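(* Let $\Lambda$ be a countable directed set and let $(X\ast\mathbf{H},\pi)=\varinjlim_{\lambda\in\Lambda}(X_\lambda\ast\mathbf{H}_\lambda,\pi_\lambda)$ be a Borel bundle of locally Hilbert spaces, with $\sigma$-algebras $\Theta_\lambda$ on $X_\lambda\ast\mathbf{H}_\lambda$, over the inductive limit $(X,\Sigma,\mu)=\varinjlim_{\lambda\in\Lambda}(X_\lambda,\Sigma_\lambda,\mu_\lambda)$ of a strictly inductive system of Borel measure spaces. Let $$\widetilde\Sigma=\{A\subseteq X\mid A\cap X_\lambda\in\Sigma_\lambda\text{ for all }\lambda\in\Lambda\},\qquad\widetilde\mu(A)=\sup_{\lambda\in\Lambda}\mu_\lambda(A\cap X_\lambda)\quad(A\in\widetilde\Sigma).$$ For each $x\in X$ let $\widetilde{\mathcal{H}}_x$ be a Hilbert space completion of the locally Hilbert space $\mathcal{H}_x$, and consider the Hilbert space bundle $\widetilde{\mathbf{H}}=\{\widetilde{\mathcal{H}}_x\}_{x\in X}$ with projection $\pi\colon X\ast\widetilde{\mathbf{H}}\to X$, $\pi(x,h)=x$. Let $$\widetilde\Theta=\{A\subseteq X\ast\widetilde{\mathbf{H}}\mid A\cap(X_\lambda\ast\mathbf{H}_\lambda)\in\Theta_\lambda\text{ for all }\lambda\in\Lambda\}.$$ Then: (1) $(X\ast\widetilde{\mathbf{H}},\widetilde\Theta)$ is a Borel bundle of Hilbert spaces and $\widetilde\Sigma=\{E\subseteq X\mid\pi^{-1}(E)\in\widetilde\Theta\}$. (2) The direct integral Hilbert space $L^2(X\ast\widetilde{\mathbf{H}},\widetilde\mu)$,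 which exists by (1), contains densely the direct integral locally Hilbert space $L^2_{\mathrm{loc}}(X\ast\mathbf{H},\mu)$.
   Context: Locally Hilbert spaces. A strictly inductive system of Hilbert spaces is a net $(\mathcal{H}_\lambda)_{\lambda\in\Lambda}$ ($\Lambda$ directed) of Hilbert spaces such that, for $\lambda\le\nu$, $\mathcal{H}_\lambda$ is a linear subspace of $\mathcal{H}_\nu$ with isometric inclusion. Its inductive limit $\mathcal{H}=\varinjlim_\lambda\mathcal{H}_\lambda:=\bigcup_\lambda\mathcal{H}_\lambda$, with the inherited inner product, is a locally Hilbert space; its completions as an inner product space are its Hilbert space completions. Measure spaces. A Borel space is a measurable space. A strictly inductive system of measurable spaces is a net $((X_\lambda,\Sigma_\lambda))_{\lambda\in\Lambda}$ with $X_\lambda\subseteq X_\nu$ and $\Sigma_\lambda=\{A\cap X_\lambda\mid A\in\Sigma_\nu\}\subseteq\Sigma_\nu$ for $\lambda\le\nu$; for measure spaces one also requires $\mu_\lambda(A)=\mu_\nu(A)$ for $A\in\Sigma_\lambda$. The inductive limit is $X=\bigcup_\lambda X_\lambda$, $\Sigma=\bigcup_\lambda\Sigma_\lambda$, and $\mu(A)=\mu_\lambda(A)$ for $A\in\Sigma_\lambda$. (It is known that $\widetilde\Sigma$ is a $\sigma$-algebra containing $\Sigma$ and $\widetilde\mu$ is a measure extending $\mu$.) Borel bundles of Hilbert spaces. For a family $\mathbf{K}=\{\mathcal{K}_x\}_{x\in Y}$ of Hilbert spaces put $Y\ast\mathbf{K}=\{(x,h)\mid x\in Y,\ h\in\mathcal{K}_x\}$,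 $\pi(x,h)=x$; a section is a map $f$ on $Y$ with $f(x)\in\mathcal{K}_x$. $(Y\ast\mathbf{K},\Theta,\pi)$ is a Borel bundle if $\Theta$ is a $\sigma$-algebra on $Y\ast\mathbf{K}$, $Y$ carries the $\sigma$-algebra $\{E\subseteq Y\mid\pi^{-1}(E)\in\Theta\}$, and there is a sequence $(f_n)$ of sections (fundamental sequence) such that: each $\tilde f_n(x,h)=\langle f_n(x),h\rangle_{\mathcal{K}_x}$ is measurable on $Y\ast\mathbf{K}$; each $x\mapsto\langle f_m(x),f_n(x)\rangle$ is measurable; and the $\tilde f_n$ together with $\pi$ separate the points of $Y\ast\mathbf{K}$. A section $f$ is Borel if and only if $x\mapsto\langle f(x),f_n(x)\rangle$ is measurable for every $n$. For a measure $\rho$ on $Y$, the direct integral Hilbert space $L^2(Y\ast\mathbf{K},\rho)=\int_Y^\oplus\mathcal{K}_x\,d\rho(x)$ consists of the Borel sections $f$ with $\int_Y\|f(x)\|^2d\rho(x)<\infty$, identified $\rho$-a.e., with inner product $\int_Y\langle f(x),g(x)\rangle d\rho(x)$. Borel bundle of locally Hilbert spaces. Let $((X_\lambda,\Sigma_\lambda,\mu_\lambda))_{\lambda\in\Lambda}$ be a strictly inductive system of measure spaces with inductive limit $(X,\Sigma,\mu)$. For each $x\in X$ let $(\mathcal{H}_{x,\lambda})_{\lambda\in\Lambda}$ be a strictly inductive system of separable Hilbert spaces and $\mathcal{H}_x=\varinjlim_\lambda\mathcal{H}_{x,\lambda}$. Put $\mathbf{H}_\lambda=\{\mathcal{H}_{x,\lambda}\}_{x\in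 X_\lambda}$, $\mathbf{H}=\{\mathcal{H}_x\}_{x\in X}$, $X\ast\mathbf{H}=\bigcup_\lambda X_\lambda\ast\mathbf{H}_\lambda=\{(x,h)\mid x\in X,\,h\in\mathcal{H}_x\}$, $\pi(x,h)=x$. $(X\ast\mathbf{H},\pi)$ is a Borel bundle of locally Hilbert spaces if: (i) there are $\sigma$-algebras $\Theta_\lambda$ such that $(X_\lambda\ast\mathbf{H}_\lambda,\Theta_\lambda,\pi_\lambda)$ is a Borel bundle of Hilbert spaces for each $\lambda$ and $((X_\lambda\ast\mathbf{H}_\lambda,\Theta_\lambda))_\lambda$ is a strictly inductive system of measurable spaces; (ii) $\Sigma_\lambda=\{E\subseteq X_\lambda\mid\pi_\lambda^{-1}(E)\in\Theta_\lambda\}$ for all $\lambda$; (iii) the Hilbert spaces $L^2_\lambda(X\ast\mathbf{H},\mu)$, consisting of all maps $f$ on $X$ with $f(x)\in\mathcal{H}_x$, $f=0$ off $X_\lambda$, $f|_{X_\lambda}$ a Borel section of $X_\lambda\ast\mathbf{H}_\lambda$ and $\int_{X_\lambda}\|f(x)\|^2_{\mathcal{H}_{x,\lambda}}d\mu_\lambda(x)<\infty$, identified $\mu_\lambda$-a.e., with inner product $\int_{X_\lambda}\langle f(x),g(x)\rangle\,d\mu_\lambda(x)$, form a strictly inductive system of Hilbert spaces. The direct integral is the locally Hilbert space $L^2_{\mathrm{loc}}(X\ast\mathbf{H},\mu)=\varinjlim_\lambda L^2_\lambda(X\ast\mathbf{H},\mu)$.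
   Formalization: The members of a fundamental sequence are additionally required to be Borel maps into the total space (in hypothesis and conclusion); without this, Borel sections and the direct integral can depend on the chosen fundamental sequence. *)

theory Defs
  imports "HOL-Analysis.Analysis" "HOL-Algebra.Module"
begin

section \<open>Complex Hilbert spaces with explicit carriers\<close>

text \<open>The fibres of a bundle vary with the base point, so inner product spaces are records over the
  modules of HOL-Algebra. The ring multiplication and unit that such records inherit play no role.\<close>

definition complex_cring :: "complex ring" where
  "complex_cring = \<lparr>carrier = UNIV, monoid.mult = (*), one = 1, ring.zero = 0, add = (+)\<rparr>"

record 'v inner_space = "(complex, 'v) module" +
  cinner :: "'v \<Rightarrow> 'v \<Rightarrow> complex"

text \<open>The inner product is linear in the first argument.\<close>

locale complex_inner_space = module complex_cring V for V :: "'v inner_space" (structure) +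
  assumes cinner_add_left:
      "\<lbrakk>u \<in> carrier V; v \<in> carrier V; w \<in> carrier V\<rbrakk>
        \<Longrightarrow> cinner V (u \<oplus>\<^bsub>V\<^esub> v) w = cinner V u w + cinner V v w"
    and cinner_smult_left:
      "\<lbrakk>u \<in> carrier V; w \<in> carrier V\<rbrakk> \<Longrightarrow> cinner V (c \<odot>\<^bsub>V\<^esub> u) w = c * cinner V u w"
    and cinner_commute:
      "\<lbrakk>u \<in> carrier V; v \<in> carrier V\<rbrakk> \<Longrightarrow> cinner V v u = cnj (cinner V u v)"
    and cinner_nonneg: "u \<in> carrier V \<Longrightarrow> 0 \<le> Re (cinner V u u)"
    and cinner_definite: "\<lbrakk>u \<in> carrier V; cinner V u u = 0\<rbrakk> \<Longrightarrow> u = \<zero>\<^bsub>V\<^esub>"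

definition vnorm :: "'v inner_space \<Rightarrow> 'v \<Rightarrow> real" where
  "vnorm V u = sqrt (Re (cinner V u u))"

text \<open>The value 0 outside the carrier is needed because the locale \<^locale>\<open>Metric_space\<close> requires
  symmetry of the distance on the whole type.\<close>

definition vdist :: "'v inner_space \<Rightarrow> 'v \<Rightarrow> 'v \<Rightarrow> real" where
  "vdist V u v = (if u \<in> carrier V \<and> v \<in> carrier V then vnorm V (u \<ominus>\<^bsub>V\<^esub> v) else 0)"

definition vtopology :: "'v inner_space \<Rightarrow> 'v topology" where
  "vtopology V = Metric_space.mtopology (carrier V) (vdist V)"

definition hilbert :: "'v inner_space \<Rightarrow> bool" where
  "hilbert V \<longleftrightarrow> complex_inner_space V \<and> Metric_space.mcomplete (carrier V) (vdist V)"

definition dense_subset :: "'v inner_space \<Rightarrow> 'v set \<Rightarrow> bool" where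
  "dense_subset V S \<longleftrightarrow> S \<subseteq> carrier V \<and> vtopology V closure_of S = carrier V"

definition isometric_subspace :: "'v inner_space \<Rightarrow> 'v inner_space \<Rightarrow> bool" where
  "isometric_subspace U V \<longleftrightarrow>
     carrier U \<subseteq> carrier V \<and>
     \<zero>\<^bsub>U\<^esub> = \<zero>\<^bsub>V\<^esub> \<and>
     (\<forall>u\<in>carrier U. \<forall>v\<in>carrier U. u \<oplus>\<^bsub>U\<^esub> v = u \<oplus>\<^bsub>V\<^esub> v) \<and>
     (\<forall>c. \<forall>u\<in>carrier U. c \<odot>\<^bsub>U\<^esub> u = c \<odot>\<^bsub>V\<^esub> u) \<and>
     (\<forall>u\<in>carrier U. \<forall>v\<in>carrier U. cinner U u v = cinner V u v)"


section \<open>Strictly inductive systems and locally Hilbert spaces\<close>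

definition directed_set :: "'i set \<Rightarrow> ('i \<Rightarrow> 'i \<Rightarrow> bool) \<Rightarrow> bool" where
  "directed_set \<Lambda> leq \<longleftrightarrow>
     \<Lambda> \<noteq> {} \<and> reflp_on \<Lambda> leq \<and> transp_on \<Lambda> leq \<and> (\<forall>i\<in>\<Lambda>. \<forall>j\<in>\<Lambda>. \<exists>k\<in>\<Lambda>. leq i k \<and> leq j k)"

definition strictly_inductive_hilbert ::
  "'i set \<Rightarrow> ('i \<Rightarrow> 'i \<Rightarrow> bool) \<Rightarrow> ('i \<Rightarrow> 'v inner_space) \<Rightarrow> bool" where
  "strictly_inductive_hilbert \<Lambda> leq H \<longleftrightarrow>
     directed_set \<Lambda> leq \<and> (\<forall>i\<in>\<Lambda>. hilbert (H i)) \<and>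
     (\<forall>i\<in>\<Lambda>. \<forall>j\<in>\<Lambda>. leq i j \<longrightarrow> isometric_subspace (H i) (H j))"

text \<open>The locally Hilbert space of a strictly inductive system: the operations are computed in any
  member of the system that contains the arguments.\<close>

definition stage :: "'i set \<Rightarrow> ('i \<Rightarrow> 'v inner_space) \<Rightarrow> 'v set \<Rightarrow> 'i" where
  "stage \<Lambda> H S = (SOME i. i \<in> \<Lambda> \<and> S \<subseteq> carrier (H i))"

definition ind_lim :: "'i set \<Rightarrow> ('i \<Rightarrow> 'v inner_space) \<Rightarrow> 'v inner_space" where
  "ind_lim \<Lambda> H =
     \<lparr>carrier = (\<Union>i\<in>\<Lambda>. carrier (H i)),
      monoid.mult = undefined, one = undefined,
      ring.zero = \<zero>\<^bsub>H (stage \<Lambda> H {})\<^esub>,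
      add = (\<lambda>u v. u \<oplus>\<^bsub>H (stage \<Lambda> H {u, v})\<^esub> v),
      module.smult = (\<lambda>c u. c \<odot>\<^bsub>H (stage \<Lambda> H {u})\<^esub> u),
      cinner = (\<lambda>u v. cinner (H (stage \<Lambda> H {u, v})) u v)\<rparr>"

definition hilbert_completion :: "'v inner_space \<Rightarrow> 'v inner_space \<Rightarrow> bool" where
  "hilbert_completion U V \<longleftrightarrow> hilbert V \<and> isometric_subspace U V \<and> dense_subset V (carrier U)"

text \<open>Measurable spaces are rendered by \<^typ>\<open>'x measure\<close>, ignoring the measure.\<close>

definition strictly_inductive_measurable ::
  "'i set \<Rightarrow> ('i \<Rightarrow> 'i \<Rightarrow> bool) \<Rightarrow> ('i \<Rightarrow> 'x measure) \<Rightarrow> bool" where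
  "strictly_inductive_measurable \<Lambda> leq M \<longleftrightarrow>
     directed_set \<Lambda> leq \<and>
     (\<forall>i\<in>\<Lambda>. \<forall>j\<in>\<Lambda>. leq i j \<longrightarrow>
        space (M i) \<subseteq> space (M j) \<and>
        sets (M i) = {A \<inter> space (M i) |A. A \<in> sets (M j)} \<and> sets (M i) \<subseteq> sets (M j))"

definition strictly_inductive_measure ::
  "'i set \<Rightarrow> ('i \<Rightarrow> 'i \<Rightarrow> bool) \<Rightarrow> ('i \<Rightarrow> 'x measure) \<Rightarrow> bool" where
  "strictly_inductive_measure \<Lambda> leq M \<longleftrightarrow>
     strictly_inductive_measurable \<Lambda> leq M \<and>
     (\<forall>i\<in>\<Lambda>. \<forall>j\<in>\<Lambda>. leq i j \<longrightarrow> (\<forall>A\<in>sets (M i). emeasure (M i) A = emeasure (M j) A))"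

definition lim_space :: "'i set \<Rightarrow> ('i \<Rightarrow> 'x measure) \<Rightarrow> 'x set" where
  "lim_space \<Lambda> M = (\<Union>i\<in>\<Lambda>. space (M i))"

definition tilde_sets :: "'x set \<Rightarrow> 'i set \<Rightarrow> ('i \<Rightarrow> 'x measure) \<Rightarrow> 'x set set" where
  "tilde_sets Y \<Lambda> M = {A. A \<subseteq> Y \<and> (\<forall>i\<in>\<Lambda>. A \<inter> space (M i) \<in> sets (M i))}"

definition tilde_measure :: "'i set \<Rightarrow> ('i \<Rightarrow> 'x measure) \<Rightarrow> 'x measure" where
  "tilde_measure \<Lambda> M =
     measure_of (lim_space \<Lambda> M) (tilde_sets (lim_space \<Lambda> M) \<Lambda> M)
       (\<lambda>A. SUP i\<in>\<Lambda>. emeasure (M i) (A \<inter> space (M i)))"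


section \<open>Borel bundles of Hilbert spaces and direct integrals\<close>

definition total_space :: "'x set \<Rightarrow> ('x \<Rightarrow> 'v inner_space) \<Rightarrow> ('x \<times> 'v) set" where
  "total_space Y K = Sigma Y (\<lambda>x. carrier (K x))"

definition base_sets :: "'x set \<Rightarrow> ('x \<times> 'v) measure \<Rightarrow> 'x set set" where
  "base_sets Y T = {E. E \<subseteq> Y \<and> fst -` E \<inter> space T \<in> sets T}"

definition base_algebra :: "'x set \<Rightarrow> ('x \<times> 'v) measure \<Rightarrow> 'x measure" where
  "base_algebra Y T = sigma Y (base_sets Y T)"

definition is_section :: "'x set \<Rightarrow> ('x \<Rightarrow> 'v inner_space) \<Rightarrow> ('x \<Rightarrow> 'v) \<Rightarrow> bool" where
  "is_section Y K s \<longleftrightarrow> (\<forall>x\<in>Y. s x \<in> carrier (K x))"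

text \<open>The members of a fundamental sequence are required to be Borel maps into the total space.
  For analytic total spaces this is automatic. In general it is what makes the notion of a
  Borel section below independent of the fundamental sequence: for fundamental sequences \<open>f\<close> and
  \<open>g\<close> the functions \<open>x \<mapsto> \<langle>f\<^sub>m(x), g\<^sub>n(x)\<rangle>\<close> are then measurable.\<close>

definition fundamental_sequence ::
  "'x set \<Rightarrow> ('x \<Rightarrow> 'v inner_space) \<Rightarrow> ('x \<times> 'v) measure \<Rightarrow> (nat \<Rightarrow> 'x \<Rightarrow> 'v) \<Rightarrow> bool" where
  "fundamental_sequence Y K T f \<longleftrightarrow>
     (\<forall>n. is_section Y K (f n)) \<and>
     (\<forall>n. (\<lambda>x. (x, f n x)) \<in> measurable (base_algebra Y T) T) \<and>
     (\<forall>n. (\<lambda>(x, h). cinner (K x) (f n x) h) \<in> borel_measurable T) \<and>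
     (\<forall>m n. (\<lambda>x. cinner (K x) (f m x) (f n x)) \<in> borel_measurable (base_algebra Y T)) \<and>
     (\<forall>(x, h)\<in>total_space Y K. \<forall>(y, k)\<in>total_space Y K.
        x = y \<and> (\<forall>n. cinner (K x) (f n x) h = cinner (K y) (f n y) k) \<longrightarrow> (x, h) = (y, k))"

definition borel_bundle ::
  "'x set \<Rightarrow> ('x \<Rightarrow> 'v inner_space) \<Rightarrow> ('x \<times> 'v) measure \<Rightarrow> bool" where
  "borel_bundle Y K T \<longleftrightarrow>
     (\<forall>x\<in>Y. hilbert (K x)) \<and> space T = total_space Y K \<and> (\<exists>f. fundamental_sequence Y K T f)"

definition borel_section ::
  "'x set \<Rightarrow> ('x \<Rightarrow> 'v inner_space) \<Rightarrow> ('x \<times> 'v) measure \<Rightarrow> ('x \<Rightarrow> 'v) \<Rightarrow> bool" where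
  "borel_section Y K T s \<longleftrightarrow>
     is_section Y K s \<and>
     (\<forall>f. fundamental_sequence Y K T f \<longrightarrow>
        (\<forall>n. (\<lambda>x. cinner (K x) (s x) (f n x)) \<in> borel_measurable (base_algebra Y T)))"

definition square_integrable_sections ::
  "'x set \<Rightarrow> ('x \<Rightarrow> 'v inner_space) \<Rightarrow> ('x \<times> 'v) measure \<Rightarrow> 'x measure \<Rightarrow> ('x \<Rightarrow> 'v) set" where
  "square_integrable_sections Y K T \<rho> =
     {s. borel_section Y K T s \<and> (\<integral>\<^sup>+x. ennreal ((vnorm (K x) (s x))\<^sup>2) \<partial>\<rho>) < \<infinity>}"

text \<open>A class modulo almost everywhere equality consists of arbitrary functions, not only of
  sections of the bundle at hand. So the class of a section does not change when the fibres are
  enlarged, and inclusions of \<open>L\<^sup>2\<close>-spaces are inclusions of sets.\<close>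

definition ae_class :: "'x measure \<Rightarrow> ('x \<Rightarrow> 'v) \<Rightarrow> ('x \<Rightarrow> 'v) set" where
  "ae_class N f = {g. AE x in N. f x = g x}"

text \<open>The space of classes modulo \<open>N\<close>-almost everywhere equality of the functions in \<open>L\<close>, with
  pointwise operations in the fibres \<open>K x\<close> and inner product given by integration over \<open>\<rho>\<close>.\<close>

definition L2_quotient ::
  "('x \<Rightarrow> 'v) set \<Rightarrow> ('x \<Rightarrow> 'v inner_space) \<Rightarrow> 'x measure \<Rightarrow> 'x measure \<Rightarrow> ('x \<Rightarrow> 'v) set inner_space" where
  "L2_quotient L K \<rho> N =
     (let rep = (\<lambda>F. SOME f. f \<in> F \<and> f \<in> L) in
      \<lparr>carrier = ae_class N ` L,
       monoid.mult = undefined, one = undefined,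
       ring.zero = ae_class N (\<lambda>x. \<zero>\<^bsub>K x\<^esub>),
       add = (\<lambda>F G. ae_class N (\<lambda>x. rep F x \<oplus>\<^bsub>K x\<^esub> rep G x)),
       module.smult = (\<lambda>c F. ae_class N (\<lambda>x. c \<odot>\<^bsub>K x\<^esub> rep F x)),
       cinner = (\<lambda>F G. \<integral>x. cinner (K x) (rep F x) (rep G x) \<partial>\<rho>)\<rparr>)"

definition direct_integral ::
  "'x set \<Rightarrow> ('x \<Rightarrow> 'v inner_space) \<Rightarrow> ('x \<times> 'v) measure \<Rightarrow> 'x measure
     \<Rightarrow> ('x \<Rightarrow> 'v) set inner_space" where
  "direct_integral Y K T \<rho> = L2_quotient (square_integrable_sections Y K T \<rho>) K \<rho> \<rho>"


section \<open>Borel bundles of locally Hilbert spaces\<close>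

text \<open>In the family \<open>H\<close>, the space \<open>H x i\<close> is the member with index \<open>i\<close> of the system over \<open>x\<close>;
  \<open>M i\<close> is the measure space and \<open>T i\<close> the total space with its sigma-algebra at index \<open>i\<close>.\<close>

definition local_sections ::
  "'i set \<Rightarrow> ('i \<Rightarrow> 'x measure) \<Rightarrow> ('x \<Rightarrow> 'i \<Rightarrow> 'v inner_space) \<Rightarrow> ('i \<Rightarrow> ('x \<times> 'v) measure) \<Rightarrow> 'i
     \<Rightarrow> ('x \<Rightarrow> 'v) set" where
  "local_sections \<Lambda> M H T i =
     {s. is_section (lim_space \<Lambda> M) (\<lambda>x. ind_lim \<Lambda> (H x)) s \<and>
         (\<forall>x\<in>lim_space \<Lambda> M - space (M i). s x = \<zero>\<^bsub>ind_lim \<Lambda> (H x)\<^esub>) \<and>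
         s \<in> square_integrable_sections (space (M i)) (\<lambda>x. H x i) (T i) (M i)}"

text \<open>For functions that vanish outside \<open>space (M i)\<close>, almost everywhere equality with respect to
  \<open>tilde_measure \<Lambda> M\<close> and to \<open>M i\<close> coincide (lemma \<open>ae_class_local_sections\<close> below). Taking
  classes modulo the former for all \<open>i\<close> makes the spaces for different \<open>i\<close> comparable.\<close>

definition local_L2 ::
  "'i set \<Rightarrow> ('i \<Rightarrow> 'x measure) \<Rightarrow> ('x \<Rightarrow> 'i \<Rightarrow> 'v inner_space) \<Rightarrow> ('i \<Rightarrow> ('x \<times> 'v) measure) \<Rightarrow> 'i
     \<Rightarrow> ('x \<Rightarrow> 'v) set inner_space" where
  "local_L2 \<Lambda> M H T i =
     L2_quotient (local_sections \<Lambda> M H T i) (\<lambda>x. ind_lim \<Lambda> (H x)) (M i) (tilde_measure \<Lambda> M)"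

definition locally_hilbert_bundle ::
  "'i set \<Rightarrow> ('i \<Rightarrow> 'i \<Rightarrow> bool) \<Rightarrow> ('i \<Rightarrow> 'x measure) \<Rightarrow> ('x \<Rightarrow> 'i \<Rightarrow> 'v inner_space)
     \<Rightarrow> ('i \<Rightarrow> ('x \<times> 'v) measure) \<Rightarrow> bool" where
  "locally_hilbert_bundle \<Lambda> leq M H T \<longleftrightarrow>
     strictly_inductive_measure \<Lambda> leq M \<and>
     (\<forall>x\<in>lim_space \<Lambda> M.
        strictly_inductive_hilbert \<Lambda> leq (H x) \<and> (\<forall>i\<in>\<Lambda>. separable_space (vtopology (H x i)))) \<and>
     (\<forall>i\<in>\<Lambda>. borel_bundle (space (M i)) (\<lambda>x. H x i) (T i)) \<and>
     strictly_inductive_measurable \<Lambda> leq T \<and>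
     (\<forall>i\<in>\<Lambda>. sets (M i) = base_sets (space (M i)) (T i)) \<and>
     strictly_inductive_hilbert \<Lambda> leq (local_L2 \<Lambda> M H T)"

definition local_direct_integral ::
  "'i set \<Rightarrow> ('i \<Rightarrow> 'x measure) \<Rightarrow> ('x \<Rightarrow> 'i \<Rightarrow> 'v inner_space) \<Rightarrow> ('i \<Rightarrow> ('x \<times> 'v) measure)
     \<Rightarrow> ('x \<Rightarrow> 'v) set inner_space" where
  "local_direct_integral \<Lambda> M H T = ind_lim \<Lambda> (local_L2 \<Lambda> M H T)"

definition tilde_total_space ::
  "'x set \<Rightarrow> ('x \<Rightarrow> 'v inner_space) \<Rightarrow> 'i set \<Rightarrow> ('i \<Rightarrow> ('x \<times> 'v) measure) \<Rightarrow> ('x \<times> 'v) measure" where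
  "tilde_total_space X Ht \<Lambda> T = sigma (total_space X Ht) (tilde_sets (total_space X Ht) \<Lambda> T)"


section \<open>The sigma-algebras and measures above are as intended\<close>

lemma sigma_algebra_base_sets:
  assumes "space T = total_space Y K"
  shows "sigma_algebra Y (base_sets Y T)"
  unfolding sigma_algebra_iff2
proof (intro conjI ballI allI impI)
  show "base_sets Y T \<subseteq> Pow Y" "{} \<in> base_sets Y T"
    by (auto simp: base_sets_def)
  fix E assume "E \<in> base_sets Y T"
  then have "E \<subseteq> Y" "fst -` E \<inter> space T \<in> sets T" by (auto simp: base_sets_def)
  moreover have "fst -` (Y - E) \<inter> space T = space T - (fst -` E \<inter> space T)"
    using assms by (auto simp: total_space_def)
  ultimately show "Y - E \<in> base_sets Y T" by (auto simp: base_sets_def)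
next
  fix A :: "nat \<Rightarrow> _" assume "range A \<subseteq> base_sets Y T"
  then have "\<And>n. A n \<subseteq> Y" "\<And>n. fst -` A n \<inter> space T \<in> sets T"
    by (auto simp: base_sets_def)
  moreover have "fst -` (\<Union>n. A n) \<inter> space T = (\<Union>n. fst -` A n \<inter> space T)" by auto
  moreover have "(\<Union>n. fst -` A n \<inter> space T) \<in> sets T"
    using calculation(2) by (intro sets.countable_UN) auto
  ultimately show "\<Union> (range A) \<in> base_sets Y T"
    unfolding base_sets_def by (simp add: UN_subset_iff)
qed

lemma base_algebra:
  assumes "space T = total_space Y K"
  shows "space (base_algebra Y T) = Y" "sets (base_algebra Y T) = base_sets Y T"
  using sigma_algebra_base_sets[OF assms]
  by (auto simp: base_algebra_def base_sets_def sigma_algebra.sigma_sets_eq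
      intro!: space_measure_of sigma_algebra.sets_measure_of_eq)

lemma sigma_algebra_tilde_sets:
  assumes "\<And>i. i \<in> \<Lambda> \<Longrightarrow> space (M i) \<subseteq> Y"
  shows "sigma_algebra Y (tilde_sets Y \<Lambda> M)"
  unfolding sigma_algebra_iff2
proof (intro conjI ballI allI impI)
  show "tilde_sets Y \<Lambda> M \<subseteq> Pow Y" "{} \<in> tilde_sets Y \<Lambda> M"
    by (auto simp: tilde_sets_def)
  fix A assume A: "A \<in> tilde_sets Y \<Lambda> M"
  have "(Y - A) \<inter> space (M i) \<in> sets (M i)" if "i \<in> \<Lambda>" for i
  proof -
    have "(Y - A) \<inter> space (M i) = space (M i) - (A \<inter> space (M i))" using assms[OF that] by auto
    then show ?thesis using A that by (auto simp: tilde_sets_def)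
  qed
  then show "Y - A \<in> tilde_sets Y \<Lambda> M" by (auto simp: tilde_sets_def)
next
  fix A :: "nat \<Rightarrow> _" assume A: "range A \<subseteq> tilde_sets Y \<Lambda> M"
  have "\<Union> (range A) \<inter> space (M i) \<in> sets (M i)" if "i \<in> \<Lambda>" for i
  proof -
    have "\<Union> (range A) \<inter> space (M i) = (\<Union>n. A n \<inter> space (M i))" by auto
    moreover have "A n \<inter> space (M i) \<in> sets (M i)" for n
      using A that by (auto simp: tilde_sets_def)
    then have "(\<Union>n. A n \<inter> space (M i)) \<in> sets (M i)" by (intro sets.countable_UN) auto
    ultimately show ?thesis by simp
  qed
  then show "\<Union> (range A) \<in> tilde_sets Y \<Lambda> M" using A by (auto simp: tilde_sets_def)
qed

lemma tilde_total_space: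
  assumes "\<And>i. i \<in> \<Lambda> \<Longrightarrow> space (T i) \<subseteq> total_space X Ht"
  shows "space (tilde_total_space X Ht \<Lambda> T) = total_space X Ht"
    "sets (tilde_total_space X Ht \<Lambda> T) = tilde_sets (total_space X Ht) \<Lambda> T"
  using sigma_algebra_tilde_sets[of \<Lambda> T "total_space X Ht", OF assms]
  by (auto simp: tilde_total_space_def tilde_sets_def
      intro!: space_measure_of sigma_algebra.sets_measure_of_eq)

lemma tilde_measure:
  assumes "strictly_inductive_measure \<Lambda> leq M"
  shows "space (tilde_measure \<Lambda> M) = lim_space \<Lambda> M"
    and "sets (tilde_measure \<Lambda> M) = tilde_sets (lim_space \<Lambda> M) \<Lambda> M"
    and "A \<in> tilde_sets (lim_space \<Lambda> M) \<Lambda> M \<Longrightarrow>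
      emeasure (tilde_measure \<Lambda> M) A = (SUP i\<in>\<Lambda>. emeasure (M i) (A \<inter> space (M i)))"
proof -
  let ?X = "lim_space \<Lambda> M"
  let ?S = "tilde_sets ?X \<Lambda> M"
  let ?m = "\<lambda>A. SUP i\<in>\<Lambda>. emeasure (M i) (A \<inter> space (M i))"
  interpret sigma_algebra ?X ?S
    by (rule sigma_algebra_tilde_sets) (auto simp: lim_space_def)
  have dir: "directed_set \<Lambda> leq"
    using assms unfolding strictly_inductive_measure_def strictly_inductive_measurable_def by blast
  have mono: "emeasure (M i) (A \<inter> space (M i)) \<le> emeasure (M j) (A \<inter> space (M j))"
    if "i \<in> \<Lambda>" "j \<in> \<Lambda>" "leq i j" "A \<in> ?S" for i j A
  proof -
    have "A \<inter> space (M i) \<in> sets (M i)" "A \<inter> space (M j) \<in> sets (M j)"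
      using that by (auto simp: tilde_sets_def)
    moreover have "emeasure (M i) (A \<inter> space (M i)) = emeasure (M j) (A \<inter> space (M i))"
      using assms that calculation by (auto simp: strictly_inductive_measure_def)
    moreover have "space (M i) \<subseteq> space (M j)"
      using assms that
      by (auto simp: strictly_inductive_measure_def strictly_inductive_measurable_def)
    ultimately show ?thesis by (auto intro!: emeasure_mono)
  qed
  show "space (tilde_measure \<Lambda> M) = ?X" "sets (tilde_measure \<Lambda> M) = ?S"
    by (auto simp: tilde_measure_def)
  have "countably_additive ?S ?m"
  proof (rule countably_additiveI)
    fix A :: "nat \<Rightarrow> _"
    assume A: "range A \<subseteq> ?S" "disjoint_family A"
    have "(\<Sum>n. ?m (A n)) = (SUP i\<in>\<Lambda>. \<Sum>n. emeasure (M i) (A n \<inter> space (M i)))"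
    proof (rule ennreal_suminf_SUP_eq_directed)
      fix N i j assume ij: "i \<in> \<Lambda>" "j \<in> \<Lambda>"
      then obtain k where k: "k \<in> \<Lambda>" "leq i k" "leq j k"
        using dir by (auto simp: directed_set_def)
      have "A n \<in> ?S" for n using A by auto
      then show "\<exists>k\<in>\<Lambda>. \<forall>n\<in>N.
          emeasure (M i) (A n \<inter> space (M i)) \<le> emeasure (M k) (A n \<inter> space (M k)) \<and>
          emeasure (M j) (A n \<inter> space (M j)) \<le> emeasure (M k) (A n \<inter> space (M k))"
        using k ij mono by blast
    qed
    also have "\<dots> = ?m (\<Union>n. A n)"
    proof (rule SUP_cong[OF refl])
      fix i assume i: "i \<in> \<Lambda>"
      have "(\<Sum>n. emeasure (M i) (A n \<inter> space (M i))) = emeasure (M i) (\<Union>n. A n \<inter> space (M i))"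
      proof (rule suminf_emeasure)
        show "range (\<lambda>n. A n \<inter> space (M i)) \<subseteq> sets (M i)"
          using A i by (auto simp: tilde_sets_def)
        show "disjoint_family (\<lambda>n. A n \<inter> space (M i))"
          using A(2) by (rule disjoint_family_on_bisimulation) auto
      qed
      moreover have "(\<Union>n. A n \<inter> space (M i)) = (\<Union>n. A n) \<inter> space (M i)" by auto
      ultimately show "(\<Sum>n. emeasure (M i) (A n \<inter> space (M i)))
          = emeasure (M i) ((\<Union>n. A n) \<inter> space (M i))" by simp
    qed
    finally show "(\<Sum>n. ?m (A n)) = ?m (\<Union>n. A n)" .
  qed
  moreover have "positive ?S ?m" using dir by (simp add: positive_def directed_set_def)
  ultimately show "emeasure (tilde_measure \<Lambda> M) A = ?m A" if "A \<in> ?S"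
    using that sigma_algebra_axioms
    by (simp add: tilde_measure_def emeasure_measure_of_sigma)
qed

lemma local_sections_zero:
  "\<lbrakk>s \<in> local_sections \<Lambda> M H T i; x \<in> lim_space \<Lambda> M; x \<notin> space (M i)\<rbrakk>
    \<Longrightarrow> s x = \<zero>\<^bsub>ind_lim \<Lambda> (H x)\<^esub>"
  by (auto simp: local_sections_def)

lemma ae_class_local_sections:
  assumes M: "strictly_inductive_measure \<Lambda> leq M" and i: "i \<in> \<Lambda>"
    and f: "f \<in> local_sections \<Lambda> M H T i" and g: "g \<in> local_sections \<Lambda> M H T i"
  shows "ae_class (tilde_measure \<Lambda> M) f = ae_class (tilde_measure \<Lambda> M) g
    \<longleftrightarrow> (AE x in M i. f x = g x)"
proof -
  let ?N = "tilde_measure \<Lambda> M"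
  note tm = tilde_measure[OF M]
  have ind: "A \<inter> space (M j) \<in> sets (M j)" "B \<in> sets (M j) \<Longrightarrow> B \<in> sets (M k)"
      "B \<in> sets (M j) \<Longrightarrow> emeasure (M j) B = emeasure (M k) B"
    if "j \<in> \<Lambda>" "k \<in> \<Lambda>" "leq j k" "A \<in> sets (M k)" for j k A B
  proof -
    note unf = M[unfolded strictly_inductive_measure_def strictly_inductive_measurable_def]
    note jk = unf[THEN conjunct1, THEN conjunct2, rule_format, OF that(1-3),
        THEN conjunct2, THEN conjunct1]
      unf[THEN conjunct1, THEN conjunct2, rule_format, OF that(1-3),
        THEN conjunct2, THEN conjunct2]
    have jk': "emeasure (M j) A = emeasure (M k) A" if "A \<in> sets (M j)" for A
      by (rule unf[THEN conjunct2, rule_format, OF \<open>j \<in> \<Lambda>\<close> \<open>k \<in> \<Lambda>\<close> \<open>leq j k\<close> that])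
    show "A \<inter> space (M j) \<in> sets (M j)"
      by (subst jk(1)) (use that(4) in blast)
    show "B \<in> sets (M j) \<Longrightarrow> B \<in> sets (M k)" by (rule subsetD[OF jk(2)])
    show "B \<in> sets (M j) \<Longrightarrow> emeasure (M j) B = emeasure (M k) B" by (rule jk')
  qed
  have dir: "directed_set \<Lambda> leq"
    using M unfolding strictly_inductive_measure_def strictly_inductive_measurable_def by blast
  have "ae_class ?N f = ae_class ?N g \<longleftrightarrow> (AE x in ?N. f x = g x)"
  proof
    assume "ae_class ?N f = ae_class ?N g"
    moreover have "g \<in> ae_class ?N g" by (simp add: ae_class_def)
    ultimately have "g \<in> ae_class ?N f" by simp
    then show "AE x in ?N. f x = g x" by (simp add: ae_class_def)
  next
    assume fg: "AE x in ?N. f x = g x"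
    show "ae_class ?N f = ae_class ?N g"
    proof (unfold ae_class_def, intro Collect_cong iffI)
      fix h
      show "AE x in ?N. g x = h x" if "AE x in ?N. f x = h x"
        using fg that by eventually_elim simp
      show "AE x in ?N. f x = h x" if "AE x in ?N. g x = h x"
        using fg that by eventually_elim simp
    qed
  qed
  also have "\<dots> \<longleftrightarrow> (AE x in M i. f x = g x)"
  proof
    assume "AE x in ?N. f x = g x"
    then obtain Z where Z: "{x \<in> space ?N. f x \<noteq> g x} \<subseteq> Z" "emeasure ?N Z = 0" "Z \<in> sets ?N"
      by (rule AE_E)
    have Z': "Z \<in> tilde_sets (lim_space \<Lambda> M) \<Lambda> M" using Z tm by simp
    then have "emeasure (M i) (Z \<inter> space (M i)) \<le> emeasure ?N Z"
      using i by (simp only: tm(3)) (rule SUP_upper)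
    then have "emeasure (M i) (Z \<inter> space (M i)) = 0" using Z by simp
    moreover have "Z \<inter> space (M i) \<in> sets (M i)" using Z' i by (auto simp: tilde_sets_def)
    moreover have "{x \<in> space (M i). f x \<noteq> g x} \<subseteq> Z \<inter> space (M i)"
      using Z(1) i tm(1) by (auto simp: lim_space_def)
    ultimately show "AE x in M i. f x = g x" by (intro AE_I)
  next
    assume "AE x in M i. f x = g x"
    then obtain Z where Z: "{x \<in> space (M i). f x \<noteq> g x} \<subseteq> Z" "emeasure (M i) Z = 0"
      "Z \<in> sets (M i)"
      by (rule AE_E)
    have *: "Z \<inter> space (M j) \<in> sets (M j) \<and> emeasure (M j) (Z \<inter> space (M j)) = 0"
      if j: "j \<in> \<Lambda>" for j
    proof -
      obtain k where k: "k \<in> \<Lambda>" "leq i k" "leq j k"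
        using dir i j by (auto simp: directed_set_def)
      have Zk: "Z \<in> sets (M k)" "emeasure (M k) Z = 0"
        using ind(2,3)[OF i k(1,2) sets.top Z(3)] Z(2) by simp_all
      have Zj: "Z \<inter> space (M j) \<in> sets (M j)" using ind(1)[OF j k(1,3) Zk(1)] .
      have "emeasure (M j) (Z \<inter> space (M j)) = emeasure (M k) (Z \<inter> space (M j))"
        using ind(3)[OF j k(1,3) Zk(1) Zj] .
      also have "\<dots> \<le> emeasure (M k) Z" using Zk by (intro emeasure_mono) auto
      finally show ?thesis using Zj Zk(2) by simp
    qed
    have Z': "Z \<in> tilde_sets (lim_space \<Lambda> M) \<Lambda> M"
      using * sets.sets_into_space[OF Z(3)] i unfolding tilde_sets_def lim_space_def by blast
    have "emeasure ?N Z = 0"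
      using dir * by (simp add: tm(3)[OF Z'] directed_set_def)
    moreover have "x \<in> Z" if "x \<in> space ?N" "f x \<noteq> g x" for x
    proof -
      have "x \<in> space (M i)"
        using that tm(1) local_sections_zero[OF f, of x] local_sections_zero[OF g, of x] by force
      then show ?thesis using Z(1) that by blast
    qed
    moreover from this have "{x \<in> space ?N. f x \<noteq> g x} \<subseteq> Z" by blast
    ultimately show "AE x in ?N. f x = g x"
      using Z' tm(2) by (intro AE_I) simp_all
  qed
  finally show ?thesis .
qed

end

theory Submission
  imports Defs
begin

text \<open>
  Along a cofinal sequence of stages, the fundamental sequences of the stages combine to a countable
  family of sections of the completed bundle. It separates points, because the members of a
  fundamental sequence are total in their fibres and the fibres of the stages are dense in those of
  the completed bundle. All measurability questions reduce to one principle: a section whose inner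
  products with a fundamental sequence are measurable is a pointwise limit of countable pieces of
  rational combinations of that sequence.

  A square integrable section \<open>s\<close> of the completed bundle is approximated by cutting it off outside a
  stage and projecting its values orthogonally to the fibres of that stage. The projections converge
  pointwise to \<open>s\<close> and are dominated by \<open>s\<close>, so they converge in \<open>L\<^sup>2\<close>.
\<close>

section \<open>Inner product spaces\<close>

text \<open>The \<open>\<sigma>\<close>-algebra of the completed bundle sees only traces on the
  stages, and the trace on a stage is determined by the trace on any later one. So measurability may
  be tested along the cofinal sequence, from any index on, and points of a completed fibre outside
  every stage cause no trouble. The obstacle is that fundamental sequences of different stages have
  to be compared. The link is that their members are Borel maps into the total spaces: for
  \<open>k \<le> l\<close> this makes the inner products of \<open>F (c l) m\<close> with the
  sections taken from stage \<open>c k\<close> measurable. The approximation principle does the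
  rest. It is applied over the base, and also over the total space, where the fibre coordinate is
  itself a section of the pulled back bundle. It allows one of the two arguments to lie in a larger
  space than the frame, so that sections of a stage can be paired with sections of the completed
  bundle. Projection to a stage preserves measurability because the inner products of the projected
  section with the fundamental sequence of the stage equal those of the section itself.\<close>

lemma complex_cring_simps [simp]:
  "carrier complex_cring = UNIV" "a \<oplus>\<^bsub>complex_cring\<^esub> b = a + b"
  "a \<otimes>\<^bsub>complex_cring\<^esub> b = a * b" "\<one>\<^bsub>complex_cring\<^esub> = 1" "\<zero>\<^bsub>complex_cring\<^esub> = 0"
  by (simp_all add: complex_cring_def)

context complex_inner_space
begin

lemma minus_closed [simp, intro]:
  "u \<in> carrier V \<Longrightarrow> v \<in> carrier V \<Longrightarrow> u \<ominus>\<^bsub>V\<^esub> v \<in> carrier V"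
  by (rule M.minus_closed)

lemma smult_closed' [simp, intro]: "u \<in> carrier V \<Longrightarrow> c \<odot>\<^bsub>V\<^esub> u \<in> carrier V"
  by (rule smult_closed) simp_all

lemma uminus_eq_smult:
  assumes "v \<in> carrier V"
  shows "\<ominus>\<^bsub>V\<^esub> v = (-1) \<odot>\<^bsub>V\<^esub> v"
proof -
  have "(-1) \<odot>\<^bsub>V\<^esub> v \<oplus>\<^bsub>V\<^esub> v = ((-1) \<oplus>\<^bsub>complex_cring\<^esub> \<one>\<^bsub>complex_cring\<^esub>) \<odot>\<^bsub>V\<^esub> v"
    using assms smult_one[OF assms] by (subst smult_l_distr) simp_all
  also have "\<dots> = \<zero>\<^bsub>V\<^esub>" using assms smult_l_null[OF assms] by simp
  finally show ?thesis using assms by (intro M.minus_equality) simp_all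
qed

lemma minus_eq_smult: "v \<in> carrier V \<Longrightarrow> u \<ominus>\<^bsub>V\<^esub> v = u \<oplus>\<^bsub>V\<^esub> (-1) \<odot>\<^bsub>V\<^esub> v"
  by (simp add: a_minus_def uminus_eq_smult)

lemma cinner_add_right:
  assumes "u \<in> carrier V" "v \<in> carrier V" "w \<in> carrier V"
  shows "cinner V w (u \<oplus>\<^bsub>V\<^esub> v) = cinner V w u + cinner V w v"
proof -
  have "cinner V w (u \<oplus>\<^bsub>V\<^esub> v) = cnj (cinner V (u \<oplus>\<^bsub>V\<^esub> v) w)"
    using assms by (intro cinner_commute) auto
  then show ?thesis
    using assms cinner_commute[of u w] cinner_commute[of v w] by (simp add: cinner_add_left)
qed

lemma cinner_smult_right:
  assumes "u \<in> carrier V" "w \<in> carrier V"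
  shows "cinner V w (c \<odot>\<^bsub>V\<^esub> u) = cnj c * cinner V w u"
proof -
  have "cinner V w (c \<odot>\<^bsub>V\<^esub> u) = cnj (cinner V (c \<odot>\<^bsub>V\<^esub> u) w)"
    using assms by (intro cinner_commute) auto
  then show ?thesis
    using assms cinner_commute[of u w] by (simp add: cinner_smult_left)
qed

lemma cinner_minus_left:
  "\<lbrakk>u \<in> carrier V; v \<in> carrier V; w \<in> carrier V\<rbrakk>
    \<Longrightarrow> cinner V (u \<ominus>\<^bsub>V\<^esub> v) w = cinner V u w - cinner V v w"
  by (simp add: minus_eq_smult cinner_add_left cinner_smult_left)

lemma cinner_minus_right:
  "\<lbrakk>u \<in> carrier V; v \<in> carrier V; w \<in> carrier V\<rbrakk>
    \<Longrightarrow> cinner V w (u \<ominus>\<^bsub>V\<^esub> v) = cinner V w u - cinner V w v"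
  by (simp add: minus_eq_smult cinner_add_right cinner_smult_right)

lemma cinner_zero_left [simp]: "w \<in> carrier V \<Longrightarrow> cinner V \<zero>\<^bsub>V\<^esub> w = 0"
  using cinner_add_left[of "\<zero>\<^bsub>V\<^esub>" "\<zero>\<^bsub>V\<^esub>" w] by simp

lemma cinner_zero_right [simp]: "w \<in> carrier V \<Longrightarrow> cinner V w \<zero>\<^bsub>V\<^esub> = 0"
  using cinner_add_right[of "\<zero>\<^bsub>V\<^esub>" "\<zero>\<^bsub>V\<^esub>" w] by simp

lemmas cinner_expand = cinner_add_left cinner_add_right cinner_minus_left cinner_minus_right
  cinner_smult_left cinner_smult_right

lemma vnorm_nonneg [simp]: "u \<in> carrier V \<Longrightarrow> 0 \<le> vnorm V u"
  by (simp add: vnorm_def cinner_nonneg)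

lemma vnorm_power2: "u \<in> carrier V \<Longrightarrow> (vnorm V u)\<^sup>2 = Re (cinner V u u)"
  by (simp add: vnorm_def cinner_nonneg)

lemma cinner_self: "u \<in> carrier V \<Longrightarrow> cinner V u u = complex_of_real ((vnorm V u)\<^sup>2)"
  using cinner_commute[of u u] by (auto simp: vnorm_power2 complex_eq_iff)

lemma vnorm_eq_0_iff: "u \<in> carrier V \<Longrightarrow> vnorm V u = 0 \<longleftrightarrow> u = \<zero>\<^bsub>V\<^esub>"
  using cinner_self[of u] cinner_definite[of u] by (auto simp: vnorm_def)

lemma vnorm_zero [simp]: "vnorm V \<zero>\<^bsub>V\<^esub> = 0"
  by (simp add: vnorm_def)

lemma minus_eq_zero_iff:
  assumes "u \<in> carrier V" "v \<in> carrier V"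
  shows "u \<ominus>\<^bsub>V\<^esub> v = \<zero>\<^bsub>V\<^esub> \<longleftrightarrow> u = v"
  using assms M.minus_equality[of u "\<ominus>\<^bsub>V\<^esub> v"] by (auto simp: a_minus_def M.r_neg)

lemma minus_zero_right [simp]: "u \<in> carrier V \<Longrightarrow> u \<ominus>\<^bsub>V\<^esub> \<zero>\<^bsub>V\<^esub> = u"
  by (simp add: minus_eq_smult)

lemma vnorm_minus_power2:
  assumes "u \<in> carrier V" "v \<in> carrier V"
  shows "(vnorm V (u \<ominus>\<^bsub>V\<^esub> v))\<^sup>2 = (vnorm V u)\<^sup>2 + (vnorm V v)\<^sup>2 - 2 * Re (cinner V u v)"
  using assms cinner_commute[of u v] by (simp add: vnorm_power2 cinner_expand)

lemma vnorm_add_power2: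
  assumes "u \<in> carrier V" "v \<in> carrier V"
  shows "(vnorm V (u \<oplus>\<^bsub>V\<^esub> v))\<^sup>2 = (vnorm V u)\<^sup>2 + (vnorm V v)\<^sup>2 + 2 * Re (cinner V u v)"
  using assms cinner_commute[of u v] by (simp add: vnorm_power2 cinner_expand)

lemma vnorm_smult: "u \<in> carrier V \<Longrightarrow> vnorm V (c \<odot>\<^bsub>V\<^esub> u) = cmod c * vnorm V u"
proof -
  assume u: "u \<in> carrier V"
  have "(vnorm V (c \<odot>\<^bsub>V\<^esub> u))\<^sup>2 = (cmod c * vnorm V u)\<^sup>2"
    using u by (simp add: vnorm_power2 cinner_expand power_mult_distrib cmod_power2)
      (simp add: power2_eq_square algebra_simps)
  then show ?thesis using u by simp
qed

lemma vnorm_minus_commute: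
  assumes "u \<in> carrier V" "v \<in> carrier V"
  shows "vnorm V (u \<ominus>\<^bsub>V\<^esub> v) = vnorm V (v \<ominus>\<^bsub>V\<^esub> u)"
proof -
  have "(vnorm V (u \<ominus>\<^bsub>V\<^esub> v))\<^sup>2 = (vnorm V (v \<ominus>\<^bsub>V\<^esub> u))\<^sup>2"
    using assms cinner_commute[of u v] by (simp add: vnorm_minus_power2)
  then show ?thesis using assms by simp
qed

lemma Cauchy_Schwarz:
  assumes u: "u \<in> carrier V" and v: "v \<in> carrier V"
  shows "cmod (cinner V u v) \<le> vnorm V u * vnorm V v"
proof (cases "vnorm V v = 0")
  case True
  then show ?thesis using assms by (simp add: vnorm_eq_0_iff)
next
  case False
  define b where "b = (vnorm V v)\<^sup>2"
  define z where "z = cinner V u v"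
  have b: "b > 0" using False by (simp add: b_def)
  \<comment> \<open>The coefficient of the orthogonal projection of \<open>u\<close> onto the line
    through \<open>v\<close>; the inequality is the nonnegativity of the squared norm of the
    remainder.\<close>
  define c where "c = z / complex_of_real b"
  have "0 \<le> (vnorm V (u \<ominus>\<^bsub>V\<^esub> c \<odot>\<^bsub>V\<^esub> v))\<^sup>2" by simp
  also have "\<dots> = (vnorm V u)\<^sup>2 + (cmod c)\<^sup>2 * b - 2 * Re (cnj c * z)"
    using assms by (simp add: vnorm_minus_power2 vnorm_smult cinner_expand b_def z_def
        power_mult_distrib)
  also have "cnj c * z = complex_of_real ((cmod z)\<^sup>2 / b)"
    unfolding c_def 
    by (simp add: mult.commute[of "cnj z"] complex_mult_cnj cmod_power2)
  also have "(cmod c)\<^sup>2 * b = (cmod z)\<^sup>2 / b"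
    using b by (simp add: c_def norm_divide power2_eq_square)
  finally have "(cmod z)\<^sup>2 / b \<le> (vnorm V u)\<^sup>2" by simp
  then have "(cmod z)\<^sup>2 \<le> (vnorm V u * vnorm V v)\<^sup>2"
    using b by (simp add: divide_le_eq b_def power_mult_distrib)
  then show ?thesis
    unfolding z_def by (rule power2_le_imp_le) (use assms in simp)
qed

lemma vnorm_triangle:
  assumes u: "u \<in> carrier V" and v: "v \<in> carrier V"
  shows "vnorm V (u \<oplus>\<^bsub>V\<^esub> v) \<le> vnorm V u + vnorm V v"
proof (rule power2_le_imp_le)
  have "Re (cinner V u v) \<le> vnorm V u * vnorm V v"
    using Cauchy_Schwarz[OF assms] complex_Re_le_cmod order_trans by blast
  then show "(vnorm V (u \<oplus>\<^bsub>V\<^esub> v))\<^sup>2 \<le> (vnorm V u + vnorm V v)\<^sup>2"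
    using assms by (simp add: vnorm_add_power2 power2_sum)
qed (use assms in simp)

lemma minus_add_minus:
  assumes "u \<in> carrier V" "v \<in> carrier V" "w \<in> carrier V"
  shows "(u \<ominus>\<^bsub>V\<^esub> v) \<oplus>\<^bsub>V\<^esub> (v \<ominus>\<^bsub>V\<^esub> w) = u \<ominus>\<^bsub>V\<^esub> w"
  using assms by (simp add: a_minus_def M.a_assoc M.r_neg1)

lemma vnorm_triangle_minus:
  assumes "u \<in> carrier V" "v \<in> carrier V" "w \<in> carrier V"
  shows "vnorm V (u \<ominus>\<^bsub>V\<^esub> w) \<le> vnorm V (u \<ominus>\<^bsub>V\<^esub> v) + vnorm V (v \<ominus>\<^bsub>V\<^esub> w)"
  using vnorm_triangle[of "u \<ominus>\<^bsub>V\<^esub> v" "v \<ominus>\<^bsub>V\<^esub> w"] assms by (simp add: minus_add_minus)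

lemma vnorm_le_minus:
  assumes "u \<in> carrier V" "v \<in> carrier V"
  shows "vnorm V u \<le> vnorm V v + vnorm V (u \<ominus>\<^bsub>V\<^esub> v)"
  using vnorm_triangle_minus[of u v "\<zero>\<^bsub>V\<^esub>"] assms by simp

lemma vnorm_minus_le:
  assumes "u \<in> carrier V" "v \<in> carrier V"
  shows "vnorm V (u \<ominus>\<^bsub>V\<^esub> v) \<le> vnorm V u + vnorm V v"
  using vnorm_triangle[of u "(-1) \<odot>\<^bsub>V\<^esub> v"] assms by (simp add: minus_eq_smult vnorm_smult)

lemma tendsto_cinner_left:
  assumes s: "\<And>n. s n \<in> carrier V" and p: "p \<in> carrier V" and w: "w \<in> carrier V"
    and lim: "(\<lambda>n. vnorm V (s n \<ominus>\<^bsub>V\<^esub> p)) \<longlonglongrightarrow> 0"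
  shows "(\<lambda>n. cinner V (s n) w) \<longlonglongrightarrow> cinner V p w"
proof (rule LIM_zero_cancel, rule Lim_null_comparison)
  show "\<forall>\<^sub>F n in sequentially. norm (cinner V (s n) w - cinner V p w)
      \<le> vnorm V (s n \<ominus>\<^bsub>V\<^esub> p) * vnorm V w"
    using Cauchy_Schwarz[OF minus_closed[OF s p] w] s p w by (simp add: cinner_minus_left)
  show "(\<lambda>n. vnorm V (s n \<ominus>\<^bsub>V\<^esub> p) * vnorm V w) \<longlonglongrightarrow> 0"
    using tendsto_mult_left_zero[OF lim] .
qed

section \<open>Density and completeness in terms of norms\<close>

lemma Metric_space: "Metric_space (carrier V) (vdist V)"
proof
  show "0 \<le> vdist V x y" for x y by (simp add: vdist_def)
  show "vdist V x y = vdist V y x" for x y by (simp add: vdist_def vnorm_minus_commute)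
  show "(vdist V x y = 0) = (x = y)" if "x \<in> carrier V" "y \<in> carrier V" for x y
    using that by (simp add: vdist_def vnorm_eq_0_iff minus_eq_zero_iff)
  show "vdist V x z \<le> vdist V x y + vdist V y z"
    if "x \<in> carrier V" "y \<in> carrier V" "z \<in> carrier V" for x y z
    using that by (simp add: vdist_def vnorm_triangle_minus)
qed

lemma dense_subset_iff:
  "dense_subset V S \<longleftrightarrow> S \<subseteq> carrier V \<and> (\<forall>v\<in>carrier V. \<forall>e>0. \<exists>s\<in>S. vnorm V (v \<ominus>\<^bsub>V\<^esub> s) < e)"
proof -
  interpret Metric_space "carrier V" "vdist V" by (rule Metric_space)
  show ?thesis
  proof (cases "S \<subseteq> carrier V")
    case True
    then have "vtopology V closure_of S =
        {x \<in> carrier V. \<forall>e>0. \<exists>y\<in>S. vnorm V (x \<ominus>\<^bsub>V\<^esub> y) < e}"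
      by (auto simp: vtopology_def metric_closure_of vdist_def subset_iff Bex_def)
    then show ?thesis unfolding dense_subset_def using True by blast
  qed (simp add: dense_subset_def)
qed

text \<open>On the carrier, \<open>vdist\<close> is the norm of the difference. So completeness can
  be established here, and exploited in \<open>hilbert_limit\<close>, with norms of sequences
  alone.\<close>

lemma hilbertI:
  assumes "\<And>s. \<lbrakk>\<And>n. s n \<in> carrier V; \<And>e. e > 0 \<Longrightarrow> \<exists>N. \<forall>m\<ge>N. \<forall>n\<ge>N. vnorm V (s m \<ominus>\<^bsub>V\<^esub> s n) < e\<rbrakk>
    \<Longrightarrow> \<exists>p\<in>carrier V. (\<lambda>n. vnorm V (s n \<ominus>\<^bsub>V\<^esub> p)) \<longlonglongrightarrow> 0"
  shows "hilbert V"
proof -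
  interpret Metric_space "carrier V" "vdist V" by (rule Metric_space)
  have "\<exists>x. limitin mtopology s x sequentially" if "MCauchy s" for s
  proof -
    have s: "s n \<in> carrier V" for n using that by (auto simp: MCauchy_def)
    have "\<exists>N. \<forall>m\<ge>N. \<forall>n\<ge>N. vnorm V (s m \<ominus>\<^bsub>V\<^esub> s n) < e" if "e > 0" for e
      using \<open>MCauchy s\<close> that s unfolding MCauchy_def vdist_def by simp
    then obtain p where "p \<in> carrier V" "(\<lambda>n. vnorm V (s n \<ominus>\<^bsub>V\<^esub> p)) \<longlonglongrightarrow> 0"
      using assms s by blast
    then show ?thesis using s by (auto simp: limitin_metric_dist_null vdist_def)
  qed
  then show ?thesis
    unfolding hilbert_def mcomplete_def using complex_inner_space_axioms by blast
qed

end

lemma hilbert_imp_complex_inner_space: "hilbert V \<Longrightarrow> complex_inner_space V"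
  by (simp add: hilbert_def)

lemma hilbert_limit:
  assumes "hilbert V" and s: "\<And>n. s n \<in> carrier V"
    and "\<And>e. e > 0 \<Longrightarrow> \<exists>N. \<forall>m\<ge>N. \<forall>n\<ge>N. vnorm V (s m \<ominus>\<^bsub>V\<^esub> s n) < e"
  shows "\<exists>p\<in>carrier V. (\<lambda>n. vnorm V (s n \<ominus>\<^bsub>V\<^esub> p)) \<longlonglongrightarrow> 0"
proof -
  interpret complex_inner_space V using assms(1) by (simp add: hilbert_def)
  interpret Metric_space "carrier V" "vdist V" by (rule Metric_space)
  have "MCauchy s" using assms(3) s unfolding MCauchy_def vdist_def by (simp add: image_subset_iff)
  then obtain p where "limitin mtopology s p sequentially"
    using assms(1) unfolding hilbert_def mcomplete_def by blast
  then show ?thesis using s by (auto simp: limitin_metric_dist_null vdist_def)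
qed

text \<open>The exact partial sum of the geometric series is kept, because the weaker bound
  \<open>2 * C * (1/2)^n\<close> would not survive the induction on \<open>m\<close>.\<close>

lemma (in complex_inner_space) geometric_sequence_bound:
  assumes s: "\<And>n. s n \<in> carrier V"
    and step: "\<And>n. vnorm V (s (Suc n) \<ominus>\<^bsub>V\<^esub> s n) \<le> C * (1/2)^n"
    and mn: "n \<le> m"
  shows "vnorm V (s m \<ominus>\<^bsub>V\<^esub> s n) \<le> 2 * C * ((1/2)^n - (1/2)^m)"
  using mn
proof (induction m rule: dec_induct)
  case base
  then show ?case using s by (simp add: M.r_neg a_minus_def)
next
  case (step m)
  have "vnorm V (s (Suc m) \<ominus>\<^bsub>V\<^esub> s n) \<le> vnorm V (s (Suc m) \<ominus>\<^bsub>V\<^esub> s m) + vnorm V (s m \<ominus>\<^bsub>V\<^esub> s n)"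
    by (intro vnorm_triangle_minus s)
  also have "\<dots> \<le> C * (1/2)^m + 2 * C * ((1/2)^n - (1/2)^m)"
    using step.IH assms(2)[of m] by linarith
  also have "\<dots> = 2 * C * ((1/2)^n - (1/2)^Suc m)" by (simp add: algebra_simps)
  finally show ?case .
qed

text \<open>Geometrically decreasing increments make the sequence Cauchy. This is applied fibre by
  fibre to the subsequence in the completeness proof of the direct integral.\<close>

lemma hilbert_geometric_limit:
  assumes V: "hilbert V" and s: "\<And>n. s n \<in> carrier V"
    and step: "\<And>n. vnorm V (s (Suc n) \<ominus>\<^bsub>V\<^esub> s n) \<le> C * (1/2)^n"
  shows "\<exists>p\<in>carrier V. (\<lambda>n. vnorm V (s n \<ominus>\<^bsub>V\<^esub> p)) \<longlonglongrightarrow> 0"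
proof (rule hilbert_limit[OF V s])
  interpret complex_inner_space V using V by (rule hilbert_imp_complex_inner_space)
  fix e :: real assume e: "e > 0"
  have C: "C \<ge> 0" using step[of 0] vnorm_nonneg[OF minus_closed[OF s s], of 1 0] by simp
  have "(\<lambda>n. 2 * C * (1/2)^n) \<longlonglongrightarrow> 2 * C * 0"
    by (intro tendsto_intros LIMSEQ_realpow_zero) auto
  then have "\<forall>\<^sub>F n in sequentially. 2 * C * (1/2)^n < e"
    using e by (intro order_tendstoD(2)) auto
  then obtain N where N: "\<And>n. n \<ge> N \<Longrightarrow> 2 * C * (1/2)^n < e" by (auto simp: eventually_sequentially)
  have "vnorm V (s m \<ominus>\<^bsub>V\<^esub> s n) < e" if "n \<ge> N" "n \<le> m" for m n
  proof -
    have "vnorm V (s m \<ominus>\<^bsub>V\<^esub> s n) \<le> 2 * C * ((1/2)^n - (1/2)^m)"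
      by (rule geometric_sequence_bound[OF s step that(2)])
    also have "\<dots> \<le> 2 * C * (1/2)^n" using C by (intro mult_left_mono) auto
    finally show ?thesis using N[OF that(1)] by linarith
  qed
  then have "vnorm V (s m \<ominus>\<^bsub>V\<^esub> s n) < e" if "m \<ge> N" "n \<ge> N" for m n
    using that vnorm_minus_commute[OF s s, of m n] by (metis nat_le_linear)
  then show "\<exists>N. \<forall>m\<ge>N. \<forall>n\<ge>N. vnorm V (s m \<ominus>\<^bsub>V\<^esub> s n) < e" by blast
qed

section \<open>Isometric subspaces and projections\<close>

lemma isometric_subspace_refl: "isometric_subspace V V"
  by (simp add: isometric_subspace_def)

lemma isometric_subspace_trans:
  assumes "isometric_subspace U V" "isometric_subspace V W"
  shows "isometric_subspace U W"
proof -
  note UV = assms(1)[unfolded isometric_subspace_def] and VW = assms(2)[unfolded isometric_subspace_def]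
  have "u \<in> carrier V" if "u \<in> carrier U" for u using UV that by blast
  then show ?thesis unfolding isometric_subspace_def using UV VW by auto
qed

lemma isometric_subspaceD:
  assumes "isometric_subspace U V"
  shows "u \<in> carrier U \<Longrightarrow> u \<in> carrier V" "\<zero>\<^bsub>U\<^esub> = \<zero>\<^bsub>V\<^esub>"
    "u \<in> carrier U \<Longrightarrow> v \<in> carrier U \<Longrightarrow> u \<oplus>\<^bsub>U\<^esub> v = u \<oplus>\<^bsub>V\<^esub> v"
    "u \<in> carrier U \<Longrightarrow> a \<odot>\<^bsub>U\<^esub> u = a \<odot>\<^bsub>V\<^esub> u"
    "u \<in> carrier U \<Longrightarrow> v \<in> carrier U \<Longrightarrow> cinner U u v = cinner V u v"
  using assms by (auto simp: isometric_subspace_def)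

locale isometric_inclusion = U: complex_inner_space U + V: complex_inner_space V
  for U V :: "'v inner_space" +
  assumes sub: "isometric_subspace U V"
begin

lemma carrier_mono: "u \<in> carrier U \<Longrightarrow> u \<in> carrier V"
  using sub by (auto simp: isometric_subspace_def)

lemma zero_eq: "\<zero>\<^bsub>U\<^esub> = \<zero>\<^bsub>V\<^esub>"
  using sub by (auto simp: isometric_subspace_def)

lemma add_eq: "u \<in> carrier U \<Longrightarrow> v \<in> carrier U \<Longrightarrow> u \<oplus>\<^bsub>U\<^esub> v = u \<oplus>\<^bsub>V\<^esub> v"
  using sub by (auto simp: isometric_subspace_def)

lemma smult_eq: "u \<in> carrier U \<Longrightarrow> c \<odot>\<^bsub>U\<^esub> u = c \<odot>\<^bsub>V\<^esub> u"
  using sub by (auto simp: isometric_subspace_def)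

lemma cinner_eq: "u \<in> carrier U \<Longrightarrow> v \<in> carrier U \<Longrightarrow> cinner U u v = cinner V u v"
  using sub by (auto simp: isometric_subspace_def)

lemma minus_eq: "u \<in> carrier U \<Longrightarrow> v \<in> carrier U \<Longrightarrow> u \<ominus>\<^bsub>U\<^esub> v = u \<ominus>\<^bsub>V\<^esub> v"
  using U.smult_closed'[of v "-1"]
  by (simp add: U.minus_eq_smult V.minus_eq_smult carrier_mono add_eq smult_eq)

lemma vnorm_eq: "u \<in> carrier U \<Longrightarrow> vnorm U u = vnorm V u"
  by (simp add: vnorm_def cinner_eq)

end

lemma isometric_inclusionI:
  "complex_inner_space U \<Longrightarrow> complex_inner_space V \<Longrightarrow> isometric_subspace U V
    \<Longrightarrow> isometric_inclusion U V"
  by (simp add: isometric_inclusion_def isometric_inclusion_axioms_def)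

text \<open>A minimising sequence in \<open>S\<close> for the distance to \<open>h\<close> is Cauchy by the parallelogram law.\<close>

lemma (in isometric_inclusion) projection:
  assumes U: "hilbert U" and S: "S \<subseteq> carrier U" "S \<noteq> {}" and h: "h \<in> carrier V"
    and S_add: "\<And>u v. u \<in> S \<Longrightarrow> v \<in> S \<Longrightarrow> u \<oplus>\<^bsub>U\<^esub> v \<in> S"
    and S_smult: "\<And>a b u. u \<in> S \<Longrightarrow> Complex (of_rat a) (of_rat b) \<odot>\<^bsub>U\<^esub> u \<in> S"
  obtains p s where "p \<in> carrier U" "\<And>n::nat. s n \<in> S" "(\<lambda>n. vnorm U (s n \<ominus>\<^bsub>U\<^esub> p)) \<longlonglongrightarrow> 0"
    "\<And>u. u \<in> S \<Longrightarrow> cinner V u (h \<ominus>\<^bsub>V\<^esub> p) = 0"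
proof -
  define D where "D u = (vnorm V (h \<ominus>\<^bsub>V\<^esub> u))\<^sup>2" for u
  define d where "d = (INF u\<in>S. D u)"
  have SU: "u \<in> carrier U" "u \<in> carrier V" if "u \<in> S" for u using that S carrier_mono by auto
  have S_addV: "u \<oplus>\<^bsub>V\<^esub> v \<in> S" if "u \<in> S" "v \<in> S" for u v using S_add[OF that] SU that by (simp add: add_eq)
  have S_smultV: "Complex (of_rat a) (of_rat b) \<odot>\<^bsub>V\<^esub> u \<in> S" if "u \<in> S" for a b u
    using S_smult[OF that] SU that by (simp add: smult_eq)
  have bdd: "bdd_below (D ` S)" by (rule bdd_belowI2[of _ 0]) (simp add: D_def)
  have d_le: "d \<le> D u" if "u \<in> S" for u unfolding d_def by (rule cINF_lower[OF bdd that])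
  have "\<exists>u\<in>S. D u < d + 1 / Suc n" for n
    unfolding d_def using cINF_less_iff[OF S(2) bdd, of "(INF u\<in>S. D u) + 1 / Suc n"] by simp
  then obtain s where s: "\<And>n. s n \<in> S" "\<And>n. D (s n) < d + 1 / Suc n" by metis
  have par: "(vnorm V (u \<ominus>\<^bsub>V\<^esub> v))\<^sup>2 \<le> 2 * D u + 2 * D v - 4 * d" if uv: "u \<in> S" "v \<in> S" for u v
  proof -
    \<comment> \<open>\<open>S\<close> is closed under scalars with rational real and imaginary
      parts. One half is such a scalar, so the midpoint of \<open>u\<close> and \<open>v\<close>
      stays in \<open>S\<close> and its squared distance to \<open>h\<close> is at least
      \<open>d\<close>.\<close>
    have half: "Complex (of_rat (1/2)) (of_rat 0) = 1/2" by (simp add: complex_eq_iff of_rat_divide)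
    let ?m = "(1/2) \<odot>\<^bsub>V\<^esub> (u \<oplus>\<^bsub>V\<^esub> v)"
    have m: "?m \<in> S" using S_smultV[OF S_addV[OF uv], of "1/2" 0] unfolding half .
    have "(vnorm V (u \<ominus>\<^bsub>V\<^esub> v))\<^sup>2 = 2 * D u + 2 * D v - 4 * D ?m"
      using SU[OF uv(1)] SU[OF uv(2)] h V.cinner_commute[of u h] V.cinner_commute[of v h]
        V.cinner_commute[of u v]
      by (simp add: D_def V.vnorm_power2 V.cinner_expand) (simp add: field_simps)
    then show ?thesis using d_le[OF m] by simp
  qed
  have "\<exists>N. \<forall>m\<ge>N. \<forall>n\<ge>N. vnorm U (s m \<ominus>\<^bsub>U\<^esub> s n) < e" if e: "e > 0" for e
  proof -
    \<comment> \<open>The errors \<open>1 / Suc m\<close> and \<open>1 / Suc n\<close> each enter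
      the parallelogram bound with a factor 2, hence the 4.\<close>
    obtain N where N: "1 / Suc N < e\<^sup>2 / 4"
      using e nat_approx_posE[of "e\<^sup>2/4"] by auto
    have "vnorm U (s m \<ominus>\<^bsub>U\<^esub> s n) < e" if mn: "m \<ge> N" "n \<ge> N" for m n
    proof (rule power2_less_imp_less)
      have le: "1 / Suc m \<le> 1 / Suc N" "1 / Suc n \<le> 1 / Suc N"
        using mn by (auto intro!: divide_left_mono)
      have "(vnorm U (s m \<ominus>\<^bsub>U\<^esub> s n))\<^sup>2 = (vnorm V (s m \<ominus>\<^bsub>V\<^esub> s n))\<^sup>2"
        using SU s by (simp add: vnorm_eq flip: minus_eq)
      also have "\<dots> < 2 * (1 / Suc m) + 2 * (1 / Suc n)"
        using par[OF s(1)[of m] s(1)[of n]] s(2)[of m] s(2)[of n] by linarith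
      also have "\<dots> < e\<^sup>2" using le N by linarith
      finally show "(vnorm U (s m \<ominus>\<^bsub>U\<^esub> s n))\<^sup>2 < e\<^sup>2" .
    qed (use e in simp)
    then show ?thesis by blast
  qed
  then obtain p where p: "p \<in> carrier U" "(\<lambda>n. vnorm U (s n \<ominus>\<^bsub>U\<^esub> p)) \<longlonglongrightarrow> 0"
    using hilbert_limit[OF U, of s] SU s by blast
  have pV: "p \<in> carrier V" using p carrier_mono by auto
  have lim0: "(\<lambda>n. vnorm V (s n \<ominus>\<^bsub>V\<^esub> p)) \<longlonglongrightarrow> 0"
    using p SU s by (simp add: vnorm_eq flip: minus_eq)
  have Dp: "D p \<le> d"
  proof (rule LIMSEQ_le_const)
    have "(\<lambda>n. (sqrt (d + 1 / Suc n) + vnorm V (s n \<ominus>\<^bsub>V\<^esub> p))\<^sup>2) \<longlonglongrightarrow> (sqrt (d + 0) + 0)\<^sup>2"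
      using LIMSEQ_inverse_real_of_nat
      by (intro tendsto_intros lim0) (simp add: inverse_eq_divide)
    moreover have "0 \<le> d" unfolding d_def by (rule cINF_greatest[OF S(2)]) (simp add: D_def)
    ultimately show "(\<lambda>n. (sqrt (d + 1 / Suc n) + vnorm V (s n \<ominus>\<^bsub>V\<^esub> p))\<^sup>2) \<longlonglongrightarrow> d" by simp
    have "D p \<le> (sqrt (d + 1 / Suc n) + vnorm V (s n \<ominus>\<^bsub>V\<^esub> p))\<^sup>2" for n
    proof -
      have "vnorm V (h \<ominus>\<^bsub>V\<^esub> p) \<le> vnorm V (h \<ominus>\<^bsub>V\<^esub> s n) + vnorm V (s n \<ominus>\<^bsub>V\<^esub> p)"
        using SU s h pV by (intro V.vnorm_triangle_minus) auto
      moreover have "vnorm V (h \<ominus>\<^bsub>V\<^esub> s n) \<le> sqrt (d + 1 / Suc n)"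
        using s(2)[of n] by (intro real_le_rsqrt) (simp add: D_def)
      ultimately show ?thesis unfolding D_def using h pV by (intro power_mono) auto
    qed
    then show "\<exists>N. \<forall>n\<ge>N. D p \<le> (sqrt (d + 1 / Suc n) + vnorm V (s n \<ominus>\<^bsub>V\<^esub> p))\<^sup>2" by blast
  qed
  \<comment> \<open>\<open>p\<close> is a limit of members of \<open>S\<close> but need not belong
    to \<open>S\<close>. So the distance from \<open>h\<close> to \<open>p + u\<close> is compared
    with the distance to \<open>s n + u\<close>, which is in \<open>S\<close>; the error tends to
    zero.\<close>
  have le: "d \<le> (vnorm V ((h \<ominus>\<^bsub>V\<^esub> p) \<ominus>\<^bsub>V\<^esub> u))\<^sup>2" if u: "u \<in> S" for u
  proof (rule LIMSEQ_le_const)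
    let ?b = "vnorm V ((h \<ominus>\<^bsub>V\<^esub> p) \<ominus>\<^bsub>V\<^esub> u)"
    have "(\<lambda>n. (?b + vnorm V (s n \<ominus>\<^bsub>V\<^esub> p))\<^sup>2) \<longlonglongrightarrow> (?b + 0)\<^sup>2"
      by (intro tendsto_intros lim0)
    then show "(\<lambda>n. (?b + vnorm V (s n \<ominus>\<^bsub>V\<^esub> p))\<^sup>2) \<longlonglongrightarrow> ?b\<^sup>2" by simp
    have "d \<le> (?b + vnorm V (s n \<ominus>\<^bsub>V\<^esub> p))\<^sup>2" for n
    proof -
      have c: "s n \<in> carrier V" "u \<in> carrier V" using s SU u by auto
      have "h \<ominus>\<^bsub>V\<^esub> (s n \<oplus>\<^bsub>V\<^esub> u) = ((h \<ominus>\<^bsub>V\<^esub> p) \<ominus>\<^bsub>V\<^esub> u) \<ominus>\<^bsub>V\<^esub> (s n \<ominus>\<^bsub>V\<^esub> p)"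
        using c h pV by (simp add: a_minus_def V.M.minus_add V.M.a_ac V.M.r_neg1 V.M.r_neg2)
      then have "vnorm V (h \<ominus>\<^bsub>V\<^esub> (s n \<oplus>\<^bsub>V\<^esub> u)) \<le> ?b + vnorm V (s n \<ominus>\<^bsub>V\<^esub> p)"
        using V.vnorm_minus_le[of "(h \<ominus>\<^bsub>V\<^esub> p) \<ominus>\<^bsub>V\<^esub> u" "s n \<ominus>\<^bsub>V\<^esub> p"] c h pV by simp
      then have "D (s n \<oplus>\<^bsub>V\<^esub> u) \<le> (?b + vnorm V (s n \<ominus>\<^bsub>V\<^esub> p))\<^sup>2"
        unfolding D_def using h c by (intro power_mono) auto
      then show ?thesis using d_le[OF S_addV[OF s(1)[of n] u]] by linarith
    qed
    then show "\<exists>N. \<forall>n\<ge>N. d \<le> (?b + vnorm V (s n \<ominus>\<^bsub>V\<^esub> p))\<^sup>2" by blast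
  qed
  \<comment> \<open>First variation: moving from \<open>p\<close> by the rational multiple
    \<open>t\<close> of \<open>u\<close> cannot bring the squared distance below \<open>d\<close>,
    so the term linear in \<open>t\<close> is bounded by the quadratic one. Divide by
    \<open>t\<close> and let it tend to zero along \<open>1 / Suc n\<close>.\<close>
  have Re0: "Re (cinner V u (h \<ominus>\<^bsub>V\<^esub> p)) \<le> 0" if u: "u \<in> S" for u
  proof (rule LIMSEQ_le_const)
    have uV: "u \<in> carrier V" using SU u by auto
    have "(\<lambda>n. 1 / real (Suc n) * (vnorm V u)\<^sup>2) \<longlonglongrightarrow> 0 * (vnorm V u)\<^sup>2"
      using LIMSEQ_inverse_real_of_nat by (intro tendsto_intros) (simp add: inverse_eq_divide)
    then show "(\<lambda>n. 1 / real (Suc n) * (vnorm V u)\<^sup>2) \<longlonglongrightarrow> 0" by simp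
    have "Re (cinner V u (h \<ominus>\<^bsub>V\<^esub> p)) \<le> 1 / real (Suc n) * (vnorm V u)\<^sup>2" for n
    proof -
      define t where "t = 1 / real (Suc n)"
      have t: "t > 0" by (simp add: t_def)
      have "Complex (of_rat (1 / of_nat (Suc n))) (of_rat 0) = complex_of_real t"
        by (simp add: complex_eq_iff of_rat_divide t_def del: of_nat_Suc)
      then have "complex_of_real t \<odot>\<^bsub>V\<^esub> u \<in> S" using S_smultV[OF u] by metis
      from le[OF this] have "d \<le> D p + t\<^sup>2 * (vnorm V u)\<^sup>2 - 2 * t * Re (cinner V u (h \<ominus>\<^bsub>V\<^esub> p))"
        using uV h pV V.cinner_commute[of u "h \<ominus>\<^bsub>V\<^esub> p"]
        by (simp add: V.vnorm_minus_power2[of "h \<ominus>\<^bsub>V\<^esub> p"] V.vnorm_smult D_def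
            V.cinner_smult_right power_mult_distrib)
      then have "2 * t * Re (cinner V u (h \<ominus>\<^bsub>V\<^esub> p)) \<le> t * (t * (vnorm V u)\<^sup>2)"
        using Dp by (simp add: power2_eq_square algebra_simps)
      then have "2 * Re (cinner V u (h \<ominus>\<^bsub>V\<^esub> p)) \<le> t * (vnorm V u)\<^sup>2"
        using t by simp
      moreover have "0 \<le> t * (vnorm V u)\<^sup>2" using t by simp
      ultimately show ?thesis unfolding t_def by linarith
    qed
    then show "\<exists>N. \<forall>n\<ge>N. Re (cinner V u (h \<ominus>\<^bsub>V\<^esub> p)) \<le> 1 / real (Suc n) * (vnorm V u)\<^sup>2" by blast
  qed
  have "cinner V u (h \<ominus>\<^bsub>V\<^esub> p) = 0" if u: "u \<in> S" for u
  proof -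
    have uV: "u \<in> carrier V" using SU u by auto
    \<comment> \<open>The multiples of \<open>u\<close> by \<open>1\<close>, \<open>-1\<close>,
      \<open>\<i>\<close> and \<open>-\<i>\<close> turn the one-sided bound into the vanishing of
      the real and the imaginary part.\<close>
    have c: "Re (c * cinner V u (h \<ominus>\<^bsub>V\<^esub> p)) \<le> 0" if "c = Complex (of_rat a) (of_rat b)" for c a b
      using Re0[OF S_smultV[OF u, of a b]] uV h pV that by (simp add: V.cinner_smult_left)
    show ?thesis
      using c[of 1 1 0] c[of "-1" "-1" 0] c[of \<i> 0 1] c[of "-\<i>" 0 "-1"]
      by (simp add: complex_eq_iff)
  qed
  then show ?thesis using that p s by blast
qed

text \<open>The case of \<open>projection\<close> in which \<open>S\<close> is all of
  \<open>U\<close>; orthogonality to \<open>S\<close> then makes \<open>p\<close> the projection of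
  \<open>h\<close> onto \<open>U\<close>.\<close>

lemma (in isometric_inclusion) orthogonal_projection:
  assumes "hilbert U" "h \<in> carrier V"
  obtains p where "p \<in> carrier U" "\<And>u. u \<in> carrier U \<Longrightarrow> cinner V u (h \<ominus>\<^bsub>V\<^esub> p) = 0"
proof (rule projection[OF assms(1) subset_refl _ assms(2)])
  show "carrier U \<noteq> {}" using U.M.zero_closed by blast
qed (use that in auto)

section \<open>Measurability of inner products\<close>

text \<open>Linear combinations are kept as syntax trees rather than as coefficient families:
  countability is automatic, closure under sums and rational scalars is built in, and measurability
  follows by structural induction.\<close>

datatype rat_comb = Gen nat | Add rat_comb rat_comb | Scale rat rat rat_comb

instance rat_comb :: countable by countable_datatype

primrec comb_val :: "'v inner_space \<Rightarrow> (nat \<Rightarrow> 'v) \<Rightarrow> rat_comb \<Rightarrow> 'v" where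
  "comb_val V f (Gen n) = f n"
| "comb_val V f (Add c d) = comb_val V f c \<oplus>\<^bsub>V\<^esub> comb_val V f d"
| "comb_val V f (Scale a b c) = Complex (of_rat a) (of_rat b) \<odot>\<^bsub>V\<^esub> comb_val V f c"

lemma (in complex_inner_space) comb_val_closed:
  "(\<And>n. f n \<in> carrier V) \<Longrightarrow> comb_val V f c \<in> carrier V"
  by (induction c) auto

text \<open>Project \<open>a\<close> onto the closure of the set of combinations. The remainder is
  orthogonal to every generator, hence zero by totality, and so \<open>a\<close> itself is a limit
  of combinations.\<close>

lemma comb_val_dense:
  assumes V: "hilbert V" and f: "\<And>n. f n \<in> carrier V"
    and total: "\<And>u. u \<in> carrier V \<Longrightarrow> (\<And>n. cinner V (f n) u = 0) \<Longrightarrow> u = \<zero>\<^bsub>V\<^esub>"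
    and a: "a \<in> carrier V" and e: "e > 0"
  shows "\<exists>c. vnorm V (a \<ominus>\<^bsub>V\<^esub> comb_val V f c) < e"
proof -
  interpret complex_inner_space V using V by (simp add: hilbert_def)
  interpret isometric_inclusion V V
    by (intro isometric_inclusionI isometric_subspace_refl) unfold_locales
  let ?S = "range (comb_val V f)"
  obtain p s where p: "p \<in> carrier V" and s: "\<And>n::nat. s n \<in> ?S"
    and lim: "(\<lambda>n. vnorm V (s n \<ominus>\<^bsub>V\<^esub> p)) \<longlonglongrightarrow> 0"
    and orth: "\<And>u. u \<in> ?S \<Longrightarrow> cinner V u (a \<ominus>\<^bsub>V\<^esub> p) = 0"
  proof (rule projection[OF V _ _ a])
    show "?S \<subseteq> carrier V" using comb_val_closed[of f] f by blast
    show "u \<oplus>\<^bsub>V\<^esub> v \<in> ?S" if "u \<in> ?S" "v \<in> ?S" for u v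
      using that comb_val.simps(2)[of V f, symmetric] by blast
    show "Complex (of_rat x) (of_rat y) \<odot>\<^bsub>V\<^esub> u \<in> ?S" if "u \<in> ?S" for x y u
      using that comb_val.simps(3)[of V f, symmetric] by blast
  qed auto
  have "cinner V (f n) (a \<ominus>\<^bsub>V\<^esub> p) = 0" for n
    by (rule orth) (metis comb_val.simps(1) rangeI)
  then have "a \<ominus>\<^bsub>V\<^esub> p = \<zero>\<^bsub>V\<^esub>" using a p by (intro total) auto
  then have ap: "a = p" using a p by (simp add: minus_eq_zero_iff)
  obtain n where "norm (vnorm V (s n \<ominus>\<^bsub>V\<^esub> p) - 0) < e"
    using LIMSEQ_D[OF lim e] by blast
  then have "vnorm V (s n \<ominus>\<^bsub>V\<^esub> p) < e" by simp
  moreover obtain c where "s n = comb_val V f c" using s by blast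
  ultimately show ?thesis
    using ap p comb_val_closed[OF f] by (auto simp: vnorm_minus_commute)
qed

text \<open>The parameter space is left abstract because it is instantiated twice: by the base of a
  bundle, and by its total space, where the fibre depends on the first component of a pair.\<close>

locale measurable_frame =
  fixes Z :: "'z measure" and K :: "'z \<Rightarrow> 'v inner_space" and f :: "nat \<Rightarrow> 'z \<Rightarrow> 'v"
  assumes hilbert: "z \<in> space Z \<Longrightarrow> hilbert (K z)"
    and f_closed: "z \<in> space Z \<Longrightarrow> f n z \<in> carrier (K z)"
    and f_total: "\<lbrakk>z \<in> space Z; u \<in> carrier (K z); \<And>n. cinner (K z) (f n z) u = 0\<rbrakk>
      \<Longrightarrow> u = \<zero>\<^bsub>K z\<^esub>"
    and f_measurable: "(\<lambda>z. cinner (K z) (f m z) (f n z)) \<in> borel_measurable Z"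
begin

definition val :: "rat_comb \<Rightarrow> 'z \<Rightarrow> 'v" where
  "val c z = comb_val (K z) (\<lambda>n. f n z) c"

lemma inner_space: "z \<in> space Z \<Longrightarrow> complex_inner_space (K z)"
  by (rule hilbert_imp_complex_inner_space[OF hilbert])

lemma val_closed: "z \<in> space Z \<Longrightarrow> val c z \<in> carrier (K z)"
  unfolding val_def
  by (rule complex_inner_space.comb_val_closed[OF inner_space]) (auto intro: f_closed)

lemma val_dense:
  "z \<in> space Z \<Longrightarrow> a \<in> carrier (K z) \<Longrightarrow> e > 0 \<Longrightarrow> \<exists>c. vnorm (K z) (a \<ominus>\<^bsub>K z\<^esub> val c z) < e"
  unfolding val_def by (rule comb_val_dense[OF hilbert]) (auto intro: f_closed f_total)

text \<open>Structural induction on the combination. Combinations are formed in \<open>K z\<close>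
  while \<open>w z\<close> may lie in a larger space \<open>V z\<close>; the isometric inclusion
  carries sums and multiples over to \<open>V z\<close>, where the inner product is linear.\<close>

lemma measurable_cinner_val:
  assumes V: "\<And>z. z \<in> space Z \<Longrightarrow> complex_inner_space (V z)"
    and KV: "\<And>z. z \<in> space Z \<Longrightarrow> isometric_subspace (K z) (V z)"
    and w: "\<And>z. z \<in> space Z \<Longrightarrow> w z \<in> carrier (V z)"
    and meas: "\<And>n. (\<lambda>z. cinner (V z) (f n z) (w z)) \<in> borel_measurable Z"
  shows "(\<lambda>z. cinner (V z) (val c z) (w z)) \<in> borel_measurable Z"
proof (induction c)
  case (Gen n)
  then show ?case using meas by (simp add: val_def)
next
  case (Add c d)
  have "cinner (V z) (val (Add c d) z) (w z) = cinner (V z) (val c z) (w z) + cinner (V z) (val d z) (w z)"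
    if z: "z \<in> space Z" for z
  proof -
    interpret isometric_inclusion "K z" "V z"
      by (intro isometric_inclusionI inner_space V KV z)
    show ?thesis
      using val_closed[OF z] w[OF z] add_eq[of "val c z" "val d z"] V.cinner_add_left
      by (simp add: val_def carrier_mono)
  qed
  moreover have "(\<lambda>z. cinner (V z) (val c z) (w z) + cinner (V z) (val d z) (w z)) \<in> borel_measurable Z"
    using Add by measurable
  ultimately show ?case by (subst measurable_cong) auto
next
  case (Scale a b c)
  have "cinner (V z) (val (Scale a b c) z) (w z) = Complex (of_rat a) (of_rat b) * cinner (V z) (val c z) (w z)"
    if z: "z \<in> space Z" for z
  proof -
    interpret isometric_inclusion "K z" "V z"
      by (intro isometric_inclusionI inner_space V KV z)
    show ?thesis
      using val_closed[OF z] w[OF z] smult_eq[of "val c z"] V.cinner_smult_left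
      by (simp add: val_def carrier_mono)
  qed
  moreover have "(\<lambda>z. Complex (of_rat a) (of_rat b) * cinner (V z) (val c z) (w z)) \<in> borel_measurable Z"
    using Scale by measurable
  ultimately show ?case by (subst measurable_cong) auto
qed

lemma measurable_cinner_commute:
  assumes V: "\<And>z. z \<in> space Z \<Longrightarrow> complex_inner_space (V z)"
    and v: "\<And>z. z \<in> space Z \<Longrightarrow> v z \<in> carrier (V z)"
    and w: "\<And>z. z \<in> space Z \<Longrightarrow> w z \<in> carrier (V z)"
    and meas: "(\<lambda>z. cinner (V z) (v z) (w z)) \<in> borel_measurable Z"
  shows "(\<lambda>z. cinner (V z) (w z) (v z)) \<in> borel_measurable Z"
proof -
  have "(\<lambda>z. cnj (cinner (V z) (v z) (w z))) \<in> borel_measurable Z"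
    by (intro measurable_compose[OF meas] borel_measurable_continuous_onI continuous_intros)
  moreover have "cinner (V z) (w z) (v z) = cnj (cinner (V z) (v z) (w z))" if "z \<in> space Z" for z
    using complex_inner_space.cinner_commute[OF V[OF that] v[OF that] w[OF that]] .
  ultimately show ?thesis by (subst measurable_cong) auto
qed

text \<open>Linearity is used in one argument at a time: first with a generator in the second place,
  then, after exchanging the arguments, with the combination itself there.\<close>

lemma measurable_vnorm_val: "(\<lambda>z. vnorm (K z) (val c z)) \<in> borel_measurable Z"
proof -
  have 1: "(\<lambda>z. cinner (K z) (val c z) (f n z)) \<in> borel_measurable Z" for n
    by (rule measurable_cinner_val)
      (auto intro: inner_space isometric_subspace_refl f_closed f_measurable)
  have "(\<lambda>z. cinner (K z) (val c z) (val c z)) \<in> borel_measurable Z"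
    by (rule measurable_cinner_val)
      (auto intro: inner_space isometric_subspace_refl val_closed
        intro!: measurable_cinner_commute[OF _ _ _ 1] f_closed)
  then show ?thesis unfolding vnorm_def by measurable
qed

text \<open>The dual description of the norm over a countable dense set. One direction is the
  Cauchy-Schwarz inequality. For the other, let combinations tend to \<open>a\<close>, which yields
  \<open>(vnorm (K z) a)^2 \<le> r * vnorm (K z) a\<close>. The norm of the combination stands as a
  factor because it may vanish.\<close>

lemma vnorm_le_iff:
  assumes z: "z \<in> space Z" and a: "a \<in> carrier (K z)" and r: "0 \<le> r"
  shows "vnorm (K z) a \<le> r \<longleftrightarrow> (\<forall>c. cmod (cinner (K z) (val c z) a) \<le> r * vnorm (K z) (val c z))"
proof -
  interpret complex_inner_space "K z" by (rule inner_space[OF z])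
  note vc = val_closed[OF z]
  show ?thesis
  proof (intro iffI allI)
    fix c assume "vnorm (K z) a \<le> r"
    then show "cmod (cinner (K z) (val c z) a) \<le> r * vnorm (K z) (val c z)"
      using Cauchy_Schwarz[OF vc a, of c] mult_right_mono[of "vnorm (K z) a" r "vnorm (K z) (val c z)"] vc
      by (simp add: mult.commute)
  next
    assume *: "\<forall>c. cmod (cinner (K z) (val c z) a) \<le> r * vnorm (K z) (val c z)"
    have "\<exists>c. vnorm (K z) (a \<ominus>\<^bsub>K z\<^esub> val c z) < 1 / Suc n" for n
      by (rule val_dense[OF z a]) simp
    then obtain c where c: "\<And>n. vnorm (K z) (a \<ominus>\<^bsub>K z\<^esub> val (c n) z) < 1 / Suc n" by metis
    have lim: "(\<lambda>n. vnorm (K z) (val (c n) z \<ominus>\<^bsub>K z\<^esub> a)) \<longlonglongrightarrow> 0"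
    proof (rule Lim_null_comparison)
      show "\<forall>\<^sub>F n in sequentially. norm (vnorm (K z) (val (c n) z \<ominus>\<^bsub>K z\<^esub> a)) \<le> inverse (Suc n)"
        using c a vc by (auto simp: vnorm_minus_commute[of _ a] inverse_eq_divide less_imp_le
            simp del: of_nat_Suc)
    qed (rule LIMSEQ_inverse_real_of_nat)
    have "cmod (cinner (K z) a a) \<le> r * (vnorm (K z) a + 0)"
    proof (rule LIMSEQ_le)
      show "(\<lambda>n. cmod (cinner (K z) (val (c n) z) a)) \<longlonglongrightarrow> cmod (cinner (K z) a a)"
        by (intro tendsto_norm tendsto_cinner_left vc a lim)
      show "(\<lambda>n. r * (vnorm (K z) a + vnorm (K z) (val (c n) z \<ominus>\<^bsub>K z\<^esub> a))) \<longlonglongrightarrow> r * (vnorm (K z) a + 0)"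
        by (intro tendsto_intros lim)
      have "cmod (cinner (K z) (val (c n) z) a)
          \<le> r * (vnorm (K z) a + vnorm (K z) (val (c n) z \<ominus>\<^bsub>K z\<^esub> a))" for n
        using *[rule_format, of "c n"] mult_left_mono[OF vnorm_le_minus[OF vc a, of "c n"] r] by linarith
      then show "\<exists>N. \<forall>n\<ge>N. cmod (cinner (K z) (val (c n) z) a)
          \<le> r * (vnorm (K z) a + vnorm (K z) (val (c n) z \<ominus>\<^bsub>K z\<^esub> a))" by blast
    qed
    then have "(vnorm (K z) a)\<^sup>2 \<le> r * vnorm (K z) a"
      using a by (simp add: cinner_self flip: of_real_power)
    then show "vnorm (K z) a \<le> r"
      using vnorm_nonneg[OF a] r
      by (cases "vnorm (K z) a = 0") (auto simp: power2_eq_square intro: mult_right_le_imp_le)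
  qed
qed

text \<open>By \<open>vnorm_le_iff\<close> the sublevel sets for \<open>r \<ge> 0\<close> are
  countable intersections of measurable sets; those for negative \<open>r\<close> are empty.\<close>

lemma measurable_vnorm:
  assumes a: "\<And>z. z \<in> space Z \<Longrightarrow> a z \<in> carrier (K z)"
    and meas: "\<And>n. (\<lambda>z. cinner (K z) (f n z) (a z)) \<in> borel_measurable Z"
  shows "(\<lambda>z. vnorm (K z) (a z)) \<in> borel_measurable Z"
  unfolding borel_measurable_iff_le
proof
  fix r :: real
  note 1 = measurable_vnorm_val
  have 2: "(\<lambda>z. cinner (K z) (val c z) (a z)) \<in> borel_measurable Z" for c
    by (rule measurable_cinner_val) (auto intro: inner_space isometric_subspace_refl a meas)
  show "{z \<in> space Z. vnorm (K z) (a z) \<le> r} \<in> sets Z"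
  proof (cases "r \<ge> 0")
    case True
    have "{z \<in> space Z. vnorm (K z) (a z) \<le> r} =
        {z \<in> space Z. \<forall>c. cmod (cinner (K z) (val c z) (a z)) \<le> r * vnorm (K z) (val c z)}"
      using vnorm_le_iff[OF _ a True] by auto
    also have "\<dots> \<in> sets Z" using 1 2 by measurable
    finally show ?thesis .
  next
    case False
    then have "{z \<in> space Z. vnorm (K z) (a z) \<le> r} = {}"
      using complex_inner_space.vnorm_nonneg[OF inner_space a] by force
    then show ?thesis by (metis sets.empty_sets)
  qed
qed

text \<open>The section \<open>a\<close> is the pointwise limit of sections that are countable pieces of rational
  combinations of the frame.\<close>

lemma measurable_cinner:
  assumes a: "\<And>z. z \<in> space Z \<Longrightarrow> a z \<in> carrier (K z)"
    and meas_a: "\<And>n. (\<lambda>z. cinner (K z) (f n z) (a z)) \<in> borel_measurable Z"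
    and V: "\<And>z. z \<in> space Z \<Longrightarrow> complex_inner_space (V z)"
    and KV: "\<And>z. z \<in> space Z \<Longrightarrow> isometric_subspace (K z) (V z)"
    and w: "\<And>z. z \<in> space Z \<Longrightarrow> w z \<in> carrier (V z)"
    and meas_w: "\<And>n. (\<lambda>z. cinner (V z) (f n z) (w z)) \<in> borel_measurable Z"
  shows "(\<lambda>z. cinner (V z) (a z) (w z)) \<in> borel_measurable Z"
proof -
  define E where "E c z = vnorm (K z) (a z \<ominus>\<^bsub>K z\<^esub> val c z)" for c z
  have va: "(\<lambda>z. cinner (K z) (val c z) (f n z)) \<in> borel_measurable Z" for c n
    by (rule measurable_cinner_val)
      (auto intro: inner_space isometric_subspace_refl f_closed f_measurable)
  have E: "E c \<in> borel_measurable Z" for c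
    unfolding E_def
  proof (rule measurable_vnorm)
    show "a z \<ominus>\<^bsub>K z\<^esub> val c z \<in> carrier (K z)" if "z \<in> space Z" for z
      using complex_inner_space.minus_closed[OF inner_space] that a val_closed by blast
    show "(\<lambda>z. cinner (K z) (f n z) (a z \<ominus>\<^bsub>K z\<^esub> val c z)) \<in> borel_measurable Z" for n
    proof -
      have "(\<lambda>z. cinner (K z) (f n z) (val c z)) \<in> borel_measurable Z"
        by (rule measurable_cinner_commute[OF _ _ _ va]) (auto intro: inner_space val_closed f_closed)
      then have "(\<lambda>z. cinner (K z) (f n z) (a z) - cinner (K z) (f n z) (val c z)) \<in> borel_measurable Z"
        using meas_a by measurable
      moreover have "cinner (K z) (f n z) (a z \<ominus>\<^bsub>K z\<^esub> val c z) =
          cinner (K z) (f n z) (a z) - cinner (K z) (f n z) (val c z)" if "z \<in> space Z" for z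
        using that by (intro complex_inner_space.cinner_minus_right inner_space a val_closed f_closed)
      ultimately show ?thesis by (subst measurable_cong) auto
    qed
  qed
  \<comment> \<open>The least code of a combination within \<open>1 / Suc n\<close> of
    \<open>a z\<close>. Among countably many candidates this choice is measurable in
    \<open>z\<close>, because each distance \<open>E c\<close> is.\<close>
  define J where "J n z = (LEAST j. E (from_nat j) z < 1 / Suc n)" for n z
  have J: "E (from_nat (J n z)) z < 1 / Suc n" if z: "z \<in> space Z" for n z
  proof -
    obtain c where "E c z < 1 / Suc n"
      using val_dense[OF z a[OF z], of "1 / Suc n"] by (auto simp: E_def)
    then have "E (from_nat (to_nat c)) z < 1 / Suc n" by simp
    then show ?thesis unfolding J_def by (rule LeastI)
  qed
  have J_meas: "J n \<in> measurable Z (count_space UNIV)" for n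
    unfolding J_def using E by measurable
  have vw: "(\<lambda>z. cinner (V z) (val c z) (w z)) \<in> borel_measurable Z" for c
    by (rule measurable_cinner_val[OF V KV w meas_w])
  define g where "g n z = cinner (V z) (val (from_nat (J n z)) z) (w z)" for n z
  have "g n \<in> borel_measurable Z" for n
    unfolding g_def by (rule measurable_compose_countable[OF vw J_meas])
  moreover have "(\<lambda>n. g n z) \<longlonglongrightarrow> cinner (V z) (a z) (w z)" if z: "z \<in> space Z" for z
    unfolding g_def
  proof -
    interpret isometric_inclusion "K z" "V z"
      by (intro isometric_inclusionI inner_space V KV z)
    have c: "val c z \<in> carrier (K z)" "a z \<in> carrier (K z)" for c using z val_closed a by auto
    show "(\<lambda>n. cinner (V z) (val (from_nat (J n z)) z) (w z)) \<longlonglongrightarrow> cinner (V z) (a z) (w z)"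
    proof (rule V.tendsto_cinner_left)
      show "(\<lambda>n. vnorm (V z) (val (from_nat (J n z)) z \<ominus>\<^bsub>V z\<^esub> a z)) \<longlonglongrightarrow> 0"
      proof (rule Lim_null_comparison)
        have "vnorm (V z) (val (from_nat (J n z)) z \<ominus>\<^bsub>V z\<^esub> a z) = E (from_nat (J n z)) z" for n
          using c U.vnorm_minus_commute[OF c(2,1)] by (simp add: E_def vnorm_eq flip: minus_eq)
        then show "\<forall>\<^sub>F n in sequentially.
            norm (vnorm (V z) (val (from_nat (J n z)) z \<ominus>\<^bsub>V z\<^esub> a z)) \<le> inverse (Suc n)"
          using J[OF z] c by (auto simp: E_def inverse_eq_divide less_imp_le simp del: of_nat_Suc)
      qed (rule LIMSEQ_inverse_real_of_nat)
    qed (auto intro: c carrier_mono w z)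
  qed
  ultimately show ?thesis by (rule borel_measurable_LIMSEQ_metric)
qed

end

section \<open>Borel sections\<close>

locale framed_bundle =
  fixes Y :: "'x set" and K :: "'x \<Rightarrow> 'v inner_space" and T :: "('x \<times> 'v) measure"
    and f :: "nat \<Rightarrow> 'x \<Rightarrow> 'v"
  assumes hilbert: "x \<in> Y \<Longrightarrow> hilbert (K x)"
    and space_T: "space T = total_space Y K"
    and fundamental: "fundamental_sequence Y K T f"
begin

abbreviation B :: "'x measure" where "B \<equiv> base_algebra Y T"

lemma inner_space: "x \<in> Y \<Longrightarrow> complex_inner_space (K x)"
  by (rule hilbert_imp_complex_inner_space[OF hilbert])

lemma space_B [simp]: "space B = Y"
  by (rule base_algebra(1)[OF space_T])

lemma sets_B: "sets B = base_sets Y T"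
  by (rule base_algebra(2)[OF space_T])

lemma in_space_T: "p \<in> space T \<longleftrightarrow> fst p \<in> Y \<and> snd p \<in> carrier (K (fst p))"
  by (cases p) (auto simp: space_T total_space_def)

lemma f_closed: "x \<in> Y \<Longrightarrow> f n x \<in> carrier (K x)"
  using fundamental by (auto simp: fundamental_sequence_def is_section_def)

lemma f_borel: "(\<lambda>x. (x, f n x)) \<in> measurable B T"
  using fundamental by (auto simp: fundamental_sequence_def)

lemma f_cinner_T: "(\<lambda>p. cinner (K (fst p)) (f n (fst p)) (snd p)) \<in> borel_measurable T"
  using fundamental by (auto simp: fundamental_sequence_def case_prod_beta')

text \<open>The points \<open>(x, u)\<close> and \<open>(x, 0)\<close> of the total space have the
  same base point and the same inner products with the sequence, so the separation condition
  identifies them.\<close>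

lemma f_total:
  assumes x: "x \<in> Y" and u: "u \<in> carrier (K x)" and "\<And>n. cinner (K x) (f n x) u = 0"
  shows "u = \<zero>\<^bsub>K x\<^esub>"
proof -
  interpret complex_inner_space "K x" by (rule inner_space[OF x])
  have "(x, u) \<in> total_space Y K" "(x, \<zero>\<^bsub>K x\<^esub>) \<in> total_space Y K"
    using x u by (auto simp: total_space_def)
  moreover have "cinner (K x) (f n x) u = cinner (K x) (f n x) \<zero>\<^bsub>K x\<^esub>" for n
    using assms f_closed by simp
  ultimately show ?thesis using fundamental unfolding fundamental_sequence_def by blast
qed

lemma fst_measurable: "fst \<in> measurable T B"
proof (rule measurableI)
  show "fst p \<in> space B" if "p \<in> space T" for p using that by (simp add: in_space_T)
  show "fst -` A \<inter> space T \<in> sets T" if "A \<in> sets B" for A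
    using that by (simp add: sets_B base_sets_def)
qed

sublocale base: measurable_frame B K f
proof
  show "(\<lambda>x. cinner (K x) (f m x) (f n x)) \<in> borel_measurable B" for m n
    using fundamental by (auto simp: fundamental_sequence_def)
qed (auto intro: hilbert f_closed f_total)

text \<open>The bundle pulled back along its own projection. Over the total space the fibre
  coordinate \<open>snd\<close> is a section, so that its inner products with other sections fall
  under \<open>measurable_cinner\<close>.\<close>

lemma total_frame:
  "measurable_frame T (\<lambda>p. K (fst p)) (\<lambda>n p. f n (fst p))"
proof
  show "(\<lambda>p. cinner (K (fst p)) (f m (fst p)) (f n (fst p))) \<in> borel_measurable T" for m n
    by (rule measurable_compose[OF fst_measurable base.f_measurable])
qed (auto simp: in_space_T intro: hilbert f_closed f_total)

lemma measurable_cinner_section: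
  assumes "(\<lambda>x. (x, g x)) \<in> measurable B T"
  shows "(\<lambda>x. cinner (K x) (f n x) (g x)) \<in> borel_measurable B"
  using measurable_compose[OF assms f_cinner_T[of n]] by simp

text \<open>\<open>borel_section\<close> quantifies over all fundamental sequences; testing against
  the fixed one is enough. For another sequence \<open>g\<close>, the inner products of
  \<open>f m\<close> and \<open>g n\<close> are measurable because \<open>g n\<close> is a Borel map
  into the total space, and then \<open>measurable_cinner\<close> applies to \<open>g n\<close> and
  \<open>s\<close>.\<close>

lemma borel_section_iff:
  "borel_section Y K T s \<longleftrightarrow> is_section Y K s \<and>
    (\<forall>n. (\<lambda>x. cinner (K x) (f n x) (s x)) \<in> borel_measurable B)"
proof
  assume s: "borel_section Y K T s"
  then have "is_section Y K s" "\<And>n. (\<lambda>x. cinner (K x) (s x) (f n x)) \<in> borel_measurable B"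
    using fundamental by (auto simp: borel_section_def)
  then show "is_section Y K s \<and> (\<forall>n. (\<lambda>x. cinner (K x) (f n x) (s x)) \<in> borel_measurable B)"
    by (auto simp: is_section_def intro!: base.measurable_cinner_commute[where V = K and v = s]
        intro: inner_space f_closed)
next
  assume s: "is_section Y K s \<and> (\<forall>n. (\<lambda>x. cinner (K x) (f n x) (s x)) \<in> borel_measurable B)"
  then have s_closed: "s x \<in> carrier (K x)" if "x \<in> Y" for x using that by (auto simp: is_section_def)
  have "(\<lambda>x. cinner (K x) (s x) (g n x)) \<in> borel_measurable B"
    if g: "fundamental_sequence Y K T g" for g n
  proof -
    have g_closed: "g n x \<in> carrier (K x)" if "x \<in> Y" for x
      using g that by (auto simp: fundamental_sequence_def is_section_def)
    have "(\<lambda>x. (x, g n x)) \<in> measurable B T" using g by (auto simp: fundamental_sequence_def)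
    from measurable_cinner_section[OF this]
    have "(\<lambda>x. cinner (K x) (f m x) (g n x)) \<in> borel_measurable B" for m .
    then have "(\<lambda>x. cinner (K x) (g n x) (s x)) \<in> borel_measurable B"
      by (rule base.measurable_cinner[where V = K, rotated])
        (use s in \<open>auto intro: inner_space isometric_subspace_refl g_closed s_closed\<close>)
    then show ?thesis
      by (rule base.measurable_cinner_commute[where V = K, rotated 3])
        (auto intro: inner_space g_closed s_closed)
  qed
  then show "borel_section Y K T s" using s by (auto simp: borel_section_def)
qed

lemma borel_section_closed: "borel_section Y K T s \<Longrightarrow> x \<in> Y \<Longrightarrow> s x \<in> carrier (K x)"
  by (auto simp: borel_section_def is_section_def)

lemma borel_section_cinner:
  assumes "borel_section Y K T s" "borel_section Y K T t"
  shows "(\<lambda>x. cinner (K x) (s x) (t x)) \<in> borel_measurable B"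
  by (rule base.measurable_cinner[where V = K])
    (use assms in \<open>auto intro: inner_space isometric_subspace_refl borel_section_closed
      simp: borel_section_iff\<close>)

lemma borel_section_vnorm:
  assumes "borel_section Y K T s"
  shows "(\<lambda>x. vnorm (K x) (s x)) \<in> borel_measurable B"
  unfolding vnorm_def using borel_section_cinner[OF assms assms] by measurable

lemma borel_sectionI:
  assumes "\<And>x. x \<in> Y \<Longrightarrow> s x \<in> carrier (K x)"
    and eq: "\<And>n x. x \<in> Y \<Longrightarrow> cinner (K x) (f n x) (s x) = h n x"
    and "\<And>n. h n \<in> borel_measurable B"
  shows "borel_section Y K T s"
proof -
  have "(\<lambda>x. cinner (K x) (f n x) (s x)) \<in> borel_measurable B" for n
    by (rule measurable_cong[THEN iffD2, OF eq assms(3)]) simp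
  then show ?thesis using assms(1) by (simp add: borel_section_iff is_section_def)
qed

lemma borel_section_measurable:
  "borel_section Y K T s \<Longrightarrow> (\<lambda>x. cinner (K x) (f n x) (s x)) \<in> borel_measurable B"
  by (simp add: borel_section_iff)

lemma borel_section_zero: "borel_section Y K T (\<lambda>x. \<zero>\<^bsub>K x\<^esub>)"
proof (rule borel_sectionI)
  fix n x assume x: "x \<in> Y"
  interpret complex_inner_space "K x" by (rule inner_space[OF x])
  show "\<zero>\<^bsub>K x\<^esub> \<in> carrier (K x)" by simp
  show "cinner (K x) (f n x) \<zero>\<^bsub>K x\<^esub> = 0" using f_closed[OF x] by simp
qed simp

lemma borel_section_add:
  assumes s: "borel_section Y K T s" and t: "borel_section Y K T t"
  shows "borel_section Y K T (\<lambda>x. s x \<oplus>\<^bsub>K x\<^esub> t x)"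
proof (rule borel_sectionI)
  fix n x assume x: "x \<in> Y"
  interpret complex_inner_space "K x" by (rule inner_space[OF x])
  note c = f_closed[OF x] borel_section_closed[OF s x] borel_section_closed[OF t x]
  show "s x \<oplus>\<^bsub>K x\<^esub> t x \<in> carrier (K x)" using c by simp
  show "cinner (K x) (f n x) (s x \<oplus>\<^bsub>K x\<^esub> t x)
      = cinner (K x) (f n x) (s x) + cinner (K x) (f n x) (t x)"
    using c by (simp add: cinner_add_right)
next
  show "(\<lambda>x. cinner (K x) (f n x) (s x) + cinner (K x) (f n x) (t x)) \<in> borel_measurable B" for n
    by (intro borel_measurable_add borel_section_measurable s t)
qed

lemma borel_section_minus:
  assumes s: "borel_section Y K T s" and t: "borel_section Y K T t"
  shows "borel_section Y K T (\<lambda>x. s x \<ominus>\<^bsub>K x\<^esub> t x)"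
proof (rule borel_sectionI)
  fix n x assume x: "x \<in> Y"
  interpret complex_inner_space "K x" by (rule inner_space[OF x])
  note c = f_closed[OF x] borel_section_closed[OF s x] borel_section_closed[OF t x]
  show "s x \<ominus>\<^bsub>K x\<^esub> t x \<in> carrier (K x)" using c by simp
  show "cinner (K x) (f n x) (s x \<ominus>\<^bsub>K x\<^esub> t x)
      = cinner (K x) (f n x) (s x) - cinner (K x) (f n x) (t x)"
    using c by (simp add: cinner_minus_right)
next
  show "(\<lambda>x. cinner (K x) (f n x) (s x) - cinner (K x) (f n x) (t x)) \<in> borel_measurable B" for n
    by (intro borel_measurable_diff borel_section_measurable s t)
qed

lemma borel_section_smult:
  assumes s: "borel_section Y K T s"
  shows "borel_section Y K T (\<lambda>x. c \<odot>\<^bsub>K x\<^esub> s x)"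
proof (rule borel_sectionI)
  fix n x assume x: "x \<in> Y"
  interpret complex_inner_space "K x" by (rule inner_space[OF x])
  note c = f_closed[OF x] borel_section_closed[OF s x]
  show "c \<odot>\<^bsub>K x\<^esub> s x \<in> carrier (K x)" using c by simp
  show "cinner (K x) (f n x) (c \<odot>\<^bsub>K x\<^esub> s x) = cnj c * cinner (K x) (f n x) (s x)"
    using c by (simp add: cinner_smult_right)
next
  show "(\<lambda>x. cnj c * cinner (K x) (f n x) (s x)) \<in> borel_measurable B" for n
    by (intro borel_measurable_times borel_measurable_const borel_section_measurable s)
qed

end

lemma borel_bundle_framed:
  assumes "borel_bundle Y K T"
  obtains f where "framed_bundle Y K T f"
  using assms unfolding borel_bundle_def framed_bundle_def by blast

section \<open>Spaces of classes of square integrable sections\<close>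

lemma ae_class_eq_iff: "ae_class N f = ae_class N g \<longleftrightarrow> (AE x in N. f x = g x)"
proof
  assume "ae_class N f = ae_class N g"
  moreover have "g \<in> ae_class N g" by (simp add: ae_class_def)
  ultimately have "g \<in> ae_class N f" by simp
  then show "AE x in N. f x = g x" by (simp add: ae_class_def)
next
  assume fg: "AE x in N. f x = g x"
  have "(AE x in N. f x = h x) \<longleftrightarrow> (AE x in N. g x = h x)" for h
  proof
    show "AE x in N. g x = h x" if "AE x in N. f x = h x"
      using fg that by eventually_elim simp
    show "AE x in N. f x = h x" if "AE x in N. g x = h x"
      using fg that by eventually_elim simp
  qed
  then show "ae_class N f = ae_class N g" by (simp add: ae_class_def)
qed

lemma ae_class_cong: "(\<And>x. x \<in> space N \<Longrightarrow> f x = g x) \<Longrightarrow> ae_class N f = ae_class N g"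
  unfolding ae_class_eq_iff by (rule AE_I2)

text \<open>The choice that \<open>L2_quotient\<close> makes through its local \<open>rep\<close>,
  named so that its properties can be stated and folded back.\<close>

definition representative :: "('x \<Rightarrow> 'v) set \<Rightarrow> ('x \<Rightarrow> 'v) set \<Rightarrow> 'x \<Rightarrow> 'v" where
  "representative L F = (SOME f. f \<in> F \<and> f \<in> L)"

lemma representative:
  assumes "f \<in> L"
  shows "representative L (ae_class N f) \<in> L" "AE x in N. f x = representative L (ae_class N f) x"
proof -
  have "\<exists>g. g \<in> ae_class N f \<and> g \<in> L" using assms by (auto simp: ae_class_def)
  then have "representative L (ae_class N f) \<in> ae_class N f \<and> representative L (ae_class N f) \<in> L"
    unfolding representative_def by (rule someI_ex)
  then show "representative L (ae_class N f) \<in> L" "AE x in N. f x = representative L (ae_class N f) x"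
    by (auto simp: ae_class_def)
qed

lemma L2_quotient_simps [simp]:
  "carrier (L2_quotient L K \<rho> N) = ae_class N ` L"
  "\<zero>\<^bsub>L2_quotient L K \<rho> N\<^esub> = ae_class N (\<lambda>x. \<zero>\<^bsub>K x\<^esub>)"
  by (simp_all add: L2_quotient_def Let_def)

lemma L2_quotient_add:
  assumes "f \<in> L" "g \<in> L"
  shows "ae_class N f \<oplus>\<^bsub>L2_quotient L K \<rho> N\<^esub> ae_class N g = ae_class N (\<lambda>x. f x \<oplus>\<^bsub>K x\<^esub> g x)"
proof -
  have "AE x in N. representative L (ae_class N f) x \<oplus>\<^bsub>K x\<^esub> representative L (ae_class N g) x
      = f x \<oplus>\<^bsub>K x\<^esub> g x"
    using representative(2)[OF assms(1), of N] representative(2)[OF assms(2), of N]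
    by eventually_elim simp
  then show ?thesis by (simp add: L2_quotient_def Let_def ae_class_eq_iff flip: representative_def)
qed

lemma L2_quotient_smult:
  assumes "f \<in> L"
  shows "c \<odot>\<^bsub>L2_quotient L K \<rho> N\<^esub> ae_class N f = ae_class N (\<lambda>x. c \<odot>\<^bsub>K x\<^esub> f x)"
proof -
  have "AE x in N. c \<odot>\<^bsub>K x\<^esub> representative L (ae_class N f) x = c \<odot>\<^bsub>K x\<^esub> f x"
    using representative(2)[OF assms(1), of N] by eventually_elim simp
  then show ?thesis by (simp add: L2_quotient_def Let_def ae_class_eq_iff flip: representative_def)
qed

text \<open>Classes are taken modulo \<open>N\<close> but integrals over \<open>\<rho>\<close>; for
  a stage these are the limit measure and the measure of the stage, hence the assumption
  \<open>AE\<close>. Measurability enters because changing the integrand on a null set is justified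
  for measurable integrands.\<close>

lemma L2_quotient_cinner:
  assumes "f \<in> L" "g \<in> L"
    and AE: "\<And>P. (AE x in N. P x) \<Longrightarrow> (AE x in \<rho>. P x)"
    and meas: "\<And>f g. f \<in> L \<Longrightarrow> g \<in> L \<Longrightarrow> (\<lambda>x. cinner (K x) (f x) (g x)) \<in> borel_measurable \<rho>"
  shows "cinner (L2_quotient L K \<rho> N) (ae_class N f) (ae_class N g)
    = (\<integral>x. cinner (K x) (f x) (g x) \<partial>\<rho>)"
proof -
  have "AE x in \<rho>. cinner (K x) (representative L (ae_class N f) x) (representative L (ae_class N g) x)
      = cinner (K x) (f x) (g x)"
    using AE[OF representative(2)[OF assms(1)]] AE[OF representative(2)[OF assms(2)]]
    by eventually_elim simp
  then have "(\<integral>x. cinner (K x) (representative L (ae_class N f) x) (representative L (ae_class N g) x) \<partial>\<rho>)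
      = (\<integral>x. cinner (K x) (f x) (g x) \<partial>\<rho>)"
    using assms by (intro integral_cong_AE meas representative)
  then show ?thesis by (simp add: L2_quotient_def Let_def flip: representative_def)
qed

lemma cring_complex_cring: "cring complex_cring"
proof (rule cringI)
  show "abelian_group complex_cring"
  proof (rule abelian_groupI)
    fix x :: complex
    show "\<exists>y\<in>carrier complex_cring. y \<oplus>\<^bsub>complex_cring\<^esub> x = \<zero>\<^bsub>complex_cring\<^esub>"
      by (rule bexI[of _ "- x"]) simp_all
  qed simp_all
  show "Group.comm_monoid complex_cring"
    by (rule Group.comm_monoidI) simp_all
qed (simp add: algebra_simps)

section \<open>The direct integral as an inner product space\<close>

locale square_integrable_bundle = framed_bundle Y K T f
  for Y :: "'x set" and K :: "'x \<Rightarrow> 'v inner_space" and T :: "('x \<times> 'v) measure"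
    and f :: "nat \<Rightarrow> 'x \<Rightarrow> 'v" +
  fixes \<rho> :: "'x measure"
  assumes sets_\<rho>: "sets \<rho> = sets (base_algebra Y T)"
begin

abbreviation L :: "('x \<Rightarrow> 'v) set" where "L \<equiv> square_integrable_sections Y K T \<rho>"
abbreviation Q :: "('x \<Rightarrow> 'v) set inner_space" where "Q \<equiv> direct_integral Y K T \<rho>"
abbreviation cl :: "('x \<Rightarrow> 'v) \<Rightarrow> ('x \<Rightarrow> 'v) set" where "cl \<equiv> ae_class \<rho>"

lemma space_\<rho>: "space \<rho> = Y"
  using sets_eq_imp_space_eq[OF sets_\<rho>] by simp

lemma measurable_\<rho>: "measurable \<rho> N = measurable B N"
  by (rule measurable_cong_sets[OF sets_\<rho> refl])

lemma L_borel: "s \<in> L \<Longrightarrow> borel_section Y K T s"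
  by (simp add: square_integrable_sections_def)

lemma L_closed: "s \<in> L \<Longrightarrow> x \<in> Y \<Longrightarrow> s x \<in> carrier (K x)"
  using L_borel borel_section_closed by blast

lemma L_finite: "s \<in> L \<Longrightarrow> (\<integral>\<^sup>+x. ennreal ((vnorm (K x) (s x))\<^sup>2) \<partial>\<rho>) < \<infinity>"
  by (simp add: square_integrable_sections_def)

lemma vnorm_measurable: "borel_section Y K T s \<Longrightarrow> (\<lambda>x. vnorm (K x) (s x)) \<in> borel_measurable \<rho>"
  unfolding measurable_\<rho> by (rule borel_section_vnorm)

lemma cinner_measurable:
  "s \<in> L \<Longrightarrow> t \<in> L \<Longrightarrow> (\<lambda>x. cinner (K x) (s x) (t x)) \<in> borel_measurable \<rho>"
  unfolding measurable_\<rho> by (intro borel_section_cinner L_borel)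

lemma vnorm_integrable: "s \<in> L \<Longrightarrow> integrable \<rho> (\<lambda>x. (vnorm (K x) (s x))\<^sup>2)"
  using L_finite[of s] vnorm_measurable[OF L_borel, of s] by (intro integrableI_bounded) auto

lemma L_I:
  assumes "borel_section Y K T s" "integrable \<rho> h"
    and "\<And>x. x \<in> Y \<Longrightarrow> (vnorm (K x) (s x))\<^sup>2 \<le> h x"
  shows "s \<in> L"
proof -
  have "(\<integral>\<^sup>+x. ennreal ((vnorm (K x) (s x))\<^sup>2) \<partial>\<rho>) \<le> (\<integral>\<^sup>+x. ennreal (norm (h x)) \<partial>\<rho>)"
    using assms(3) by (intro nn_integral_mono ennreal_leI) (force simp: space_\<rho> intro: order_trans[OF _ abs_ge_self])
  also have "\<dots> < \<infinity>" using assms(2) by (simp add: integrable_iff_bounded)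
  finally show ?thesis using assms(1) by (simp add: square_integrable_sections_def)
qed

lemma L_zero: "(\<lambda>x. \<zero>\<^bsub>K x\<^esub>) \<in> L"
  by (rule L_I[of _ "\<lambda>_. 0"])
    (auto intro: borel_section_zero simp: complex_inner_space.vnorm_zero[OF inner_space])

lemma L_add:
  assumes "s \<in> L" "t \<in> L"
  shows "(\<lambda>x. s x \<oplus>\<^bsub>K x\<^esub> t x) \<in> L"
proof (rule L_I)
  show "integrable \<rho> (\<lambda>x. 2 * (vnorm (K x) (s x))\<^sup>2 + 2 * (vnorm (K x) (t x))\<^sup>2)"
    using assms by (intro Bochner_Integration.integrable_add integrable_mult_right vnorm_integrable) auto
  fix x assume x: "x \<in> Y"
  interpret complex_inner_space "K x" by (rule inner_space[OF x])
  have c: "s x \<in> carrier (K x)" "t x \<in> carrier (K x)" using assms x L_closed by auto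
  have "(vnorm (K x) (s x \<oplus>\<^bsub>K x\<^esub> t x))\<^sup>2 \<le> (vnorm (K x) (s x) + vnorm (K x) (t x))\<^sup>2"
    using c vnorm_triangle by (intro power_mono) auto
  also have "\<dots> \<le> 2 * (vnorm (K x) (s x))\<^sup>2 + 2 * (vnorm (K x) (t x))\<^sup>2"
    using sum_squares_ge_zero[of "vnorm (K x) (s x) - vnorm (K x) (t x)" 0]
    by (simp add: power2_eq_square algebra_simps)
  finally show "(vnorm (K x) (s x \<oplus>\<^bsub>K x\<^esub> t x))\<^sup>2
      \<le> 2 * (vnorm (K x) (s x))\<^sup>2 + 2 * (vnorm (K x) (t x))\<^sup>2" .
qed (intro borel_section_add L_borel assms)

lemma L_smult:
  assumes "s \<in> L"
  shows "(\<lambda>x. c \<odot>\<^bsub>K x\<^esub> s x) \<in> L"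
proof (rule L_I)
  show "integrable \<rho> (\<lambda>x. (cmod c)\<^sup>2 * (vnorm (K x) (s x))\<^sup>2)"
    using assms by (intro integrable_mult_right vnorm_integrable) auto
  show "(vnorm (K x) (c \<odot>\<^bsub>K x\<^esub> s x))\<^sup>2 \<le> (cmod c)\<^sup>2 * (vnorm (K x) (s x))\<^sup>2" if "x \<in> Y" for x
    using complex_inner_space.vnorm_smult[OF inner_space[OF that] L_closed[OF assms that]]
    by (simp add: power_mult_distrib)
qed (intro borel_section_smult L_borel assms)

lemma L_minus:
  assumes "s \<in> L" "t \<in> L"
  shows "(\<lambda>x. s x \<ominus>\<^bsub>K x\<^esub> t x) \<in> L"
proof (rule L_I[OF _ vnorm_integrable[OF L_add[OF assms(1) L_smult[OF assms(2), of "-1"]]]])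
  fix x assume x: "x \<in> Y"
  interpret complex_inner_space "K x" by (rule inner_space[OF x])
  show "(vnorm (K x) (s x \<ominus>\<^bsub>K x\<^esub> t x))\<^sup>2
      \<le> (vnorm (K x) (s x \<oplus>\<^bsub>K x\<^esub> (-1) \<odot>\<^bsub>K x\<^esub> t x))\<^sup>2"
    using L_closed[OF assms(2) x] by (simp add: minus_eq_smult)
qed (intro borel_section_minus L_borel assms)

lemma cinner_integrable:
  assumes "s \<in> L" "t \<in> L"
  shows "integrable \<rho> (\<lambda>x. cinner (K x) (s x) (t x))"
proof (rule Bochner_Integration.integrable_bound)
  show "integrable \<rho> (\<lambda>x. (vnorm (K x) (s x))\<^sup>2 + (vnorm (K x) (t x))\<^sup>2)"
    using assms by (intro Bochner_Integration.integrable_add vnorm_integrable)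
  show "(\<lambda>x. cinner (K x) (s x) (t x)) \<in> borel_measurable \<rho>"
    by (rule cinner_measurable[OF assms])
  show "AE x in \<rho>. norm (cinner (K x) (s x) (t x))
      \<le> norm ((vnorm (K x) (s x))\<^sup>2 + (vnorm (K x) (t x))\<^sup>2)"
  proof (rule AE_I2)
    fix x assume "x \<in> space \<rho>"
    then have x: "x \<in> Y" by (simp add: space_\<rho>)
    interpret complex_inner_space "K x" by (rule inner_space[OF x])
    have c: "s x \<in> carrier (K x)" "t x \<in> carrier (K x)" using assms x L_closed by auto
    let ?a = "vnorm (K x) (s x)" and ?b = "vnorm (K x) (t x)"
    have "norm (cinner (K x) (s x) (t x)) \<le> ?a * ?b" by (rule Cauchy_Schwarz[OF c])
    also have "\<dots> \<le> ?a\<^sup>2 + ?b\<^sup>2"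
      using sum_squares_bound[of ?a ?b] mult_nonneg_nonneg[OF c[THEN vnorm_nonneg]]
      unfolding mult.assoc by linarith
    finally show "norm (cinner (K x) (s x) (t x)) \<le> norm (?a\<^sup>2 + ?b\<^sup>2)" by simp
  qed
qed

lemma Q_carrier: "carrier Q = cl ` L"
  by (simp add: direct_integral_def)

lemma Q_zero: "\<zero>\<^bsub>Q\<^esub> = cl (\<lambda>x. \<zero>\<^bsub>K x\<^esub>)"
  by (simp add: direct_integral_def)

lemma Q_add: "s \<in> L \<Longrightarrow> t \<in> L \<Longrightarrow> cl s \<oplus>\<^bsub>Q\<^esub> cl t = cl (\<lambda>x. s x \<oplus>\<^bsub>K x\<^esub> t x)"
  unfolding direct_integral_def by (rule L2_quotient_add)

lemma Q_smult: "s \<in> L \<Longrightarrow> c \<odot>\<^bsub>Q\<^esub> cl s = cl (\<lambda>x. c \<odot>\<^bsub>K x\<^esub> s x)"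
  unfolding direct_integral_def by (rule L2_quotient_smult)

lemma Q_cinner:
  "s \<in> L \<Longrightarrow> t \<in> L \<Longrightarrow> cinner Q (cl s) (cl t) = (\<integral>x. cinner (K x) (s x) (t x) \<partial>\<rho>)"
  unfolding direct_integral_def by (rule L2_quotient_cinner) (auto intro: cinner_measurable)

lemma cl_cong: "(\<And>x. x \<in> Y \<Longrightarrow> s x = t x) \<Longrightarrow> cl s = cl t"
  by (rule ae_class_cong) (simp add: space_\<rho>)

text \<open>Every axiom holds pointwise in the fibres over \<open>Y\<close>, and
  \<open>cl_cong\<close> turns pointwise equality on \<open>Y\<close> into equality of classes. The
  module axioms below are treated in the same way.\<close>

lemma abelian_group_Q: "abelian_group Q"
proof (rule abelian_groupI)
  show "\<zero>\<^bsub>Q\<^esub> \<in> carrier Q" by (simp add: Q_zero Q_carrier L_zero)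
  fix F assume "F \<in> carrier Q"
  then obtain s where s: "F = cl s" "s \<in> L" by (auto simp: Q_carrier)
  show "\<zero>\<^bsub>Q\<^esub> \<oplus>\<^bsub>Q\<^esub> F = F"
    unfolding s(1) Q_zero Q_add[OF L_zero s(2)]
  proof (rule cl_cong)
    fix x assume x: "x \<in> Y"
    interpret complex_inner_space "K x" by (rule inner_space[OF x])
    show "\<zero>\<^bsub>K x\<^esub> \<oplus>\<^bsub>K x\<^esub> s x = s x" using L_closed[OF s(2) x] by simp
  qed
  show "\<exists>G\<in>carrier Q. G \<oplus>\<^bsub>Q\<^esub> F = \<zero>\<^bsub>Q\<^esub>"
  proof (rule bexI)
    show "cl (\<lambda>x. (-1) \<odot>\<^bsub>K x\<^esub> s x) \<in> carrier Q" using L_smult[OF s(2)] by (simp add: Q_carrier)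
    show "cl (\<lambda>x. (-1) \<odot>\<^bsub>K x\<^esub> s x) \<oplus>\<^bsub>Q\<^esub> F = \<zero>\<^bsub>Q\<^esub>"
      unfolding s(1) Q_zero Q_add[OF L_smult[OF s(2)] s(2)]
    proof (rule cl_cong)
      fix x assume x: "x \<in> Y"
      interpret complex_inner_space "K x" by (rule inner_space[OF x])
      show "(-1) \<odot>\<^bsub>K x\<^esub> s x \<oplus>\<^bsub>K x\<^esub> s x = \<zero>\<^bsub>K x\<^esub>"
        using L_closed[OF s(2) x] by (simp add: M.l_neg flip: uminus_eq_smult)
    qed
  qed
  fix G assume "G \<in> carrier Q"
  then obtain t where t: "G = cl t" "t \<in> L" by (auto simp: Q_carrier)
  show "F \<oplus>\<^bsub>Q\<^esub> G \<in> carrier Q" using L_add s t by (simp add: Q_add Q_carrier)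
  show "F \<oplus>\<^bsub>Q\<^esub> G = G \<oplus>\<^bsub>Q\<^esub> F"
    unfolding s(1) t(1) Q_add[OF s(2) t(2)] Q_add[OF t(2) s(2)]
  proof (rule cl_cong)
    fix x assume x: "x \<in> Y"
    interpret complex_inner_space "K x" by (rule inner_space[OF x])
    show "s x \<oplus>\<^bsub>K x\<^esub> t x = t x \<oplus>\<^bsub>K x\<^esub> s x"
      using L_closed[OF s(2) x] L_closed[OF t(2) x] by (rule M.a_comm)
  qed
  fix H assume "H \<in> carrier Q"
  then obtain r where r: "H = cl r" "r \<in> L" by (auto simp: Q_carrier)
  show "F \<oplus>\<^bsub>Q\<^esub> G \<oplus>\<^bsub>Q\<^esub> H = F \<oplus>\<^bsub>Q\<^esub> (G \<oplus>\<^bsub>Q\<^esub> H)"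
    unfolding s(1) t(1) r(1) Q_add[OF s(2) t(2)] Q_add[OF t(2) r(2)]
      Q_add[OF L_add[OF s(2) t(2)] r(2)] Q_add[OF s(2) L_add[OF t(2) r(2)]]
  proof (rule cl_cong)
    fix x assume x: "x \<in> Y"
    interpret complex_inner_space "K x" by (rule inner_space[OF x])
    show "s x \<oplus>\<^bsub>K x\<^esub> t x \<oplus>\<^bsub>K x\<^esub> r x = s x \<oplus>\<^bsub>K x\<^esub> (t x \<oplus>\<^bsub>K x\<^esub> r x)"
      using L_closed[OF s(2) x] L_closed[OF t(2) x] L_closed[OF r(2) x] by (rule M.a_assoc)
  qed
qed

lemma module_Q: "module complex_cring Q"
proof (rule moduleI[OF cring_complex_cring abelian_group_Q])
  fix a b :: complex and F assume "F \<in> carrier Q"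
  then obtain s where s: "F = cl s" "s \<in> L" by (auto simp: Q_carrier)
  note sm = L_smult[OF s(2)]
  show "a \<odot>\<^bsub>Q\<^esub> F \<in> carrier Q" using sm by (simp add: s Q_smult Q_carrier)
  show "(a \<oplus>\<^bsub>complex_cring\<^esub> b) \<odot>\<^bsub>Q\<^esub> F = a \<odot>\<^bsub>Q\<^esub> F \<oplus>\<^bsub>Q\<^esub> b \<odot>\<^bsub>Q\<^esub> F"
    unfolding s(1) Q_smult[OF s(2)] Q_add[OF sm sm]
  proof (rule cl_cong)
    fix x assume x: "x \<in> Y"
    interpret complex_inner_space "K x" by (rule inner_space[OF x])
    show "(a \<oplus>\<^bsub>complex_cring\<^esub> b) \<odot>\<^bsub>K x\<^esub> s x = a \<odot>\<^bsub>K x\<^esub> s x \<oplus>\<^bsub>K x\<^esub> b \<odot>\<^bsub>K x\<^esub> s x"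
      by (rule smult_l_distr) (simp_all add: L_closed[OF s(2) x])
  qed
  show "(a \<otimes>\<^bsub>complex_cring\<^esub> b) \<odot>\<^bsub>Q\<^esub> F = a \<odot>\<^bsub>Q\<^esub> (b \<odot>\<^bsub>Q\<^esub> F)"
    unfolding s(1) Q_smult[OF s(2)] Q_smult[OF sm]
  proof (rule cl_cong)
    fix x assume x: "x \<in> Y"
    interpret complex_inner_space "K x" by (rule inner_space[OF x])
    show "(a \<otimes>\<^bsub>complex_cring\<^esub> b) \<odot>\<^bsub>K x\<^esub> s x = a \<odot>\<^bsub>K x\<^esub> (b \<odot>\<^bsub>K x\<^esub> s x)"
      by (rule smult_assoc1) (simp_all add: L_closed[OF s(2) x])
  qed
  show "\<one>\<^bsub>complex_cring\<^esub> \<odot>\<^bsub>Q\<^esub> F = F"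
    unfolding s(1) Q_smult[OF s(2)]
  proof (rule cl_cong)
    fix x assume x: "x \<in> Y"
    interpret complex_inner_space "K x" by (rule inner_space[OF x])
    show "\<one>\<^bsub>complex_cring\<^esub> \<odot>\<^bsub>K x\<^esub> s x = s x"
      by (rule smult_one) (simp add: L_closed[OF s(2) x])
  qed
  fix G assume "G \<in> carrier Q"
  then obtain t where t: "G = cl t" "t \<in> L" by (auto simp: Q_carrier)
  show "a \<odot>\<^bsub>Q\<^esub> (F \<oplus>\<^bsub>Q\<^esub> G) = a \<odot>\<^bsub>Q\<^esub> F \<oplus>\<^bsub>Q\<^esub> a \<odot>\<^bsub>Q\<^esub> G"
    unfolding s(1) t(1) Q_smult[OF s(2)] Q_smult[OF t(2)] Q_add[OF s(2) t(2)]
      Q_smult[OF L_add[OF s(2) t(2)]] Q_add[OF sm L_smult[OF t(2)]]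
  proof (rule cl_cong)
    fix x assume x: "x \<in> Y"
    interpret complex_inner_space "K x" by (rule inner_space[OF x])
    show "a \<odot>\<^bsub>K x\<^esub> (s x \<oplus>\<^bsub>K x\<^esub> t x) = a \<odot>\<^bsub>K x\<^esub> s x \<oplus>\<^bsub>K x\<^esub> a \<odot>\<^bsub>K x\<^esub> t x"
      by (rule smult_r_distr) (simp_all add: L_closed[OF s(2) x] L_closed[OF t(2) x])
  qed
qed

lemma cinner_self_integral:
  assumes "s \<in> L"
  shows "cinner Q (cl s) (cl s) = complex_of_real (\<integral>x. (vnorm (K x) (s x))\<^sup>2 \<partial>\<rho>)"
proof -
  have "(\<integral>x. cinner (K x) (s x) (s x) \<partial>\<rho>) = (\<integral>x. complex_of_real ((vnorm (K x) (s x))\<^sup>2) \<partial>\<rho>)"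
  proof (rule Bochner_Integration.integral_cong[OF refl])
    fix x assume "x \<in> space \<rho>"
    then have x: "x \<in> Y" by (simp add: space_\<rho>)
    show "cinner (K x) (s x) (s x) = complex_of_real ((vnorm (K x) (s x))\<^sup>2)"
      by (rule complex_inner_space.cinner_self[OF inner_space[OF x] L_closed[OF assms x]])
  qed
  then show ?thesis using assms by (simp add: Q_cinner integral_complex_of_real del: of_real_power)
qed

lemma complex_inner_space_Q: "complex_inner_space Q"
proof (intro complex_inner_space.intro module_Q complex_inner_space_axioms.intro)
  fix F assume "F \<in> carrier Q"
  then obtain s where s: "F = cl s" "s \<in> L" by (auto simp: Q_carrier)
  show "0 \<le> Re (cinner Q F F)"
    unfolding s(1) cinner_self_integral[OF s(2)] by (simp add: integral_nonneg)
  show "F = \<zero>\<^bsub>Q\<^esub>" if "cinner Q F F = 0"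
  proof -
    have "(\<integral>x. (vnorm (K x) (s x))\<^sup>2 \<partial>\<rho>) = 0"
      using that unfolding s(1) cinner_self_integral[OF s(2)] by simp
    then have "AE x in \<rho>. (vnorm (K x) (s x))\<^sup>2 = 0"
      using integral_nonneg_eq_0_iff_AE[OF vnorm_integrable[OF s(2)]] by simp
    then have "AE x in \<rho>. s x = \<zero>\<^bsub>K x\<^esub>"
    proof (rule AE_mp, intro AE_I2 impI)
      fix x assume "x \<in> space \<rho>" "(vnorm (K x) (s x))\<^sup>2 = 0"
      then show "s x = \<zero>\<^bsub>K x\<^esub>"
        using complex_inner_space.vnorm_eq_0_iff[OF inner_space L_closed[OF s(2)]]
        by (simp add: space_\<rho>)
    qed
    then show ?thesis by (simp add: s(1) Q_zero ae_class_eq_iff)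
  qed
  fix G assume "G \<in> carrier Q"
  then obtain t where t: "G = cl t" "t \<in> L" by (auto simp: Q_carrier)
  show "cinner Q (c \<odot>\<^bsub>Q\<^esub> F) G = c * cinner Q F G" for c
  proof -
    have "(\<integral>x. cinner (K x) (c \<odot>\<^bsub>K x\<^esub> s x) (t x) \<partial>\<rho>) = (\<integral>x. c * cinner (K x) (s x) (t x) \<partial>\<rho>)"
      using complex_inner_space.cinner_smult_left[OF inner_space L_closed[OF s(2)] L_closed[OF t(2)]]
      by (intro Bochner_Integration.integral_cong) (auto simp: space_\<rho>)
    then show ?thesis
      unfolding s(1) t(1) Q_smult[OF s(2)] Q_cinner[OF L_smult[OF s(2)] t(2)] Q_cinner[OF s(2) t(2)]
      by simp
  qed
  show "cinner Q G F = cnj (cinner Q F G)"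
  proof -
    have "(\<integral>x. cinner (K x) (t x) (s x) \<partial>\<rho>) = (\<integral>x. cnj (cinner (K x) (s x) (t x)) \<partial>\<rho>)"
      using complex_inner_space.cinner_commute[OF inner_space L_closed[OF s(2)] L_closed[OF t(2)]]
      by (intro Bochner_Integration.integral_cong) (auto simp: space_\<rho>)
    then show ?thesis
      unfolding s(1) t(1) Q_cinner[OF t(2) s(2)] Q_cinner[OF s(2) t(2)] by (simp add: integral_cnj)
  qed
  fix H assume "H \<in> carrier Q"
  then obtain r where r: "H = cl r" "r \<in> L" by (auto simp: Q_carrier)
  show "cinner Q (F \<oplus>\<^bsub>Q\<^esub> G) H = cinner Q F H + cinner Q G H"
  proof -
    have "(\<integral>x. cinner (K x) (s x \<oplus>\<^bsub>K x\<^esub> t x) (r x) \<partial>\<rho>)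
        = (\<integral>x. cinner (K x) (s x) (r x) + cinner (K x) (t x) (r x) \<partial>\<rho>)"
      using complex_inner_space.cinner_add_left[OF inner_space L_closed[OF s(2)] L_closed[OF t(2)]
          L_closed[OF r(2)]]
      by (intro Bochner_Integration.integral_cong) (auto simp: space_\<rho>)
    also have "\<dots> = (\<integral>x. cinner (K x) (s x) (r x) \<partial>\<rho>) + (\<integral>x. cinner (K x) (t x) (r x) \<partial>\<rho>)"
      by (intro Bochner_Integration.integral_add cinner_integrable s t r)
    finally show ?thesis
      unfolding s(1) t(1) r(1) Q_add[OF s(2) t(2)] Q_cinner[OF L_add[OF s(2) t(2)] r(2)]
        Q_cinner[OF s(2) r(2)] Q_cinner[OF t(2) r(2)] .
  qed
qed

sublocale Q: complex_inner_space Q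
  by (rule complex_inner_space_Q)

lemma vnorm_Q: "s \<in> L \<Longrightarrow> (vnorm Q (cl s))\<^sup>2 = (\<integral>x. (vnorm (K x) (s x))\<^sup>2 \<partial>\<rho>)"
  using Q.vnorm_power2[of "cl s"] by (simp add: cinner_self_integral Q_carrier)

lemma vnorm_Q_nn_integral:
  assumes "s \<in> L"
  shows "ennreal ((vnorm Q (cl s))\<^sup>2) = (\<integral>\<^sup>+x. ennreal ((vnorm (K x) (s x))\<^sup>2) \<partial>\<rho>)"
  unfolding vnorm_Q[OF assms]
  by (rule nn_integral_eq_integral[symmetric]) (auto intro: vnorm_integrable assms)

text \<open>Distances are written as nonnegative integrals, the form to which Fatou's lemma and
  dominated convergence apply directly.\<close>

lemma vnorm_Q_minus:
  assumes "s \<in> L" "t \<in> L"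
  shows "ennreal ((vnorm Q (cl s \<ominus>\<^bsub>Q\<^esub> cl t))\<^sup>2)
    = (\<integral>\<^sup>+x. ennreal ((vnorm (K x) (s x \<ominus>\<^bsub>K x\<^esub> t x))\<^sup>2) \<partial>\<rho>)"
proof -
  have "cl s \<ominus>\<^bsub>Q\<^esub> cl t = cl (\<lambda>x. s x \<oplus>\<^bsub>K x\<^esub> (-1) \<odot>\<^bsub>K x\<^esub> t x)"
    using assms L_smult[OF assms(2)] by (simp add: Q.minus_eq_smult Q_carrier Q_smult Q_add)
  also have "\<dots> = cl (\<lambda>x. s x \<ominus>\<^bsub>K x\<^esub> t x)"
    using complex_inner_space.minus_eq_smult[OF inner_space L_closed[OF assms(2)]]
    by (intro cl_cong) simp
  finally show ?thesis using vnorm_Q_nn_integral[OF L_minus[OF assms]] by simp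
qed

text \<open>Riesz--Fischer: a subsequence with summable increments converges almost everywhere, and
  Fatou's lemma shows that the whole sequence converges to the pointwise limit.\<close>

lemma hilbert_Q: "hilbert Q"
proof (rule Q.hilbertI)
  fix S :: "nat \<Rightarrow> _" assume S: "\<And>n. S n \<in> carrier Q"
    and Cauchy: "\<And>e. e > 0 \<Longrightarrow> \<exists>N. \<forall>m\<ge>N. \<forall>n\<ge>N. vnorm Q (S m \<ominus>\<^bsub>Q\<^esub> S n) < e"
  from S have "\<exists>s. s \<in> L \<and> S n = cl s" for n by (auto simp: Q_carrier)
  then obtain F where F: "\<And>n. F n \<in> L" and SF: "\<And>n. S n = cl (F n)" by metis
  define D where "D m n x = (vnorm (K x) (F m x \<ominus>\<^bsub>K x\<^esub> F n x))\<^sup>2" for m n x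
  have D_int: "(\<integral>\<^sup>+x. ennreal (D m n x) \<partial>\<rho>) = ennreal ((vnorm Q (S m \<ominus>\<^bsub>Q\<^esub> S n))\<^sup>2)" for m n
    unfolding D_def SF by (rule vnorm_Q_minus[OF F F, symmetric])
  have D_meas: "D m n \<in> borel_measurable \<rho>" for m n
    unfolding D_def by (intro borel_measurable_power vnorm_measurable L_borel L_minus F)
  have D_nonneg: "0 \<le> D m n x" for m n x by (simp add: D_def)
  \<comment> \<open>The squared increments of the subsequence will have integrals at most
    \<open>(1/8)^k\<close>. Weighted by \<open>4^k\<close> they still have a convergent sum, bounded
    by the sum of \<open>(1/2)^k\<close>. Where the weighted sum \<open>G x\<close> of the pointwise
    squares is finite, the increments are at most \<open>sqrt (G x)\<close> times
    \<open>(1/2)^k\<close>.\<close>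
  have "\<exists>R. \<forall>m\<ge>R. \<forall>n\<ge>R. vnorm Q (S m \<ominus>\<^bsub>Q\<^esub> S n) < sqrt ((1/8)^k)" for k :: nat
    by (rule Cauchy) simp
  then obtain R where R: "\<And>k m n. m \<ge> R k \<Longrightarrow> n \<ge> R k \<Longrightarrow> vnorm Q (S m \<ominus>\<^bsub>Q\<^esub> S n) < sqrt ((1/8)^k)"
    by metis
  \<comment> \<open>Adding up the thresholds puts both \<open>r k\<close> and
    \<open>r (Suc k)\<close> above \<open>R k\<close>. The summand \<open>k\<close> makes
    \<open>r\<close> unbounded, which the passage to the limit in \<open>Fatou\<close> relies
    on.\<close>
  define r where "r k = k + (\<Sum>j\<le>k. R j)" for k
  have r: "R k \<le> r k" "R k \<le> r (Suc k)" "k \<le> r k" for k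
    using member_le_sum[of k "{..k}" R] by (simp_all add: r_def)
  have small: "(vnorm Q (S (r (Suc k)) \<ominus>\<^bsub>Q\<^esub> S (r k)))\<^sup>2 \<le> (1/8)^k" for k
  proof -
    have "(vnorm Q (S (r (Suc k)) \<ominus>\<^bsub>Q\<^esub> S (r k)))\<^sup>2 \<le> (sqrt ((1/8)^k))\<^sup>2"
      using R[OF r(2) r(1), of k] S by (intro power_mono) auto
    then show ?thesis by simp
  qed
  define G where "G x = (\<Sum>k. ennreal (4^k * D (r (Suc k)) (r k) x))" for x
  have G_meas: "G \<in> borel_measurable \<rho>"
    unfolding G_def using D_meas by measurable
  have "(\<integral>\<^sup>+x. G x \<partial>\<rho>) = (\<Sum>k. \<integral>\<^sup>+x. ennreal (4^k * D (r (Suc k)) (r k) x) \<partial>\<rho>)"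
    unfolding G_def using D_meas by (intro nn_integral_suminf) measurable
  also have "\<dots> \<le> (\<Sum>k. ennreal ((1/2)^k))"
  proof (rule suminf_le)
    fix k
    have "(\<integral>\<^sup>+x. ennreal (4^k * D (r (Suc k)) (r k) x) \<partial>\<rho>)
        = ennreal (4^k) * (\<integral>\<^sup>+x. ennreal (D (r (Suc k)) (r k) x) \<partial>\<rho>)"
      using D_meas D_nonneg by (subst nn_integral_cmult[symmetric]) (auto simp: ennreal_mult)
    also have "\<dots> = ennreal (4^k * (vnorm Q (S (r (Suc k)) \<ominus>\<^bsub>Q\<^esub> S (r k)))\<^sup>2)"
      unfolding D_int by (simp add: ennreal_mult)
    also have "\<dots> \<le> ennreal (4^k * (1/8)^k)"
      by (intro ennreal_leI mult_left_mono small) simp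
    also have "(4::real)^k * (1/8)^k = (1/2)^k" by (simp flip: power_mult_distrib)
    finally show "(\<integral>\<^sup>+x. ennreal (4^k * D (r (Suc k)) (r k) x) \<partial>\<rho>) \<le> ennreal ((1/2)^k)" .
  qed auto
  also have "\<dots> < \<infinity>"
  proof -
    have "(\<Sum>k. ennreal ((1/2)^k)) = ennreal (\<Sum>k. (1/2)^k)"
      by (rule suminf_ennreal2) auto
    then show ?thesis by simp
  qed
  finally have AE_G: "AE x in \<rho>. G x \<noteq> \<infinity>"
    by (intro nn_integral_PInf_AE G_meas) auto
  have conv: "\<exists>p\<in>carrier (K x). (\<lambda>k. vnorm (K x) (F (r k) x \<ominus>\<^bsub>K x\<^esub> p)) \<longlonglongrightarrow> 0"
    if x: "x \<in> Y" and Gx: "G x \<noteq> \<infinity>" for x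
  proof (rule hilbert_geometric_limit[OF hilbert[OF x], where C = "sqrt (enn2real (G x))"])
    interpret complex_inner_space "K x" by (rule inner_space[OF x])
    show c: "F (r k) x \<in> carrier (K x)" for k by (rule L_closed[OF F x])
    define C where "C = enn2real (G x)"
    have C: "C \<ge> 0" "G x = ennreal C" using Gx by (cases "G x"; simp add: C_def)+
    show "vnorm (K x) (F (r (Suc k)) x \<ominus>\<^bsub>K x\<^esub> F (r k) x) \<le> sqrt (enn2real (G x)) * (1/2)^k" for k
    proof -
      have "ennreal (4^k * D (r (Suc k)) (r k) x) \<le> G x"
        unfolding G_def using sum_le_suminf[of "\<lambda>k. ennreal (4^k * D (r (Suc k)) (r k) x)" "{k}"] by simp
      then have "4^k * D (r (Suc k)) (r k) x \<le> C" using C by (simp add: ennreal_le_iff)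
      moreover have four: "(2^k)\<^sup>2 = (4::real)^k"
        by (simp add: power2_eq_square flip: power_mult_distrib)
      ultimately have "(2^k * vnorm (K x) (F (r (Suc k)) x \<ominus>\<^bsub>K x\<^esub> F (r k) x))\<^sup>2 \<le> C"
        using four by (simp add: D_def power_mult_distrib)
      then have "2^k * vnorm (K x) (F (r (Suc k)) x \<ominus>\<^bsub>K x\<^esub> F (r k) x) \<le> sqrt C"
        by (rule real_le_rsqrt)
      then show ?thesis by (simp add: field_simps power_one_over C_def)
    qed
  qed
  \<comment> \<open>On the null set where \<open>G\<close> is infinite the subsequence need not
    converge, and the limit is replaced by zero.\<close>
  define a where "a x = (if x \<in> Y \<and> G x \<noteq> \<infinity>
      then SOME p. p \<in> carrier (K x) \<and> (\<lambda>k. vnorm (K x) (F (r k) x \<ominus>\<^bsub>K x\<^esub> p)) \<longlonglongrightarrow> 0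
      else \<zero>\<^bsub>K x\<^esub>)" for x
  have a: "a x \<in> carrier (K x) \<and> (\<lambda>k. vnorm (K x) (F (r k) x \<ominus>\<^bsub>K x\<^esub> a x)) \<longlonglongrightarrow> 0"
    if "x \<in> Y" "G x \<noteq> \<infinity>" for x
    using someI_ex[OF conv[OF that, unfolded Bex_def]] that by (simp add: a_def)
  have a0: "a x = \<zero>\<^bsub>K x\<^esub>" if "G x = \<infinity>" for x using that by (simp add: a_def)
  have lim_closed: "a x \<in> carrier (K x)" if x: "x \<in> Y" for x
  proof -
    interpret complex_inner_space "K x" by (rule inner_space[OF x])
    show ?thesis using a[OF x] a0[of x] by (cases "G x = \<infinity>") auto
  qed
  have a_borel: "borel_section Y K T a"
  proof (rule borel_sectionI[OF lim_closed refl])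
    fix n
    \<comment> \<open>With the indicator as a factor the inner products converge at every point of
      the base, also where \<open>a\<close> has its default value zero. The set is measurable
      because \<open>G\<close> is.\<close>
    have "(\<lambda>x. indicator {x \<in> space \<rho>. G x \<noteq> \<infinity>} x * cinner (K x) (F (r k) x) (f n x)) \<in> borel_measurable \<rho>" for k
    proof (intro borel_measurable_times borel_measurable_indicator)
      show "{x \<in> space \<rho>. G x \<noteq> \<infinity>} \<in> sets \<rho>" using G_meas by measurable
      show "(\<lambda>x. cinner (K x) (F (r k) x) (f n x)) \<in> borel_measurable \<rho>"
        unfolding measurable_\<rho> by (rule base.measurable_cinner_commute[where V = K])
          (auto intro: inner_space f_closed L_closed F borel_section_measurable L_borel)
    qed
    then have "(\<lambda>x. cinner (K x) (a x) (f n x)) \<in> borel_measurable \<rho>"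
    proof (rule borel_measurable_LIMSEQ_metric)
      fix x assume "x \<in> space \<rho>"
      then have x: "x \<in> Y" by (simp add: space_\<rho>)
      interpret complex_inner_space "K x" by (rule inner_space[OF x])
      show "(\<lambda>k. indicator {x \<in> space \<rho>. G x \<noteq> \<infinity>} x * cinner (K x) (F (r k) x) (f n x))
          \<longlonglongrightarrow> cinner (K x) (a x) (f n x)"
      proof (cases "G x = \<infinity>")
        case True
        then show ?thesis using a0[of x] f_closed[OF x] by simp
      next
        case False
        have "(\<lambda>k. cinner (K x) (F (r k) x) (f n x)) \<longlonglongrightarrow> cinner (K x) (a x) (f n x)"
          using a[OF x False] by (intro tendsto_cinner_left L_closed[OF F x] f_closed[OF x]) auto
        then show ?thesis using False x by (simp add: space_\<rho>)
      qed
    qed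
    then show "(\<lambda>x. cinner (K x) (f n x) (a x)) \<in> borel_measurable B"
      unfolding measurable_\<rho> by (rule base.measurable_cinner_commute[where V = K, rotated 3])
        (auto intro: inner_space f_closed lim_closed)
  qed
  \<comment> \<open>For fixed \<open>m\<close> let the second index run through the subsequence:
    almost everywhere the squared distances tend to the squared distance from \<open>a\<close>, so
    the Cauchy estimate survives in the limit.\<close>
  have Fatou: "(\<integral>\<^sup>+x. ennreal ((vnorm (K x) (F m x \<ominus>\<^bsub>K x\<^esub> a x))\<^sup>2) \<partial>\<rho>) \<le> ennreal (e\<^sup>2)"
    if N: "\<And>m n. m \<ge> N \<Longrightarrow> n \<ge> N \<Longrightarrow> vnorm Q (S m \<ominus>\<^bsub>Q\<^esub> S n) < e" and m: "m \<ge> N" for N m e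
  proof -
    have "AE x in \<rho>. ennreal ((vnorm (K x) (F m x \<ominus>\<^bsub>K x\<^esub> a x))\<^sup>2) = liminf (\<lambda>k. ennreal (D m (r k) x))"
    proof (rule AE_mp[OF AE_G], intro AE_I2 impI)
      fix x assume "x \<in> space \<rho>" and Gx: "G x \<noteq> \<infinity>"
      then have x: "x \<in> Y" by (simp add: space_\<rho>)
      interpret complex_inner_space "K x" by (rule inner_space[OF x])
      have c: "F m x \<in> carrier (K x)" "F (r k) x \<in> carrier (K x)" "a x \<in> carrier (K x)" for k m
        using L_closed[OF F x] lim_closed[OF x] by auto
      let ?d = "\<lambda>k. vnorm (K x) (F m x \<ominus>\<^bsub>K x\<^esub> F (r k) x)"
      have "?d \<longlonglongrightarrow> vnorm (K x) (F m x \<ominus>\<^bsub>K x\<^esub> a x)"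
      proof (rule LIM_zero_cancel, rule Lim_null_comparison)
        show "\<forall>\<^sub>F k in sequentially. norm (?d k - vnorm (K x) (F m x \<ominus>\<^bsub>K x\<^esub> a x))
            \<le> vnorm (K x) (F (r k) x \<ominus>\<^bsub>K x\<^esub> a x)"
        proof (rule always_eventually, rule allI)
          fix k
          show "norm (?d k - vnorm (K x) (F m x \<ominus>\<^bsub>K x\<^esub> a x)) \<le> vnorm (K x) (F (r k) x \<ominus>\<^bsub>K x\<^esub> a x)"
            using vnorm_triangle_minus[OF c(1) c(2) c(3), of m k] vnorm_triangle_minus[OF c(1) c(3) c(2), of m k]
              vnorm_minus_commute[OF c(3) c(2), of k] by (simp add: abs_le_iff)
        qed
        show "(\<lambda>k. vnorm (K x) (F (r k) x \<ominus>\<^bsub>K x\<^esub> a x)) \<longlonglongrightarrow> 0" using a[OF x Gx] by simp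
      qed
      then have "(\<lambda>k. ennreal (D m (r k) x)) \<longlonglongrightarrow> ennreal ((vnorm (K x) (F m x \<ominus>\<^bsub>K x\<^esub> a x))\<^sup>2)"
        unfolding D_def by (intro tendsto_ennrealI tendsto_power)
      then show "ennreal ((vnorm (K x) (F m x \<ominus>\<^bsub>K x\<^esub> a x))\<^sup>2) = liminf (\<lambda>k. ennreal (D m (r k) x))"
        by (intro lim_imp_Liminf[symmetric]) simp_all
    qed
    then have "(\<integral>\<^sup>+x. ennreal ((vnorm (K x) (F m x \<ominus>\<^bsub>K x\<^esub> a x))\<^sup>2) \<partial>\<rho>)
        = (\<integral>\<^sup>+x. liminf (\<lambda>k. ennreal (D m (r k) x)) \<partial>\<rho>)"
      by (rule nn_integral_cong_AE)
    also have "\<dots> \<le> liminf (\<lambda>k. \<integral>\<^sup>+x. ennreal (D m (r k) x) \<partial>\<rho>)"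
      using D_meas by (intro nn_integral_liminf) measurable
    also have "\<dots> \<le> limsup (\<lambda>k. \<integral>\<^sup>+x. ennreal (D m (r k) x) \<partial>\<rho>)"
      by (rule Liminf_le_Limsup) simp
    also have "\<dots> \<le> ennreal (e\<^sup>2)"
    proof (rule Limsup_bounded)
      show "\<forall>\<^sub>F k in sequentially. (\<integral>\<^sup>+x. ennreal (D m (r k) x) \<partial>\<rho>) \<le> ennreal (e\<^sup>2)"
        using eventually_ge_at_top[of N]
      proof eventually_elim
        case (elim k)
        then have "vnorm Q (S m \<ominus>\<^bsub>Q\<^esub> S (r k)) < e" using r(3)[of k] by (intro N m) linarith
        then show ?case unfolding D_int using S by (intro ennreal_leI power_mono) auto
      qed
    qed
    finally show ?thesis .
  qed
  \<comment> \<open>\<open>F N - a\<close> is square integrable by the estimate just proved, taken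
    at \<open>m = N\<close> and \<open>e = 1\<close>, and \<open>a\<close> is the difference of
    \<open>F N\<close> and \<open>F N - a\<close>.\<close>
  have a_L: "a \<in> L"
  proof -
    obtain N where N: "\<And>m n. m \<ge> N \<Longrightarrow> n \<ge> N \<Longrightarrow> vnorm Q (S m \<ominus>\<^bsub>Q\<^esub> S n) < 1"
      using Cauchy[of 1] by auto
    have "(\<lambda>x. F N x \<ominus>\<^bsub>K x\<^esub> a x) \<in> L"
      using borel_section_minus[OF L_borel[OF F] a_borel, of N] Fatou[OF N order_refl]
      by (simp add: square_integrable_sections_def le_less_trans[of _ 1])
    from L_minus[OF F[of N] this] have "(\<lambda>x. F N x \<ominus>\<^bsub>K x\<^esub> (F N x \<ominus>\<^bsub>K x\<^esub> a x)) \<in> L" .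
    moreover have "F N x \<ominus>\<^bsub>K x\<^esub> (F N x \<ominus>\<^bsub>K x\<^esub> a x) = a x" if x: "x \<in> Y" for x
    proof -
      interpret complex_inner_space "K x" by (rule inner_space[OF x])
      show ?thesis using L_closed[OF F x, of N] lim_closed[OF x]
        by (simp add: a_minus_def M.minus_add M.r_neg2)
    qed
    ultimately show ?thesis
      by (intro L_I[OF a_borel vnorm_integrable[of "\<lambda>x. F N x \<ominus>\<^bsub>K x\<^esub> (F N x \<ominus>\<^bsub>K x\<^esub> a x)"]]) auto
  qed
  show "\<exists>p\<in>carrier Q. (\<lambda>n. vnorm Q (S n \<ominus>\<^bsub>Q\<^esub> p)) \<longlonglongrightarrow> 0"
  proof (rule bexI)
    show ca: "cl a \<in> carrier Q" using a_L by (simp add: Q_carrier)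
    show "(\<lambda>n. vnorm Q (S n \<ominus>\<^bsub>Q\<^esub> cl a)) \<longlonglongrightarrow> 0"
    proof (rule LIMSEQ_I)
      fix e :: real assume e: "e > 0"
      then obtain N where N: "\<And>m n. m \<ge> N \<Longrightarrow> n \<ge> N \<Longrightarrow> vnorm Q (S m \<ominus>\<^bsub>Q\<^esub> S n) < e / 2"
        using Cauchy[of "e / 2"] by auto
      have "norm (vnorm Q (S m \<ominus>\<^bsub>Q\<^esub> cl a) - 0) < e" if m: "m \<ge> N" for m
      proof -
        have "ennreal ((vnorm Q (S m \<ominus>\<^bsub>Q\<^esub> cl a))\<^sup>2) \<le> ennreal ((e/2)\<^sup>2)"
          using Fatou[OF N m] unfolding SF vnorm_Q_minus[OF F a_L] .
        then have "(vnorm Q (S m \<ominus>\<^bsub>Q\<^esub> cl a))\<^sup>2 \<le> (e/2)\<^sup>2" by (simp add: ennreal_le_iff)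
        then have "vnorm Q (S m \<ominus>\<^bsub>Q\<^esub> cl a) \<le> e/2" by (rule power2_le_imp_le) (use e in simp)
        then show ?thesis using e Q.vnorm_nonneg[OF Q.minus_closed[OF S ca]] by simp
      qed
      then show "\<exists>N. \<forall>m\<ge>N. norm (vnorm Q (S m \<ominus>\<^bsub>Q\<^esub> cl a) - 0) < e" by blast
    qed
  qed
qed

end

section \<open>Countable directed systems\<close>

locale cofinal_sequence =
  fixes \<Lambda> :: "'i set" and leq :: "'i \<Rightarrow> 'i \<Rightarrow> bool" and c :: "nat \<Rightarrow> 'i"
  assumes directed: "directed_set \<Lambda> leq"
    and c_in [simp]: "c n \<in> \<Lambda>"
    and c_mono: "m \<le> n \<Longrightarrow> leq (c m) (c n)"
    and c_cofinal: "i \<in> \<Lambda> \<Longrightarrow> \<exists>n. leq i (c n)"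

text \<open>Enumerate \<open>\<Lambda>\<close>, possibly with repetitions, and choose each new index
  above both its predecessor and the next enumerated element.\<close>

lemma countable_directed_cofinal_sequence:
  assumes "countable \<Lambda>" and dir: "directed_set \<Lambda> leq"
  obtains c where "cofinal_sequence \<Lambda> leq c"
proof -
  have ne: "\<Lambda> \<noteq> {}" and trans: "transp_on \<Lambda> leq" and refl: "reflp_on \<Lambda> leq"
    and ub: "\<And>i j. i \<in> \<Lambda> \<Longrightarrow> j \<in> \<Lambda> \<Longrightarrow> \<exists>k\<in>\<Lambda>. leq i k \<and> leq j k"
    using dir by (auto simp: directed_set_def)
  define e where "e = from_nat_into \<Lambda>"
  have e: "e n \<in> \<Lambda>" for n unfolding e_def by (rule from_nat_into[OF ne])
  have "\<exists>c. \<forall>n. (c n \<in> \<Lambda> \<and> leq (e n) (c n)) \<and> leq (c n) (c (Suc n))"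
  proof (rule dependent_nat_choice)
    show "\<exists>k. k \<in> \<Lambda> \<and> leq (e 0) k" using ub[OF e e] by blast
    show "\<exists>k. (k \<in> \<Lambda> \<and> leq (e (Suc n)) k) \<and> leq i k" if "i \<in> \<Lambda> \<and> leq (e n) i" for i n
      using ub[OF e] that by blast
  qed
  then obtain c where c: "\<And>n. c n \<in> \<Lambda>" "\<And>n. leq (e n) (c n)" "\<And>n. leq (c n) (c (Suc n))" by blast
  have "cofinal_sequence \<Lambda> leq c"
  proof
    show "leq (c m) (c n)" if "m \<le> n" for m n
      using that
    proof (induction rule: dec_induct)
      case base
      then show ?case using refl c(1) by (auto dest: reflp_onD)
    next
      case (step n)
      then show ?case using transp_onD[OF trans] c by blast
    qed
    show "\<exists>n. leq i (c n)" if "i \<in> \<Lambda>" for i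
      using from_nat_into_surj[OF assms(1) that] c(2) by (auto simp: e_def)
  qed (use dir c in auto)
  then show ?thesis by (rule that)
qed

context cofinal_sequence
begin

lemma leq_trans: "\<lbrakk>i \<in> \<Lambda>; j \<in> \<Lambda>; k \<in> \<Lambda>; leq i j; leq j k\<rbrakk> \<Longrightarrow> leq i k"
  using directed unfolding directed_set_def by (blast dest: transp_onD)

lemma upper_bound:
  assumes "i \<in> \<Lambda>" "j \<in> \<Lambda>"
  obtains k where "k \<in> \<Lambda>" "leq i k" "leq j k"
  using directed assms unfolding directed_set_def by blast

text \<open>By monotonicity a dominating index may be taken as late as desired, so tests along the
  sequence may skip an initial segment.\<close>

lemma c_cofinal_ge:
  assumes "i \<in> \<Lambda>"
  obtains n where "n \<ge> k" "leq i (c n)"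
proof -
  obtain n where "leq i (c n)" using c_cofinal[OF assms] by blast
  then have "leq i (c (max n k))" using leq_trans[OF assms c_in c_in] c_mono[of n "max n k"] by simp
  then show ?thesis using that[of "max n k"] by simp
qed

end

text \<open>The ambient set \<open>Z\<close> is a parameter: for the base spaces it is their union
  \<open>X\<close>, whereas for the total spaces it is the completed total space, which may exceed
  their union.\<close>

locale measurable_system = cofinal_sequence \<Lambda> leq c
  for \<Lambda> :: "'i set" and leq and c +
  fixes N :: "'i \<Rightarrow> 'y measure" and Z :: "'y set"
  assumes system: "strictly_inductive_measurable \<Lambda> leq N"
    and spaces: "i \<in> \<Lambda> \<Longrightarrow> space (N i) \<subseteq> Z"
begin

lemma space_mono: "\<lbrakk>i \<in> \<Lambda>; j \<in> \<Lambda>; leq i j\<rbrakk> \<Longrightarrow> space (N i) \<subseteq> space (N j)"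
  using system unfolding strictly_inductive_measurable_def by blast

lemma sets_mono: "\<lbrakk>i \<in> \<Lambda>; j \<in> \<Lambda>; leq i j\<rbrakk> \<Longrightarrow> sets (N i) \<subseteq> sets (N j)"
  using system unfolding strictly_inductive_measurable_def by blast

lemma sets_trace:
  assumes "i \<in> \<Lambda>" "j \<in> \<Lambda>" "leq i j" "A \<in> sets (N j)"
  shows "A \<inter> space (N i) \<in> sets (N i)"
proof -
  have "sets (N i) = {A \<inter> space (N i) |A. A \<in> sets (N j)}"
    using system assms unfolding strictly_inductive_measurable_def by blast
  then show ?thesis using assms(4) by blast
qed

text \<open>Each stage lies below a late member of the cofinal sequence, and the trace on it is the
  trace of the trace on that member.\<close>

lemma tilde_setsI:
  assumes A: "A \<subseteq> Z" and "\<And>n. n \<ge> k \<Longrightarrow> A \<inter> space (N (c n)) \<in> sets (N (c n))"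
  shows "A \<in> tilde_sets Z \<Lambda> N"
proof -
  have "A \<inter> space (N i) \<in> sets (N i)" if i: "i \<in> \<Lambda>" for i
  proof -
    obtain n where n: "n \<ge> k" "leq i (c n)" using c_cofinal_ge[OF i] .
    have "A \<inter> space (N (c n)) \<inter> space (N i) \<in> sets (N i)"
      by (rule sets_trace[OF i c_in n(2) assms(2)[OF n(1)]])
    moreover have "A \<inter> space (N (c n)) \<inter> space (N i) = A \<inter> space (N i)"
      using space_mono[OF i c_in n(2)] by blast
    ultimately show ?thesis by simp
  qed
  then show ?thesis using A by (simp add: tilde_sets_def)
qed

lemma tilde_setsD: "A \<in> tilde_sets Z \<Lambda> N \<Longrightarrow> i \<in> \<Lambda> \<Longrightarrow> A \<inter> space (N i) \<in> sets (N i)"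
  by (simp add: tilde_sets_def)

text \<open>At a common upper bound of \<open>i\<close> and \<open>j\<close> the set
  \<open>A\<close> is still measurable, and from there it has a measurable trace on stage
  \<open>j\<close>.\<close>

lemma sets_subset_tilde_sets:
  assumes i: "i \<in> \<Lambda>" and A: "A \<in> sets (N i)"
  shows "A \<in> tilde_sets Z \<Lambda> N"
proof -
  have "A \<inter> space (N j) \<in> sets (N j)" if j: "j \<in> \<Lambda>" for j
  proof -
    obtain k where k: "k \<in> \<Lambda>" "leq i k" "leq j k" using upper_bound[OF i j] .
    then show ?thesis using sets_trace[OF j k(1,3)] sets_mono[OF i k(1,2)] A by blast
  qed
  then show ?thesis using spaces[OF i] sets.sets_into_space[OF A] by (auto simp: tilde_sets_def)
qed

end

section \<open>Inductive limits of Hilbert spaces\<close>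

lemma stage:
  assumes "i \<in> \<Lambda>" "S \<subseteq> carrier (E i)"
  shows "stage \<Lambda> E S \<in> \<Lambda>" "S \<subseteq> carrier (E (stage \<Lambda> E S))"
  using someI[of "\<lambda>i. i \<in> \<Lambda> \<and> S \<subseteq> carrier (E i)" i] assms by (auto simp: stage_def)

lemma ind_lim_simps [simp]:
  "carrier (ind_lim \<Lambda> E) = (\<Union>i\<in>\<Lambda>. carrier (E i))"
  "\<zero>\<^bsub>ind_lim \<Lambda> E\<^esub> = \<zero>\<^bsub>E (stage \<Lambda> E {})\<^esub>"
  "u \<oplus>\<^bsub>ind_lim \<Lambda> E\<^esub> v = u \<oplus>\<^bsub>E (stage \<Lambda> E {u, v})\<^esub> v"
  "a \<odot>\<^bsub>ind_lim \<Lambda> E\<^esub> u = a \<odot>\<^bsub>E (stage \<Lambda> E {u})\<^esub> u"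
  "cinner (ind_lim \<Lambda> E) u v = cinner (E (stage \<Lambda> E {u, v})) u v"
  by (simp_all add: ind_lim_def)

text \<open>The stage at which \<open>ind_lim\<close> evaluates an operation is chosen without
  regard to \<open>i\<close>. Both stages embed isometrically in a common upper bound, and there the
  two results agree.\<close>

lemma isometric_subspace_ind_lim:
  assumes sys: "strictly_inductive_hilbert \<Lambda> leq E" and i: "i \<in> \<Lambda>"
  shows "isometric_subspace (E i) (ind_lim \<Lambda> E)"
proof -
  have iso: "isometric_subspace (E j) (E k)" if "j \<in> \<Lambda>" "k \<in> \<Lambda>" "leq j k" for j k
    using sys that unfolding strictly_inductive_hilbert_def by blast
  have *: "\<exists>k. isometric_subspace (E i) (E k) \<and> isometric_subspace (E (stage \<Lambda> E S)) (E k)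
      \<and> S \<subseteq> carrier (E (stage \<Lambda> E S))" if S: "S \<subseteq> carrier (E i)" for S
  proof -
    note st = stage[of i \<Lambda> S E, OF i S]
    obtain k where "k \<in> \<Lambda>" "leq i k" "leq (stage \<Lambda> E S) k"
      using sys i st(1) unfolding strictly_inductive_hilbert_def directed_set_def by blast
    then show ?thesis using iso i st by blast
  qed
  show ?thesis
    unfolding isometric_subspace_def ind_lim_simps
  proof (intro conjI ballI allI)
    show "carrier (E i) \<subseteq> (\<Union>i\<in>\<Lambda>. carrier (E i))" using i by blast
    obtain k where "isometric_subspace (E i) (E k)" "isometric_subspace (E (stage \<Lambda> E {})) (E k)"
      using *[of "{}"] by auto
    then show "\<zero>\<^bsub>E i\<^esub> = \<zero>\<^bsub>E (stage \<Lambda> E {})\<^esub>" using isometric_subspaceD(2) by metis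
  next
    fix u v assume uv: "u \<in> carrier (E i)" "v \<in> carrier (E i)"
    then obtain k where "isometric_subspace (E i) (E k)" "isometric_subspace (E (stage \<Lambda> E {u, v})) (E k)"
      "{u, v} \<subseteq> carrier (E (stage \<Lambda> E {u, v}))" using *[of "{u, v}"] by auto
    then show "u \<oplus>\<^bsub>E i\<^esub> v = u \<oplus>\<^bsub>E (stage \<Lambda> E {u, v})\<^esub> v"
      "cinner (E i) u v = cinner (E (stage \<Lambda> E {u, v})) u v"
      using uv isometric_subspaceD(3,5)[of "E i" "E k" u v]
        isometric_subspaceD(3,5)[of "E (stage \<Lambda> E {u, v})" "E k" u v] by simp_all
  next
    fix a u assume u: "u \<in> carrier (E i)"
    then obtain k where "isometric_subspace (E i) (E k)" "isometric_subspace (E (stage \<Lambda> E {u})) (E k)"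
      "{u} \<subseteq> carrier (E (stage \<Lambda> E {u}))" using *[of "{u}"] by auto
    then show "a \<odot>\<^bsub>E i\<^esub> u = a \<odot>\<^bsub>E (stage \<Lambda> E {u})\<^esub> u"
      using u isometric_subspaceD(4)[of "E i" "E k" u a]
        isometric_subspaceD(4)[of "E (stage \<Lambda> E {u})" "E k" u a] by simp
  qed
qed

text \<open>Directedness puts two arguments into one stage, so the stage chosen by
  \<open>ind_lim\<close> contains both; that stage embeds in \<open>V\<close>, which fixes the
  value. Applied below to the spaces \<open>local_L2\<close>.\<close>

lemma ind_lim_isometric_subspace:
  assumes sys: "strictly_inductive_hilbert \<Lambda> leq E"
    and V: "\<And>i. i \<in> \<Lambda> \<Longrightarrow> isometric_subspace (E i) V"
  shows "isometric_subspace (ind_lim \<Lambda> E) V"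
proof -
  have dir: "directed_set \<Lambda> leq"
    and iso: "isometric_subspace (E j) (E k)" if "j \<in> \<Lambda>" "k \<in> \<Lambda>" "leq j k" for j k
    using sys that unfolding strictly_inductive_hilbert_def by blast+
  have mono: "u \<in> carrier (E k)" if "j \<in> \<Lambda>" "k \<in> \<Lambda>" "leq j k" "u \<in> carrier (E j)" for j k u
    using isometric_subspaceD(1)[OF iso] that by blast
  have *: "isometric_subspace (E (stage \<Lambda> E {u, v})) V \<and> {u, v} \<subseteq> carrier (E (stage \<Lambda> E {u, v}))"
    if uv: "u \<in> carrier (ind_lim \<Lambda> E)" "v \<in> carrier (ind_lim \<Lambda> E)" for u v
  proof -
    obtain i j where ij: "i \<in> \<Lambda>" "u \<in> carrier (E i)" "j \<in> \<Lambda>" "v \<in> carrier (E j)"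
      using uv by auto
    then obtain k where k: "k \<in> \<Lambda>" "leq i k" "leq j k"
      using sys unfolding strictly_inductive_hilbert_def directed_set_def by blast
    then have "{u, v} \<subseteq> carrier (E k)" using mono ij by blast
    from stage[of k \<Lambda> _ E, OF k(1) this] show ?thesis using V by blast
  qed
  show ?thesis
    unfolding isometric_subspace_def
  proof (intro conjI ballI allI)
    show "carrier (ind_lim \<Lambda> E) \<subseteq> carrier V" using isometric_subspaceD(1)[OF V] by auto
    obtain i where "i \<in> \<Lambda>" using sys unfolding strictly_inductive_hilbert_def directed_set_def by blast
    then show "\<zero>\<^bsub>ind_lim \<Lambda> E\<^esub> = \<zero>\<^bsub>V\<^esub>"
      using stage(1)[of i \<Lambda> "{}" E] isometric_subspaceD(2)[OF V] by simp
  next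
    fix u v assume "u \<in> carrier (ind_lim \<Lambda> E)" "v \<in> carrier (ind_lim \<Lambda> E)"
    from *[OF this] show "u \<oplus>\<^bsub>ind_lim \<Lambda> E\<^esub> v = u \<oplus>\<^bsub>V\<^esub> v" "cinner (ind_lim \<Lambda> E) u v = cinner V u v"
      using isometric_subspaceD(3,5)[of "E (stage \<Lambda> E {u, v})" V u v] by simp_all
  next
    fix a u assume u: "u \<in> carrier (ind_lim \<Lambda> E)"
    from *[OF this this] show "a \<odot>\<^bsub>ind_lim \<Lambda> E\<^esub> u = a \<odot>\<^bsub>V\<^esub> u"
      using isometric_subspaceD(4)[of "E (stage \<Lambda> E {u})" V u a] by simp
  qed
qed

section \<open>The completed bundle\<close>

locale bundle_limit = cofinal_sequence \<Lambda> leq c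
  for \<Lambda> :: "'i set" and leq and c +
  fixes M :: "'i \<Rightarrow> 'x measure" and H :: "'x \<Rightarrow> 'i \<Rightarrow> 'v inner_space"
    and T :: "'i \<Rightarrow> ('x \<times> 'v) measure" and Ht :: "'x \<Rightarrow> 'v inner_space"
  assumes loc_bundle: "locally_hilbert_bundle \<Lambda> leq M H T"
    and completion: "x \<in> lim_space \<Lambda> M \<Longrightarrow> hilbert_completion (ind_lim \<Lambda> (H x)) (Ht x)"
begin

abbreviation X :: "'x set" where "X \<equiv> lim_space \<Lambda> M"
abbreviation Mt :: "'x measure" where "Mt \<equiv> tilde_measure \<Lambda> M"
abbreviation Tt :: "('x \<times> 'v) measure" where "Tt \<equiv> tilde_total_space X Ht \<Lambda> T"

lemma measure_system: "strictly_inductive_measure \<Lambda> leq M"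
  using loc_bundle by (simp add: locally_hilbert_bundle_def)

lemma space_in_X: "i \<in> \<Lambda> \<Longrightarrow> x \<in> space (M i) \<Longrightarrow> x \<in> X"
  by (auto simp: lim_space_def)

sublocale M: measurable_system \<Lambda> leq c M X
  using measure_system
  by unfold_locales (auto simp: strictly_inductive_measure_def lim_space_def)

lemma fibre_system: "x \<in> X \<Longrightarrow> strictly_inductive_hilbert \<Lambda> leq (H x)"
  using loc_bundle by (simp add: locally_hilbert_bundle_def)

lemma hilbert_H: "x \<in> X \<Longrightarrow> i \<in> \<Lambda> \<Longrightarrow> hilbert (H x i)"
  using fibre_system[of x] by (simp add: strictly_inductive_hilbert_def)

lemma hilbert_Ht: "x \<in> X \<Longrightarrow> hilbert (Ht x)"
  using completion by (simp add: hilbert_completion_def)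

lemma inner_space_Ht: "x \<in> X \<Longrightarrow> complex_inner_space (Ht x)"
  by (rule hilbert_imp_complex_inner_space[OF hilbert_Ht])

lemma lim_subspace: "x \<in> X \<Longrightarrow> isometric_subspace (ind_lim \<Lambda> (H x)) (Ht x)"
  using completion by (simp add: hilbert_completion_def)

lemma fibre_subspace: "x \<in> X \<Longrightarrow> i \<in> \<Lambda> \<Longrightarrow> isometric_subspace (H x i) (Ht x)"
  using isometric_subspace_ind_lim[OF fibre_system] lim_subspace isometric_subspace_trans by blast

lemma fibre_inclusion: "x \<in> X \<Longrightarrow> i \<in> \<Lambda> \<Longrightarrow> isometric_inclusion (H x i) (Ht x)"
  by (intro isometric_inclusionI fibre_subspace hilbert_imp_complex_inner_space hilbert_H hilbert_Ht)

lemma fibre_mono: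
  "\<lbrakk>x \<in> X; m \<le> n; u \<in> carrier (H x (c m))\<rbrakk> \<Longrightarrow> u \<in> carrier (H x (c n))"
  using fibre_system[of x] c_mono[of m n] isometric_subspaceD(1)[of "H x (c m)" "H x (c n)" u]
  by (simp add: strictly_inductive_hilbert_def)

lemma fibre_closed: "\<lbrakk>x \<in> X; i \<in> \<Lambda>; u \<in> carrier (H x i)\<rbrakk> \<Longrightarrow> u \<in> carrier (Ht x)"
  by (rule isometric_subspaceD(1)[OF fibre_subspace])

lemma fibre_dense:
  assumes x: "x \<in> X" and h: "h \<in> carrier (Ht x)" and e: "e > 0"
  obtains n u where "u \<in> carrier (H x (c n))" "vnorm (Ht x) (h \<ominus>\<^bsub>Ht x\<^esub> u) < e"
proof -
  have "dense_subset (Ht x) (carrier (ind_lim \<Lambda> (H x)))"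
    using completion[OF x] by (simp add: hilbert_completion_def)
  then obtain u where "u \<in> carrier (ind_lim \<Lambda> (H x))" and lt: "vnorm (Ht x) (h \<ominus>\<^bsub>Ht x\<^esub> u) < e"
    using h e unfolding complex_inner_space.dense_subset_iff[OF inner_space_Ht[OF x]] by blast
  then obtain i where u: "i \<in> \<Lambda>" "u \<in> carrier (H x i)" by auto
  obtain n where "leq i (c n)" using c_cofinal[OF u(1)] by blast
  then have "u \<in> carrier (H x (c n))"
    using fibre_system[OF x] u(1,2) isometric_subspaceD(1)[of "H x i" "H x (c n)" u]
    by (simp add: strictly_inductive_hilbert_def)
  then show ?thesis using lt by (rule that)
qed

definition F :: "'i \<Rightarrow> nat \<Rightarrow> 'x \<Rightarrow> 'v" where
  "F i = (SOME f. framed_bundle (space (M i)) (\<lambda>x. H x i) (T i) f)"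

lemma framed: "i \<in> \<Lambda> \<Longrightarrow> framed_bundle (space (M i)) (\<lambda>x. H x i) (T i) (F i)"
proof -
  assume "i \<in> \<Lambda>"
  then have "borel_bundle (space (M i)) (\<lambda>x. H x i) (T i)"
    using loc_bundle by (simp add: locally_hilbert_bundle_def)
  then show ?thesis unfolding F_def by (metis borel_bundle_framed someI)
qed

lemma space_T: "i \<in> \<Lambda> \<Longrightarrow> p \<in> space (T i) \<longleftrightarrow> fst p \<in> space (M i) \<and> snd p \<in> carrier (H (fst p) i)"
  by (rule framed_bundle.in_space_T[OF framed])

lemma sets_M: "i \<in> \<Lambda> \<Longrightarrow> sets (M i) = base_sets (space (M i)) (T i)"
  using loc_bundle by (simp add: locally_hilbert_bundle_def)

lemma sets_base_M: "i \<in> \<Lambda> \<Longrightarrow> sets (base_algebra (space (M i)) (T i)) = sets (M i)"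
  using framed_bundle.sets_B[OF framed] sets_M by simp

sublocale T: measurable_system \<Lambda> leq c T "total_space X Ht"
proof
  show "strictly_inductive_measurable \<Lambda> leq T" using loc_bundle by (simp add: locally_hilbert_bundle_def)
  show "space (T i) \<subseteq> total_space X Ht" if "i \<in> \<Lambda>" for i
  proof
    fix p assume "p \<in> space (T i)"
    then show "p \<in> total_space X Ht"
      using that fibre_closed space_in_X by (cases p) (auto simp: space_T total_space_def)
  qed
qed

lemma space_Mt [simp]: "space Mt = X" and sets_Mt: "sets Mt = tilde_sets X \<Lambda> M"
  using tilde_measure(1,2)[OF measure_system] by auto

lemma space_Tt [simp]: "space Tt = total_space X Ht"
  and sets_Tt: "sets Tt = tilde_sets (total_space X Ht) \<Lambda> T"
  using tilde_total_space[of \<Lambda> T X Ht] T.spaces by auto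

text \<open>The trace on stage \<open>i\<close> of the preimage of \<open>E\<close> is the preimage
  of \<open>E \<inter> space (M i)\<close>, so the two conditions coincide stage by stage.\<close>

lemma tilde_sets_eq_base_sets: "tilde_sets X \<Lambda> M = base_sets X Tt"
proof -
  have "E \<inter> space (M i) \<in> sets (M i) \<longleftrightarrow> fst -` E \<inter> space Tt \<inter> space (T i) \<in> sets (T i)"
    if i: "i \<in> \<Lambda>" for E i
  proof -
    have "fst -` E \<inter> space Tt \<inter> space (T i) = fst -` (E \<inter> space (M i)) \<inter> space (T i)"
      using T.spaces[OF i] space_T[OF i] by auto
    then show ?thesis by (simp add: sets_M[OF i] base_sets_def)
  qed
  then show ?thesis by (auto simp: base_sets_def sets_Tt tilde_sets_def)
qed

lemma sets_base_Mt: "sets (base_algebra X Tt) = sets Mt"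
  using base_algebra(2)[of Tt X Ht] by (simp add: sets_Mt tilde_sets_eq_base_sets)

lemma id_measurable_M: "i \<in> \<Lambda> \<Longrightarrow> (\<lambda>x. x) \<in> measurable (M i) Mt"
proof (rule measurableI)
  fix A assume i: "i \<in> \<Lambda>" and "A \<in> sets Mt"
  then show "(\<lambda>x. x) -` A \<inter> space (M i) \<in> sets (M i)" using M.tilde_setsD by (simp add: sets_Mt)
qed (simp add: space_in_X)

lemma id_measurable_T: "i \<in> \<Lambda> \<Longrightarrow> (\<lambda>p. p) \<in> measurable (T i) Tt"
proof (rule measurableI)
  fix A assume i: "i \<in> \<Lambda>" and "A \<in> sets Tt"
  then show "(\<lambda>p. p) -` A \<inter> space (T i) \<in> sets (T i)" using T.tilde_setsD by (simp add: sets_Tt)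
qed (use T.spaces in auto)

lemma F_closed: "i \<in> \<Lambda> \<Longrightarrow> x \<in> space (M i) \<Longrightarrow> F i n x \<in> carrier (H x i)"
  by (rule framed_bundle.f_closed[OF framed])

lemma F_borel: "i \<in> \<Lambda> \<Longrightarrow> (\<lambda>x. (x, F i n x)) \<in> measurable (M i) (T i)"
  using framed_bundle.f_borel[OF framed] measurable_cong_sets[OF sets_base_M refl] by blast

section \<open>A fundamental sequence of the completed bundle\<close>

definition first_index :: "'x \<Rightarrow> nat" where
  "first_index x = (LEAST n. x \<in> space (M (c n)))"

lemma first_index_le: "x \<in> X \<Longrightarrow> first_index x \<le> n \<longleftrightarrow> x \<in> space (M (c n))"
proof -
  assume x: "x \<in> X"
  then obtain i where i: "i \<in> \<Lambda>" "x \<in> space (M i)" by (auto simp: lim_space_def)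
  then obtain m where "leq i (c m)" using c_cofinal by blast
  then have "x \<in> space (M (c m))" using M.space_mono[OF i(1) c_in] i(2) by blast
  then have "x \<in> space (M (c (first_index x)))" unfolding first_index_def by (rule LeastI)
  moreover have "space (M (c (first_index x))) \<subseteq> space (M (c n))" if "first_index x \<le> n"
    by (rule M.space_mono[OF c_in c_in c_mono[OF that]])
  ultimately show ?thesis unfolding first_index_def by (blast intro: Least_le)
qed

lemma space_sets_Mt: "i \<in> \<Lambda> \<Longrightarrow> space (M i) \<in> sets Mt"
  unfolding sets_Mt by (rule M.sets_subset_tilde_sets) auto

text \<open>The level sets cut \<open>X\<close> into countably many measurable pieces, on each of
  which \<open>g\<close> below is given by a single stage.\<close>

lemma first_index_measurable: "first_index \<in> measurable Mt (count_space UNIV)"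
proof -
  have [measurable]: "Measurable.pred Mt (\<lambda>x. x \<in> space (M (c n)))" for n
    using space_sets_Mt[OF c_in, of n] by measurable
  show ?thesis unfolding first_index_def by measurable
qed

text \<open>Extending \<open>F (c k) n\<close> by zero would not do: the zero section need not be a Borel map. Instead,
  points outside \<open>space (M (c k))\<close> use the fundamental sequence of the first stage that contains them.\<close>

definition g :: "nat \<Rightarrow> nat \<Rightarrow> 'x \<Rightarrow> 'v" where
  "g k n x = F (c (max k (first_index x))) n x"

lemma g_eq: "x \<in> space (M (c k)) \<Longrightarrow> g k n x = F (c k) n x"
  using first_index_le[of x k] space_in_X[of "c k" x] by (simp add: g_def max_absorb1)

text \<open>On \<open>space (M (c l))\<close> the index \<open>max k (first_index x)\<close> never
  exceeds \<open>l\<close>, so the values lie in the fibres of stage \<open>c l\<close>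
  already.\<close>

lemma g_fibre:
  assumes x: "x \<in> space (M (c l))" and kl: "k \<le> l"
  shows "g k n x \<in> carrier (H x (c l))"
proof -
  have X: "x \<in> X" by (rule space_in_X[OF c_in x])
  have "g k n x \<in> carrier (H x (c (max k (first_index x))))"
    unfolding g_def by (rule F_closed) (use first_index_le[OF X, of "max k (first_index x)"] in auto)
  moreover have "max k (first_index x) \<le> l" using kl x first_index_le[OF X] by simp
  ultimately show ?thesis using fibre_mono[OF X] by blast
qed

lemma g_closed: "x \<in> X \<Longrightarrow> g k n x \<in> carrier (Ht x)"
proof -
  assume x: "x \<in> X"
  then have "x \<in> space (M (c (max k (first_index x))))" using first_index_le[OF x, of "max k (first_index x)"] by simp
  from g_fibre[OF this, of k n] have "g k n x \<in> carrier (H x (c (max k (first_index x))))" by simp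
  then show ?thesis by (rule fibre_closed[OF x c_in])
qed

text \<open>On the piece where \<open>first_index\<close> is \<open>m\<close>, the section is
  \<open>F (c (max k m)) n\<close>, a Borel map into its own stage and hence into the completed
  total space. Preimages are countable unions of such pieces.\<close>

lemma g_borel: "(\<lambda>x. (x, g k n x)) \<in> measurable Mt Tt"
proof (rule measurableI)
  show "(x, g k n x) \<in> space Tt" if "x \<in> space Mt" for x
    using that g_closed by (simp add: total_space_def)
  fix A assume A: "A \<in> sets Tt"
  let ?B = "\<lambda>m. {x \<in> space (M (c (max k m))). (x, F (c (max k m)) n x) \<in> A}"
  have B: "?B m \<in> sets Mt" for m
  proof -
    have "(\<lambda>x. (x, F (c (max k m)) n x)) \<in> measurable (M (c (max k m))) Tt"
      using measurable_compose[OF F_borel id_measurable_T] by simp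
    from measurable_sets[OF this A] have "?B m \<in> sets (M (c (max k m)))"
      by (simp add: vimage_def Int_def conj_commute)
    then show ?thesis unfolding sets_Mt by (rule M.sets_subset_tilde_sets[OF c_in])
  qed
  have "(\<lambda>x. (x, g k n x)) -` A \<inter> space Mt = (\<Union>m. (first_index -` {m} \<inter> space Mt) \<inter> ?B m)"
    using first_index_le by (fastforce simp: g_def)
  also have "\<dots> \<in> sets Mt"
    by (intro sets.countable_UN image_subsetI sets.Int B measurable_sets[OF first_index_measurable]) auto
  finally show "(\<lambda>x. (x, g k n x)) -` A \<inter> space Mt \<in> sets Mt" .
qed

text \<open>A measurable set of stage \<open>c l\<close> belongs to the limit
  \<open>\<sigma>\<close>-algebra, so \<open>g_borel\<close> applies to it; restricting to
  \<open>space (M (c l))\<close> leads back to the stage.\<close>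

lemma g_borel_stage:
  assumes kl: "k \<le> l"
  shows "(\<lambda>x. (x, g k n x)) \<in> measurable (M (c l)) (T (c l))"
proof (rule measurableI)
  show "(x, g k n x) \<in> space (T (c l))" if "x \<in> space (M (c l))" for x
    using that g_fibre[OF that kl] by (simp add: space_T)
  fix A assume "A \<in> sets (T (c l))"
  then have "A \<in> sets Tt" unfolding sets_Tt by (rule T.sets_subset_tilde_sets[OF c_in])
  then show "(\<lambda>x. (x, g k n x)) -` A \<inter> space (M (c l)) \<in> sets (M (c l))"
    using measurable_compose[OF id_measurable_M g_borel] by (intro measurable_sets) auto
qed

text \<open>Both arguments have measurable inner products with the frame \<open>F (c l)\<close>: the
  section because it is a Borel map into \<open>T (c l)\<close>, the fibre coordinate because
  \<open>F (c l)\<close> is fundamental.\<close>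

lemma g_cinner_stage:
  assumes kl: "k \<le> l"
  shows "(\<lambda>p. cinner (Ht (fst p)) (g k n (fst p)) (snd p)) \<in> borel_measurable (T (c l))"
proof -
  interpret fr: framed_bundle "space (M (c l))" "\<lambda>x. H x (c l)" "T (c l)" "F (c l)"
    by (rule framed[OF c_in])
  interpret tot: measurable_frame "T (c l)" "\<lambda>p. H (fst p) (c l)" "\<lambda>n p. F (c l) n (fst p)"
    by (rule fr.total_frame)
  have B: "(\<lambda>x. cinner (H x (c l)) (F (c l) m x) (g k n x)) \<in> borel_measurable fr.B" for m
    using g_borel_stage[OF kl] measurable_cong_sets[OF sets_base_M[OF c_in] refl]
    by (intro fr.measurable_cinner_section) blast
  have "(\<lambda>p. cinner (H (fst p) (c l)) (g k n (fst p)) (snd p)) \<in> borel_measurable (T (c l))"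
  proof (rule tot.measurable_cinner[where V = "\<lambda>p. H (fst p) (c l)"])
    show "(\<lambda>p. cinner (H (fst p) (c l)) (F (c l) m (fst p)) (g k n (fst p))) \<in> borel_measurable (T (c l))"
      for m by (rule measurable_compose[OF fr.fst_measurable B])
    show "(\<lambda>p. cinner (H (fst p) (c l)) (F (c l) m (fst p)) (snd p)) \<in> borel_measurable (T (c l))" for m
      by (rule fr.f_cinner_T)
  qed (use g_fibre[OF _ kl] in \<open>auto simp: space_T intro: tot.inner_space isometric_subspace_refl\<close>)
  moreover have "cinner (H (fst p) (c l)) (g k n (fst p)) (snd p) = cinner (Ht (fst p)) (g k n (fst p)) (snd p)"
    if "p \<in> space (T (c l))" for p
    using that g_fibre[OF _ kl] fibre_subspace[OF space_in_X[OF c_in] c_in]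
    by (auto simp: space_T isometric_subspace_def)
  ultimately show ?thesis by (subst measurable_cong[symmetric]) auto
qed

text \<open>For \<open>l < k\<close> the values of \<open>g k n\<close> need not lie in the fibres
  of stage \<open>c l\<close>; \<open>tilde_setsI\<close> lets the test begin at
  \<open>l = k\<close>.\<close>

lemma g_cinner_Tt: "(\<lambda>p. cinner (Ht (fst p)) (g k n (fst p)) (snd p)) \<in> borel_measurable Tt"
proof (rule measurableI)
  fix A :: "complex set" assume A: "A \<in> sets borel"
  let ?h = "\<lambda>p. cinner (Ht (fst p)) (g k n (fst p)) (snd p)"
  show "?h -` A \<inter> space Tt \<in> sets Tt"
    unfolding sets_Tt
  proof (rule T.tilde_setsI[where k = k])
    fix l assume "k \<le> l"
    from measurable_sets[OF g_cinner_stage[OF this] A]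
    have "?h -` A \<inter> space (T (c l)) \<in> sets (T (c l))" .
    moreover have "?h -` A \<inter> space Tt \<inter> space (T (c l)) = ?h -` A \<inter> space (T (c l))"
      using T.spaces[OF c_in] by auto
    ultimately show "?h -` A \<inter> space Tt \<inter> space (T (c l)) \<in> sets (T (c l))" by simp
  qed simp
qed simp

text \<open>The projection of \<open>u\<close> to a stage over \<open>x\<close> is orthogonal to the
  fundamental sequence of that stage, hence zero. So \<open>u\<close> is orthogonal to all stages,
  and their union is dense in the completed fibre.\<close>

lemma g_total:
  assumes x: "x \<in> X" and u: "u \<in> carrier (Ht x)"
    and orth: "\<And>k n. cinner (Ht x) (g k n x) u = 0"
  shows "u = \<zero>\<^bsub>Ht x\<^esub>"
proof -
  interpret V: complex_inner_space "Ht x" by (rule inner_space_Ht[OF x])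
  have orth_fibre: "cinner (Ht x) v u = 0" if v: "v \<in> carrier (H x (c m))" for v m
  proof -
    \<comment> \<open>Late enough for the stage to contain the vector \<open>v\<close> in its fibre
      and the point \<open>x\<close> in its base.\<close>
    define l where "l = max m (first_index x)"
    have xl: "x \<in> space (M (c l))" using first_index_le[OF x, of l] by (simp add: l_def)
    have vl: "v \<in> carrier (H x (c l))" by (rule fibre_mono[OF x _ v]) (simp add: l_def)
    interpret isometric_inclusion "H x (c l)" "Ht x" by (rule fibre_inclusion[OF x c_in])
    interpret fr: framed_bundle "space (M (c l))" "\<lambda>x. H x (c l)" "T (c l)" "F (c l)"
      by (rule framed[OF c_in])
    obtain p where p: "p \<in> carrier (H x (c l))"
      and op: "\<And>w. w \<in> carrier (H x (c l)) \<Longrightarrow> cinner (Ht x) w (u \<ominus>\<^bsub>Ht x\<^esub> p) = 0"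
      by (rule orthogonal_projection[OF hilbert_H[OF x c_in] u]) blast
    have pV: "p \<in> carrier (Ht x)" by (rule carrier_mono[OF p])
    have eq: "cinner (Ht x) w u = cinner (H x (c l)) w p" if "w \<in> carrier (H x (c l))" for w
      using op[OF that] that p pV u carrier_mono[OF that] by (simp add: V.cinner_minus_right cinner_eq)
    have "cinner (H x (c l)) (F (c l) n x) p = 0" for n
      using orth[of l n] eq[OF fr.f_closed[OF xl]] by (simp add: g_eq[OF xl])
    then have "p = \<zero>\<^bsub>H x (c l)\<^esub>" by (rule fr.f_total[OF xl p])
    then show ?thesis using eq[OF vl] vl by simp
  qed
  \<comment> \<open>Replacing one \<open>u\<close> in its inner product with itself by
    \<open>u - v\<close> costs nothing, as \<open>v\<close> is orthogonal to \<open>u\<close>.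
    Taking \<open>e\<close> to be half the norm of \<open>u\<close> then rules out a positive
    norm.\<close>
  have "(vnorm (Ht x) u)\<^sup>2 \<le> e * vnorm (Ht x) u" if e: "e > 0" for e
  proof -
    obtain m v where v: "v \<in> carrier (H x (c m))" and lt: "vnorm (Ht x) (u \<ominus>\<^bsub>Ht x\<^esub> v) < e"
      by (rule fibre_dense[OF x u e])
    have vV: "v \<in> carrier (Ht x)" by (rule fibre_closed[OF x c_in v])
    have "cinner (Ht x) u u = cinner (Ht x) (u \<ominus>\<^bsub>Ht x\<^esub> v) u"
      using orth_fibre[OF v] u vV by (simp add: V.cinner_minus_left)
    then have "(vnorm (Ht x) u)\<^sup>2 = cmod (cinner (Ht x) (u \<ominus>\<^bsub>Ht x\<^esub> v) u)"
      using u by (metis V.cinner_self norm_of_real abs_power2)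
    also have "\<dots> \<le> vnorm (Ht x) (u \<ominus>\<^bsub>Ht x\<^esub> v) * vnorm (Ht x) u"
      using u vV by (intro V.Cauchy_Schwarz) auto
    also have "\<dots> \<le> e * vnorm (Ht x) u" using lt u by (intro mult_right_mono) auto
    finally show ?thesis .
  qed
  from this[of "vnorm (Ht x) u / 2"] have "\<not> vnorm (Ht x) u > 0"
    by (auto simp: power2_eq_square)
  then show ?thesis using u V.vnorm_nonneg[OF u] V.vnorm_eq_0_iff[OF u] by simp
qed

definition G :: "nat \<Rightarrow> 'x \<Rightarrow> 'v" where
  "G m = g (fst (prod_decode m)) (snd (prod_decode m))"

lemma G_prod_encode: "G (prod_encode (k, n)) = g k n"
  by (simp add: G_def)

lemma framed_tilde: "framed_bundle X Ht Tt G"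
proof
  show "space Tt = total_space X Ht" by simp
  have borel: "(\<lambda>x. (x, G n x)) \<in> measurable (base_algebra X Tt) Tt" for n
    unfolding measurable_cong_sets[OF sets_base_Mt refl] G_def by (rule g_borel)
  have cin: "(\<lambda>p. cinner (Ht (fst p)) (G n (fst p)) (snd p)) \<in> borel_measurable Tt" for n
    unfolding G_def by (rule g_cinner_Tt)
  \<comment> \<open>Separation of points takes place within one fibre, where \<open>g_total\<close>
    is applied to the difference of \<open>h\<close> and \<open>k\<close>.\<close>
  have "h = k" if x: "x \<in> X" and hk: "h \<in> carrier (Ht x)" "k \<in> carrier (Ht x)"
    and eq: "\<And>n. cinner (Ht x) (G n x) h = cinner (Ht x) (G n x) k" for x h k
  proof -
    interpret V: complex_inner_space "Ht x" by (rule inner_space_Ht[OF x])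
    have "cinner (Ht x) (g m n x) (h \<ominus>\<^bsub>Ht x\<^esub> k) = 0" for m n
      using eq[of "prod_encode (m, n)"] hk g_closed[OF x]
      by (simp add: V.cinner_minus_right G_prod_encode)
    from g_total[OF x _ this] show ?thesis using hk by (simp add: V.minus_eq_zero_iff)
  qed
  \<comment> \<open>The mutual inner products of the sections are the functions in
    \<open>cin\<close> composed with the Borel maps in \<open>borel\<close>.\<close>
  then show "fundamental_sequence X Ht Tt G"
    unfolding fundamental_sequence_def is_section_def case_prod_beta'
    using borel cin measurable_compose[OF borel cin]
    by (auto simp: G_def g_closed total_space_def)
qed (rule hilbert_Ht)

lemma borel_bundle_tilde: "borel_bundle X Ht Tt"
  using framed_tilde unfolding borel_bundle_def framed_bundle_def by blast

section \<open>The direct integral\<close>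

sublocale tilde: square_integrable_bundle X Ht Tt G Mt
  by (intro square_integrable_bundle.intro framed_tilde square_integrable_bundle_axioms.intro)
    (rule sets_base_Mt[symmetric])

section \<open>The stages as restrictions of the limit measure\<close>

lemma emeasure_Mt:
  assumes i: "i \<in> \<Lambda>" and A: "A \<in> sets (M i)"
  shows "emeasure Mt A = emeasure (M i) A"
proof -
  have A': "A \<in> tilde_sets X \<Lambda> M" by (rule M.sets_subset_tilde_sets[OF i A])
  have eq: "emeasure (M j) B = emeasure (M k) B"
    if "j \<in> \<Lambda>" "k \<in> \<Lambda>" "leq j k" "B \<in> sets (M j)" for j k B
    using measure_system that unfolding strictly_inductive_measure_def by blast
  \<comment> \<open>The supremum defining the limit measure is attained at \<open>i\<close>: a
    common upper bound of \<open>i\<close> and \<open>j\<close> carries both measures.\<close>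
  have "emeasure (M j) (A \<inter> space (M j)) \<le> emeasure (M i) A" if j: "j \<in> \<Lambda>" for j
  proof -
    obtain k where k: "k \<in> \<Lambda>" "leq i k" "leq j k" using upper_bound[OF i j] .
    have Ak: "A \<in> sets (M k)" using M.sets_mono[OF i k(1,2)] A by blast
    have "emeasure (M j) (A \<inter> space (M j)) = emeasure (M k) (A \<inter> space (M j))"
      by (rule eq[OF j k(1,3) M.tilde_setsD[OF A' j]])
    also have "\<dots> \<le> emeasure (M k) A" using Ak by (intro emeasure_mono) auto
    also have "\<dots> = emeasure (M i) A" using eq[OF i k(1,2) A] by simp
    finally show ?thesis .
  qed
  then have "(SUP j\<in>\<Lambda>. emeasure (M j) (A \<inter> space (M j))) \<le> emeasure (M i) A"
    by (rule SUP_least)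
  moreover have "emeasure (M i) A \<le> (SUP j\<in>\<Lambda>. emeasure (M j) (A \<inter> space (M j)))"
    using SUP_upper[OF i, of "\<lambda>j. emeasure (M j) (A \<inter> space (M j))"] sets.sets_into_space[OF A]
    by (simp add: Int_absorb2)
  ultimately show ?thesis using tilde_measure(3)[OF measure_system A'] by simp
qed

lemma space_Int_sets_Mt: "i \<in> \<Lambda> \<Longrightarrow> space (M i) \<inter> space Mt \<in> sets Mt"
  using space_sets_Mt by blast

text \<open>This gives access to the theory of restricted measures, by which null sets,
  measurability and integrals pass between a stage and the limit.\<close>

lemma restrict_Mt: "i \<in> \<Lambda> \<Longrightarrow> restrict_space Mt (space (M i)) = M i"
proof (rule measure_eqI)
  assume i: "i \<in> \<Lambda>"
  show sets: "sets (restrict_space Mt (space (M i))) = sets (M i)"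
  proof
    show "sets (restrict_space Mt (space (M i))) \<subseteq> sets (M i)"
      using M.tilde_setsD[OF _ i] by (auto simp: sets_restrict_space sets_Mt Int_commute)
    show "sets (M i) \<subseteq> sets (restrict_space Mt (space (M i)))"
    proof
      fix A assume A: "A \<in> sets (M i)"
      then have "A \<in> sets Mt" "A \<subseteq> space (M i)"
        using M.sets_subset_tilde_sets[OF i] sets.sets_into_space by (auto simp: sets_Mt)
      then show "A \<in> sets (restrict_space Mt (space (M i)))"
        by (simp add: sets_restrict_space_iff[OF space_Int_sets_Mt[OF i]])
    qed
  qed
  fix A assume "A \<in> sets (restrict_space Mt (space (M i)))"
  then have A: "A \<in> sets (M i)" using sets by simp
  then have "emeasure (restrict_space Mt (space (M i))) A = emeasure Mt A"
    using sets.sets_into_space[OF A] by (intro emeasure_restrict_space[OF space_Int_sets_Mt[OF i]]) auto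
  then show "emeasure (restrict_space Mt (space (M i))) A = emeasure (M i) A"
    using emeasure_Mt[OF i A] by simp
qed

lemma AE_stage: "i \<in> \<Lambda> \<Longrightarrow> (AE x in Mt. P x) \<Longrightarrow> (AE x in M i. P x)"
  by (subst restrict_Mt[symmetric]) (auto simp: AE_restrict_space_iff[OF space_Int_sets_Mt])

lemma measurable_extend:
  fixes h :: "'x \<Rightarrow> complex"
  assumes i: "i \<in> \<Lambda>" and h: "h \<in> borel_measurable (M i)"
    and zero: "\<And>x. x \<in> X \<Longrightarrow> x \<notin> space (M i) \<Longrightarrow> h x = 0"
  shows "h \<in> borel_measurable Mt"
proof -
  have "(\<lambda>x. indicator (space (M i)) x *\<^sub>R h x) \<in> borel_measurable Mt"
    using h borel_measurable_restrict_space_iff[OF space_Int_sets_Mt[OF i], of h]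
    by (simp add: restrict_Mt[OF i])
  moreover have "indicator (space (M i)) x *\<^sub>R h x = h x" if "x \<in> space Mt" for x
    using zero that by (auto simp: indicator_def)
  ultimately show ?thesis by (subst measurable_cong[symmetric]) auto
qed

lemma measurable_stage:
  fixes h :: "'x \<Rightarrow> 'z"
  assumes "h \<in> measurable Mt N" "i \<in> \<Lambda>"
  shows "h \<in> measurable (M i) N"
  using measurable_compose[OF id_measurable_M[OF assms(2)] assms(1)] by simp

lemma nn_integral_stage:
  assumes i: "i \<in> \<Lambda>"
  shows "(\<integral>\<^sup>+x. h x \<partial>M i) = (\<integral>\<^sup>+x. h x * indicator (space (M i)) x \<partial>Mt)"
  by (subst restrict_Mt[OF i, symmetric]) (rule nn_integral_restrict_space[OF space_Int_sets_Mt[OF i]])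

lemma integral_stage:
  fixes h :: "'x \<Rightarrow> complex"
  assumes i: "i \<in> \<Lambda>" and zero: "\<And>x. x \<in> X \<Longrightarrow> x \<notin> space (M i) \<Longrightarrow> h x = 0"
  shows "(\<integral>x. h x \<partial>M i) = (\<integral>x. h x \<partial>Mt)"
proof -
  have "(\<integral>x. h x \<partial>M i) = (\<integral>x. indicator (space (M i)) x *\<^sub>R h x \<partial>Mt)"
    by (subst restrict_Mt[OF i, symmetric]) (rule integral_restrict_space[OF space_Int_sets_Mt[OF i]])
  also have "\<dots> = (\<integral>x. h x \<partial>Mt)"
    using zero by (intro Bochner_Integration.integral_cong) (auto simp: indicator_def)
  finally show ?thesis .
qed

section \<open>Sections of the stages inside the completed direct integral\<close>

abbreviation LS :: "'i \<Rightarrow> ('x \<Rightarrow> 'v) set" where "LS \<equiv> local_sections \<Lambda> M H T"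

lemma zero_lim: "x \<in> X \<Longrightarrow> \<zero>\<^bsub>ind_lim \<Lambda> (H x)\<^esub> = \<zero>\<^bsub>Ht x\<^esub>"
  by (rule isometric_subspaceD(2)[OF lim_subspace])

lemma LS_lim: "s \<in> LS i \<Longrightarrow> x \<in> X \<Longrightarrow> s x \<in> carrier (ind_lim \<Lambda> (H x))"
  by (simp only: local_sections_def is_section_def mem_Collect_eq)

lemma LS_closed: "s \<in> LS i \<Longrightarrow> x \<in> X \<Longrightarrow> s x \<in> carrier (Ht x)"
  by (rule isometric_subspaceD(1)[OF lim_subspace LS_lim])

lemma LS_zero:
  assumes "s \<in> LS i" "x \<in> X" "x \<notin> space (M i)"
  shows "s x = \<zero>\<^bsub>Ht x\<^esub>"
  by (rule trans[OF local_sections_zero[OF assms] zero_lim[OF assms(2)]])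

lemma LS_square_integrable:
  "s \<in> LS i \<Longrightarrow> s \<in> square_integrable_sections (space (M i)) (\<lambda>x. H x i) (T i) (M i)"
  by (simp add: local_sections_def)

text \<open>\<open>G n\<close> need not take values in the fibres of stage \<open>i\<close>, so the
  frame \<open>F i\<close> is used with inner products in the larger space \<open>Ht x\<close>. The
  inner products of \<open>G n\<close> with \<open>F i m\<close> are measurable since
  \<open>F i m\<close> is a Borel map into \<open>T i\<close>, hence into the completed total space.
  Outside the stage the section vanishes.\<close>

lemma LS_borel:
  assumes i: "i \<in> \<Lambda>" and s: "s \<in> LS i"
  shows "borel_section X Ht Tt s"
proof (rule tilde.borel_sectionI[OF LS_closed[OF s] refl])
  fix n
  interpret fr: framed_bundle "space (M i)" "\<lambda>x. H x i" "T i" "F i" by (rule framed[OF i])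
  have sb: "borel_section (space (M i)) (\<lambda>x. H x i) (T i) s"
    using LS_square_integrable[OF s] by (simp add: square_integrable_sections_def)
  have FG: "(\<lambda>x. cinner (Ht x) (G n x) (F i m x)) \<in> borel_measurable fr.B" for m
    unfolding measurable_cong_sets[OF sets_base_M[OF i] refl]
    using measurable_compose[OF F_borel[OF i] measurable_compose[OF id_measurable_T[OF i] tilde.f_cinner_T]]
    by simp
  have "(\<lambda>x. cinner (Ht x) (s x) (G n x)) \<in> borel_measurable fr.B"
  proof (rule fr.base.measurable_cinner[where V = Ht])
    show "(\<lambda>x. cinner (Ht x) (F i m x) (G n x)) \<in> borel_measurable fr.B" for m
      by (rule fr.base.measurable_cinner_commute[OF _ _ _ FG])
        (auto intro: inner_space_Ht tilde.f_closed fibre_closed[OF _ i] fr.f_closed space_in_X[OF i])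
    show "(\<lambda>x. cinner (H x i) (F i m x) (s x)) \<in> borel_measurable fr.B" for m
      by (rule fr.borel_section_measurable[OF sb])
  qed (auto intro: inner_space_Ht tilde.f_closed fibre_subspace[OF _ i] space_in_X[OF i]
      fr.borel_section_closed[OF sb])
  then have "(\<lambda>x. cinner (Ht x) (G n x) (s x)) \<in> borel_measurable fr.B"
    by (rule fr.base.measurable_cinner_commute[where V = Ht, rotated 3])
      (auto intro: inner_space_Ht tilde.f_closed LS_closed[OF s] space_in_X[OF i])
  then have "(\<lambda>x. cinner (Ht x) (G n x) (s x)) \<in> borel_measurable (M i)"
    unfolding measurable_cong_sets[OF sets_base_M[OF i] refl] .
  then have "(\<lambda>x. cinner (Ht x) (G n x) (s x)) \<in> borel_measurable Mt"
  proof (rule measurable_extend[OF i])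
    fix x assume x: "x \<in> X" "x \<notin> space (M i)"
    interpret complex_inner_space "Ht x" by (rule inner_space_Ht[OF x(1)])
    show "cinner (Ht x) (G n x) (s x) = 0" using tilde.f_closed[OF x(1)] by (simp add: LS_zero[OF s x])
  qed
  then show "(\<lambda>x. cinner (Ht x) (G n x) (s x)) \<in> borel_measurable tilde.B"
    by (simp only: tilde.measurable_\<rho>)
qed

lemma LS_subset_L:
  assumes i: "i \<in> \<Lambda>" and s: "s \<in> LS i"
  shows "s \<in> tilde.L"
proof -
  have "(\<integral>\<^sup>+x. ennreal ((vnorm (Ht x) (s x))\<^sup>2) \<partial>Mt)
      = (\<integral>\<^sup>+x. ennreal ((vnorm (Ht x) (s x))\<^sup>2) * indicator (space (M i)) x \<partial>Mt)"
  proof (rule nn_integral_cong)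
    fix x assume "x \<in> space Mt"
    then have x: "x \<in> X" by simp
    interpret complex_inner_space "Ht x" by (rule inner_space_Ht[OF x])
    show "ennreal ((vnorm (Ht x) (s x))\<^sup>2) = ennreal ((vnorm (Ht x) (s x))\<^sup>2) * indicator (space (M i)) x"
      by (cases "x \<in> space (M i)") (simp_all add: LS_zero[OF s x])
  qed
  also have "\<dots> = (\<integral>\<^sup>+x. ennreal ((vnorm (Ht x) (s x))\<^sup>2) \<partial>M i)"
    by (rule nn_integral_stage[OF i, symmetric])
  also have "\<dots> = (\<integral>\<^sup>+x. ennreal ((vnorm (H x i) (s x))\<^sup>2) \<partial>M i)"
  proof (rule nn_integral_cong)
    fix x assume x: "x \<in> space (M i)"
    have "s x \<in> carrier (H x i)"
      using LS_square_integrable[OF s] x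
      by (auto simp: square_integrable_sections_def borel_section_def is_section_def)
    then show "ennreal ((vnorm (Ht x) (s x))\<^sup>2) = ennreal ((vnorm (H x i) (s x))\<^sup>2)"
      using isometric_inclusion.vnorm_eq[OF fibre_inclusion[OF space_in_X[OF i x] i]] by simp
  qed
  also have "\<dots> < \<infinity>"
    using LS_square_integrable[OF s] by (simp add: square_integrable_sections_def)
  finally show ?thesis using LS_borel[OF i s] by (simp add: square_integrable_sections_def)
qed

text \<open>Both quotients are taken modulo the limit measure, so the classes are literally the same
  sets. The inner product of the stage integrates over \<open>M i\<close>; since the sections vanish
  off \<open>space (M i)\<close>, integration over \<open>Mt\<close> gives the same value.\<close>

lemma local_L2_subspace:
  assumes i: "i \<in> \<Lambda>"
  shows "isometric_subspace (local_L2 \<Lambda> M H T i) tilde.Q"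
proof -
  note sub = LS_subset_L[OF i]
  let ?U = "local_L2 \<Lambda> M H T i"
  have cin: "cinner (ind_lim \<Lambda> (H x)) (s x) (t x) = cinner (Ht x) (s x) (t x)"
    if "s \<in> LS i" "t \<in> LS i" "x \<in> X" for s t x
    by (rule isometric_subspaceD(5)[OF lim_subspace LS_lim LS_lim]) (use that in auto)
  have car: "carrier ?U = tilde.cl ` LS i" by (simp add: local_L2_def)
  show ?thesis
    unfolding isometric_subspace_def car
  proof (intro conjI ballI allI)
    show "tilde.cl ` LS i \<subseteq> carrier tilde.Q" using sub by (auto simp: tilde.Q_carrier)
    show "\<zero>\<^bsub>?U\<^esub> = \<zero>\<^bsub>tilde.Q\<^esub>"
      unfolding local_L2_def L2_quotient_simps(2) tilde.Q_zero by (rule tilde.cl_cong) (rule zero_lim)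
  next
    fix a u assume "u \<in> tilde.cl ` LS i"
    then obtain s where s: "u = tilde.cl s" "s \<in> LS i" by blast
    show "a \<odot>\<^bsub>?U\<^esub> u = a \<odot>\<^bsub>tilde.Q\<^esub> u"
      unfolding s(1) tilde.Q_smult[OF sub[OF s(2)]] local_L2_def L2_quotient_smult[OF s(2)]
      by (rule tilde.cl_cong) (rule isometric_subspaceD(4)[OF lim_subspace LS_lim[OF s(2)]])
  next
    fix u v assume "u \<in> tilde.cl ` LS i" "v \<in> tilde.cl ` LS i"
    then obtain s t where s: "u = tilde.cl s" "s \<in> LS i" and t: "v = tilde.cl t" "t \<in> LS i" by blast
    show "u \<oplus>\<^bsub>?U\<^esub> v = u \<oplus>\<^bsub>tilde.Q\<^esub> v"
      unfolding s(1) t(1) tilde.Q_add[OF sub[OF s(2)] sub[OF t(2)]] local_L2_def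
        L2_quotient_add[OF s(2) t(2)]
      by (rule tilde.cl_cong)
        (rule isometric_subspaceD(3)[OF lim_subspace LS_lim[OF s(2)] LS_lim[OF t(2)]])
    have "cinner ?U u v = (\<integral>x. cinner (ind_lim \<Lambda> (H x)) (s x) (t x) \<partial>M i)"
      unfolding s(1) t(1) local_L2_def
    proof (rule L2_quotient_cinner[OF s(2) t(2) AE_stage[OF i]])
      fix s t assume st: "s \<in> LS i" "t \<in> LS i"
      have "(\<lambda>x. cinner (Ht x) (s x) (t x)) \<in> borel_measurable (M i)"
        by (rule measurable_stage[OF tilde.cinner_measurable[OF sub[OF st(1)] sub[OF st(2)]] i])
      then show "(\<lambda>x. cinner (ind_lim \<Lambda> (H x)) (s x) (t x)) \<in> borel_measurable (M i)"
        by (rule measurable_cong[THEN iffD2, rotated]) (rule cin[OF st space_in_X[OF i]])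
    qed
    also have "\<dots> = (\<integral>x. cinner (Ht x) (s x) (t x) \<partial>M i)"
      by (intro Bochner_Integration.integral_cong refl cin s t space_in_X[OF i])
    also have "\<dots> = (\<integral>x. cinner (Ht x) (s x) (t x) \<partial>Mt)"
    proof (rule integral_stage[OF i])
      fix x assume x: "x \<in> X" "x \<notin> space (M i)"
      interpret complex_inner_space "Ht x" by (rule inner_space_Ht[OF x(1)])
      show "cinner (Ht x) (s x) (t x) = 0"
        using LS_closed[OF t(2) x(1)] by (simp add: LS_zero[OF s(2) x])
    qed
    also have "\<dots> = cinner tilde.Q u v"
      unfolding s(1) t(1) tilde.Q_cinner[OF sub[OF s(2)] sub[OF t(2)]] ..
    finally show "cinner ?U u v = cinner tilde.Q u v" .
  qed
qed

lemma local_direct_integral_subspace: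
  "isometric_subspace (local_direct_integral \<Lambda> M H T) tilde.Q"
  unfolding local_direct_integral_def
proof (rule ind_lim_isometric_subspace[OF _ local_L2_subspace])
  show "strictly_inductive_hilbert \<Lambda> leq (local_L2 \<Lambda> M H T)"
    using loc_bundle by (simp add: locally_hilbert_bundle_def)
qed

section \<open>Approximation by projections to the stages\<close>

definition proj :: "nat \<Rightarrow> ('x \<Rightarrow> 'v) \<Rightarrow> 'x \<Rightarrow> 'v" where
  "proj k s x = (if x \<in> space (M (c k))
     then SOME p. p \<in> carrier (H x (c k)) \<and>
       (\<forall>u\<in>carrier (H x (c k)). cinner (Ht x) u (s x \<ominus>\<^bsub>Ht x\<^esub> p) = 0)
     else \<zero>\<^bsub>Ht x\<^esub>)"

text \<open>Existence comes from completeness of the stage fibre. Orthogonality is expressed in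
  \<open>Ht x\<close>, where \<open>s x\<close> lies, and it determines the projection, so the
  choice by \<open>SOME\<close> is no real choice.\<close>

lemma proj:
  assumes x: "x \<in> space (M (c k))" and s: "s x \<in> carrier (Ht x)"
  shows proj_closed: "proj k s x \<in> carrier (H x (c k))"
    and proj_orth: "u \<in> carrier (H x (c k)) \<Longrightarrow> cinner (Ht x) u (s x \<ominus>\<^bsub>Ht x\<^esub> proj k s x) = 0"
proof -
  have X: "x \<in> X" by (rule space_in_X[OF c_in x])
  obtain p where "p \<in> carrier (H x (c k))"
    "\<And>u. u \<in> carrier (H x (c k)) \<Longrightarrow> cinner (Ht x) u (s x \<ominus>\<^bsub>Ht x\<^esub> p) = 0"
    by (rule isometric_inclusion.orthogonal_projection[OF fibre_inclusion[OF X c_in] hilbert_H[OF X c_in] s])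
      (rule that)
  then have "\<exists>p. p \<in> carrier (H x (c k)) \<and>
      (\<forall>u\<in>carrier (H x (c k)). cinner (Ht x) u (s x \<ominus>\<^bsub>Ht x\<^esub> p) = 0)" by blast
  from someI_ex[OF this] have "proj k s x \<in> carrier (H x (c k)) \<and>
      (\<forall>u\<in>carrier (H x (c k)). cinner (Ht x) u (s x \<ominus>\<^bsub>Ht x\<^esub> proj k s x) = 0)"
    unfolding proj_def if_P[OF x] .
  then show "proj k s x \<in> carrier (H x (c k))"
    "u \<in> carrier (H x (c k)) \<Longrightarrow> cinner (Ht x) u (s x \<ominus>\<^bsub>Ht x\<^esub> proj k s x) = 0" by auto
qed

lemma proj_zero: "x \<notin> space (M (c k)) \<Longrightarrow> proj k s x = \<zero>\<^bsub>Ht x\<^esub>"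
  by (simp add: proj_def)

text \<open>The difference of the projection and \<open>u\<close> lies in the stage fibre and is
  therefore orthogonal to the remainder. The case \<open>u = 0\<close> gives the norm bounds,
  general \<open>u\<close> the best approximation property.\<close>

lemma proj_pythagoras:
  assumes x: "x \<in> space (M (c k))" and s: "s x \<in> carrier (Ht x)" and u: "u \<in> carrier (H x (c k))"
  shows "(vnorm (Ht x) (s x \<ominus>\<^bsub>Ht x\<^esub> u))\<^sup>2 = (vnorm (Ht x) (s x \<ominus>\<^bsub>Ht x\<^esub> proj k s x))\<^sup>2
    + (vnorm (Ht x) (proj k s x \<ominus>\<^bsub>Ht x\<^esub> u))\<^sup>2"
proof -
  have X: "x \<in> X" by (rule space_in_X[OF c_in x])
  interpret isometric_inclusion "H x (c k)" "Ht x" by (rule fibre_inclusion[OF X c_in])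
  define p where "p = proj k s x"
  have p: "p \<in> carrier (H x (c k))" unfolding p_def by (rule proj_closed[where s = s, OF x s])
  have c: "p \<in> carrier (Ht x)" "u \<in> carrier (Ht x)" using p u carrier_mono by auto
  have "p \<ominus>\<^bsub>Ht x\<^esub> u \<in> carrier (H x (c k))" using p u by (simp flip: minus_eq)
  then have "cinner (Ht x) (p \<ominus>\<^bsub>Ht x\<^esub> u) (s x \<ominus>\<^bsub>Ht x\<^esub> p) = 0"
    unfolding p_def by (rule proj_orth[where s = s, OF x s])
  then have "cinner (Ht x) (s x \<ominus>\<^bsub>Ht x\<^esub> p) (p \<ominus>\<^bsub>Ht x\<^esub> u) = 0"
    using V.cinner_commute[of "p \<ominus>\<^bsub>Ht x\<^esub> u" "s x \<ominus>\<^bsub>Ht x\<^esub> p"] c s by simp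
  then show ?thesis
    using V.vnorm_add_power2[of "s x \<ominus>\<^bsub>Ht x\<^esub> p" "p \<ominus>\<^bsub>Ht x\<^esub> u"] c s
    by (simp add: V.minus_add_minus flip: p_def)
qed

text \<open>On the stage both estimates are \<open>proj_pythagoras\<close> at \<open>u = 0\<close>;
  off the stage the projection is zero and the remainder is \<open>s x\<close> itself.\<close>

lemma proj_bounds:
  assumes x: "x \<in> X" and s: "s x \<in> carrier (Ht x)"
  shows "proj k s x \<in> carrier (Ht x)"
    and "vnorm (Ht x) (proj k s x) \<le> vnorm (Ht x) (s x)"
    and "vnorm (Ht x) (s x \<ominus>\<^bsub>Ht x\<^esub> proj k s x) \<le> vnorm (Ht x) (s x)"
proof -
  interpret V: complex_inner_space "Ht x" by (rule inner_space_Ht[OF x])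
  show p: "proj k s x \<in> carrier (Ht x)"
    using proj_closed[of x k s] fibre_closed[OF x c_in] s by (cases "x \<in> space (M (c k))") (auto simp: proj_zero)
  have "vnorm (Ht x) (proj k s x) \<le> vnorm (Ht x) (s x) \<and>
      vnorm (Ht x) (s x \<ominus>\<^bsub>Ht x\<^esub> proj k s x) \<le> vnorm (Ht x) (s x)"
  proof (cases "x \<in> space (M (c k))")
    case True
    interpret isometric_inclusion "H x (c k)" "Ht x" by (rule fibre_inclusion[OF x c_in])
    have "\<zero>\<^bsub>Ht x\<^esub> \<in> carrier (H x (c k))" using U.M.zero_closed by (simp add: zero_eq)
    from proj_pythagoras[where s = s, OF True s this]
    have "(vnorm (Ht x) (s x))\<^sup>2 = (vnorm (Ht x) (s x \<ominus>\<^bsub>Ht x\<^esub> proj k s x))\<^sup>2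
        + (vnorm (Ht x) (proj k s x))\<^sup>2" using s p by simp
    then show ?thesis
      using s p by (auto intro: power2_le_imp_le[OF _ V.vnorm_nonneg[OF s]])
  qed (use s in \<open>simp add: proj_zero\<close>)
  then show "vnorm (Ht x) (proj k s x) \<le> vnorm (Ht x) (s x)"
    "vnorm (Ht x) (s x \<ominus>\<^bsub>Ht x\<^esub> proj k s x) \<le> vnorm (Ht x) (s x)" by auto
qed

text \<open>By orthogonality the inner product of \<open>F (c k) n\<close> with the projection is
  the one with \<open>s\<close>. On the stage \<open>F (c k) n\<close> coincides with a member of
  \<open>G\<close>, so this function is measurable because \<open>s\<close> is Borel. Integrability
  follows since projecting does not increase norms.\<close>

lemma proj_LS:
  assumes s: "s \<in> tilde.L"
  shows "proj k s \<in> LS (c k)"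
proof -
  note s_closed = tilde.L_closed[OF s]
  interpret fr: framed_bundle "space (M (c k))" "\<lambda>x. H x (c k)" "T (c k)" "F (c k)"
    by (rule framed[OF c_in])
  note XX = space_in_X[OF c_in]
  have pc: "proj k s x \<in> carrier (H x (c k))" if "x \<in> space (M (c k))" for x
    by (rule proj_closed[where s = s, OF that s_closed[OF XX[OF that]]])
  have sec: "is_section X (\<lambda>x. ind_lim \<Lambda> (H x)) (proj k s)"
    unfolding is_section_def
  proof
    fix x assume x: "x \<in> X"
    interpret U: complex_inner_space "H x (c k)"
      by (rule hilbert_imp_complex_inner_space[OF hilbert_H[OF x c_in]])
    have "proj k s x \<in> carrier (H x (c k))"
      using pc[of x] U.M.zero_closed isometric_subspaceD(2)[OF fibre_subspace[OF x c_in, of k]]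
      by (cases "x \<in> space (M (c k))") (simp_all add: proj_zero)
    then show "proj k s x \<in> carrier (ind_lim \<Lambda> (H x))" using c_in by auto
  qed
  have "borel_section (space (M (c k))) (\<lambda>x. H x (c k)) (T (c k)) (proj k s)"
  proof (rule fr.borel_sectionI[OF pc])
    fix n x assume x: "x \<in> space (M (c k))"
    interpret isometric_inclusion "H x (c k)" "Ht x" by (rule fibre_inclusion[OF XX[OF x] c_in])
    have "cinner (Ht x) (F (c k) n x) (s x \<ominus>\<^bsub>Ht x\<^esub> proj k s x) = 0"
      by (rule proj_orth[where s = s, OF x s_closed[OF XX[OF x]] fr.f_closed[OF x]])
    then show "cinner (H x (c k)) (F (c k) n x) (proj k s x)
        = cinner (Ht x) (G (prod_encode (k, n)) x) (s x)"
      using pc[OF x] fr.f_closed[OF x] s_closed[OF XX[OF x]]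
      by (simp add: cinner_eq V.cinner_minus_right carrier_mono G_prod_encode g_eq[OF x])
  next
    show "(\<lambda>x. cinner (Ht x) (G (prod_encode (k, n)) x) (s x)) \<in> borel_measurable fr.B" for n
      unfolding measurable_cong_sets[OF sets_base_M[OF c_in] refl]
      using tilde.borel_section_measurable[OF tilde.L_borel[OF s]]
      by (intro measurable_stage c_in) (simp only: tilde.measurable_\<rho>)
  qed
  moreover have "(\<integral>\<^sup>+x. ennreal ((vnorm (H x (c k)) (proj k s x))\<^sup>2) \<partial>M (c k)) < \<infinity>"
  proof -
    have "(\<integral>\<^sup>+x. ennreal ((vnorm (H x (c k)) (proj k s x))\<^sup>2) \<partial>M (c k))
        \<le> (\<integral>\<^sup>+x. ennreal ((vnorm (Ht x) (s x))\<^sup>2) \<partial>M (c k))"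
    proof (intro nn_integral_mono ennreal_leI power_mono)
      fix x assume x: "x \<in> space (M (c k))"
      interpret isometric_inclusion "H x (c k)" "Ht x" by (rule fibre_inclusion[OF XX[OF x] c_in])
      show "vnorm (H x (c k)) (proj k s x) \<le> vnorm (Ht x) (s x)"
        using proj_bounds(2)[OF XX[OF x], of s, OF s_closed[OF XX[OF x]]] pc[OF x]
        by (simp add: vnorm_eq)
      show "0 \<le> vnorm (H x (c k)) (proj k s x)" using pc[OF x] by simp
    qed
    also have "\<dots> \<le> (\<integral>\<^sup>+x. ennreal ((vnorm (Ht x) (s x))\<^sup>2) \<partial>Mt)"
      unfolding nn_integral_stage[OF c_in] by (intro nn_integral_mono) (simp add: indicator_def)
    also have "\<dots> < \<infinity>" by (rule tilde.L_finite[OF s])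
    finally show ?thesis .
  qed
  ultimately show ?thesis
    using sec unfolding local_sections_def square_integrable_sections_def
    by (simp add: zero_lim proj_zero del: ind_lim_simps)
qed

text \<open>Some vector \<open>u\<close> of some stage fibre is within \<open>e\<close> of
  \<open>s x\<close>. Once the stage contains both \<open>u\<close> and \<open>x\<close>, the
  projection is at least as close to \<open>s x\<close> as \<open>u\<close> is.\<close>

lemma proj_tendsto:
  assumes x: "x \<in> X" and s: "s x \<in> carrier (Ht x)"
  shows "(\<lambda>k. vnorm (Ht x) (s x \<ominus>\<^bsub>Ht x\<^esub> proj k s x)) \<longlonglongrightarrow> 0"
proof (rule LIMSEQ_I)
  interpret V: complex_inner_space "Ht x" by (rule inner_space_Ht[OF x])
  fix e :: real assume e: "e > 0"
  obtain m u where u: "u \<in> carrier (H x (c m))" and lt: "vnorm (Ht x) (s x \<ominus>\<^bsub>Ht x\<^esub> u) < e"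
    by (rule fibre_dense[OF x s e])
  have "norm (vnorm (Ht x) (s x \<ominus>\<^bsub>Ht x\<^esub> proj k s x) - 0) < e" if k: "k \<ge> max m (first_index x)" for k
  proof -
    have xk: "x \<in> space (M (c k))" using first_index_le[OF x, of k] k by simp
    have uk: "u \<in> carrier (H x (c k))" by (rule fibre_mono[OF x _ u]) (use k in simp)
    have c: "proj k s x \<in> carrier (Ht x)" "u \<in> carrier (Ht x)"
      using proj_bounds(1)[OF x, of s, OF s] fibre_closed[OF x c_in uk] by auto
    have "vnorm (Ht x) (s x \<ominus>\<^bsub>Ht x\<^esub> proj k s x) \<le> vnorm (Ht x) (s x \<ominus>\<^bsub>Ht x\<^esub> u)"
      by (rule power2_le_imp_le) (use proj_pythagoras[where s = s, OF xk s uk] c s in auto)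
    then show ?thesis using lt c s by simp
  qed
  then show "\<exists>N. \<forall>k\<ge>N. norm (vnorm (Ht x) (s x \<ominus>\<^bsub>Ht x\<^esub> proj k s x) - 0) < e" by blast
qed

lemma local_direct_integral_dense:
  "dense_subset tilde.Q (carrier (local_direct_integral \<Lambda> M H T))"
  unfolding tilde.Q.dense_subset_iff
proof (intro conjI ballI allI impI)
  show "carrier (local_direct_integral \<Lambda> M H T) \<subseteq> carrier tilde.Q"
    using isometric_subspaceD(1)[OF local_direct_integral_subspace] by blast
  fix v and e :: real assume "v \<in> carrier tilde.Q" and e: "e > 0"
  then obtain s where s: "v = tilde.cl s" "s \<in> tilde.L" by (auto simp: tilde.Q_carrier)
  note s_closed = tilde.L_closed[OF s(2)]
  have pL: "proj k s \<in> tilde.L" for k by (rule LS_subset_L[OF c_in proj_LS[OF s(2)]])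
  let ?d = "\<lambda>k x. ennreal ((vnorm (Ht x) (s x \<ominus>\<^bsub>Ht x\<^esub> proj k s x))\<^sup>2)"
  \<comment> \<open>The majorant is the squared norm of \<open>s\<close>, by the last estimate of
    \<open>proj_bounds\<close>. The indices range over a sequence, as dominated convergence
    requires; this is where projecting along \<open>c\<close> instead of all of
    \<open>\<Lambda>\<close> matters.\<close>
  have "(\<lambda>k. \<integral>\<^sup>+x. ?d k x \<partial>Mt) \<longlonglongrightarrow> (\<integral>\<^sup>+x. 0 \<partial>Mt)"
  proof (rule nn_integral_dominated_convergence)
    show "?d k \<in> borel_measurable Mt" for k
      by (intro measurable_compose[OF _ measurable_ennreal] borel_measurable_power
          tilde.vnorm_measurable tilde.L_borel tilde.L_minus s pL)
    show "(\<lambda>x. ennreal ((vnorm (Ht x) (s x))\<^sup>2)) \<in> borel_measurable Mt"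
      by (intro measurable_compose[OF _ measurable_ennreal] borel_measurable_power
          tilde.vnorm_measurable tilde.L_borel s)
    show "(\<integral>\<^sup>+x. ennreal ((vnorm (Ht x) (s x))\<^sup>2) \<partial>Mt) < \<infinity>" by (rule tilde.L_finite[OF s(2)])
    show "AE x in Mt. ?d k x \<le> ennreal ((vnorm (Ht x) (s x))\<^sup>2)" for k
    proof (intro AE_I2 ennreal_leI power_mono)
      fix x assume "x \<in> space Mt"
      then have x: "x \<in> X" by simp
      interpret V: complex_inner_space "Ht x" by (rule inner_space_Ht[OF x])
      note b = proj_bounds[OF x, of s, OF s_closed[OF x]]
      show "vnorm (Ht x) (s x \<ominus>\<^bsub>Ht x\<^esub> proj k s x) \<le> vnorm (Ht x) (s x)" by (rule b(3))
      show "0 \<le> vnorm (Ht x) (s x \<ominus>\<^bsub>Ht x\<^esub> proj k s x)" using b(1) s_closed[OF x] by simp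
    qed
    show "AE x in Mt. (\<lambda>k. ?d k x) \<longlonglongrightarrow> 0"
    proof (rule AE_I2)
      fix x assume "x \<in> space Mt"
      then have x: "x \<in> X" by simp
      have "(\<lambda>k. ?d k x) \<longlonglongrightarrow> ennreal (0\<^sup>2)"
        by (intro tendsto_ennrealI tendsto_power proj_tendsto x s_closed)
      then show "(\<lambda>k. ?d k x) \<longlonglongrightarrow> 0" by simp
    qed
  qed simp
  then have "(\<lambda>k. \<integral>\<^sup>+x. ?d k x \<partial>Mt) \<longlonglongrightarrow> 0" by simp
  then have "\<forall>\<^sub>F k in sequentially. (\<integral>\<^sup>+x. ?d k x \<partial>Mt) < ennreal (e\<^sup>2)"
    using e by (intro order_tendstoD(2)) auto
  then obtain k where "(\<integral>\<^sup>+x. ?d k x \<partial>Mt) < ennreal (e\<^sup>2)" by (auto simp: eventually_sequentially)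
  then have "(vnorm tilde.Q (tilde.cl s \<ominus>\<^bsub>tilde.Q\<^esub> tilde.cl (proj k s)))\<^sup>2 < e\<^sup>2"
    unfolding tilde.vnorm_Q_minus[OF s(2) pL, symmetric] by (simp add: ennreal_less_iff)
  then have "vnorm tilde.Q (v \<ominus>\<^bsub>tilde.Q\<^esub> tilde.cl (proj k s)) < e"
    unfolding s(1) by (rule power2_less_imp_less) (use e in simp)
  moreover have "tilde.cl (proj k s) \<in> carrier (local_direct_integral \<Lambda> M H T)"
    using proj_LS[OF s(2), of k] c_in[of k] by (auto simp: local_direct_integral_def local_L2_def)
  ultimately show "\<exists>t\<in>carrier (local_direct_integral \<Lambda> M H T). vnorm tilde.Q (v \<ominus>\<^bsub>tilde.Q\<^esub> t) < e"
    by blast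
qed

end

theorem theorem3p5:
  fixes \<Lambda> :: "'i set" and leq :: "'i \<Rightarrow> 'i \<Rightarrow> bool"
    and M :: "'i \<Rightarrow> 'x measure"
    and H :: "'x \<Rightarrow> 'i \<Rightarrow> 'v inner_space"
    and T :: "'i \<Rightarrow> ('x \<times> 'v) measure"
    and Ht :: "'x \<Rightarrow> 'v inner_space"
  assumes "countable \<Lambda>"
    and "locally_hilbert_bundle \<Lambda> leq M H T"
    and "\<And>x. x \<in> lim_space \<Lambda> M \<Longrightarrow> hilbert_completion (ind_lim \<Lambda> (H x)) (Ht x)"
  shows "let X = lim_space \<Lambda> M;
             Mt = tilde_measure \<Lambda> M;
             Tt = tilde_total_space X Ht \<Lambda> T;
             L2 = direct_integral X Ht Tt Mt;
             L2loc = local_direct_integral \<Lambda> M H T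
         in (borel_bundle X Ht Tt \<and> tilde_sets X \<Lambda> M = base_sets X Tt) \<and>
            (hilbert L2 \<and> isometric_subspace L2loc L2 \<and> dense_subset L2 (carrier L2loc))"
proof -
  have "directed_set \<Lambda> leq"
    using assms(2) by (simp add: locally_hilbert_bundle_def strictly_inductive_measure_def
        strictly_inductive_measurable_def)
  with assms(1) obtain c where "cofinal_sequence \<Lambda> leq c"
    by (rule countable_directed_cofinal_sequence)
  then interpret bundle_limit \<Lambda> leq c M H T Ht
    using assms(2,3) by (simp add: bundle_limit_def bundle_limit_axioms_def)
  show ?thesis
    unfolding Let_def
    by (intro conjI borel_bundle_tilde tilde_sets_eq_base_sets tilde.hilbert_Q
        local_direct_integral_subspace local_direct_integral_dense)
qed

end
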